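(* There is a randomized algorithm with the following guarantee. Let $\varepsilon\in(0,1)$, $A\in\mathbb{R}^{n\times n}$, $b\in\mathbb{R}^n$, and $B=\log(n/\varepsilon)$. Given $2^{-\Omega(B)}$-matvecs for $A$ and $A^\top$, and a number $Z$ with $Z=\Theta(\|A\|)$, the algorithm uses $O(n)$ numbers in $2^{-\Omega(B)}$-arithmetic and $O(n\log n)$ random bits, makes $O(n\log(1/\varepsilon)/\varepsilon^3)$ matvec queries, and computes $x\in\mathbb{R}^n$ such that, with probability at least $0.9$, there exists $\tilde A\in\mathbb{R}^{n\times n}$ with $\tilde Ax=b$ and $\|\tilde A-A\|\leq\varepsilon\|A\|$.
   Context: $\|\cdot\|$ is the spectral norm. $\epsilon_{\mathrm{mach}}$-arithmetic: each basic operation $\circ\in\{+,-,\times,\div\}$ returns $\mathrm{fl}(x\circ y)=(1+\theta)(x\circ y)$ and square root returns $\mathrm{fl}(\sqrt x)=(1+\theta)\sqrt x$ for some $|\theta|\leq\epsilon_{\mathrm{mach}}$ (chosen adversarially). An algorithm $\mathcal{A}$ is an $\epsilon_{\mathrm{mach}}$-matvec for $A$ if $\|\mathcal{A}(w)-Aw\|_2\leq\epsilon_{\mathrm{mach}}\|A\|\|w\|_2$ for every vector $w$. "$2^{-\Omega(B)}$" means $\epsilon_{\mathrm{mach}}\leq 2^{-cB}$ for a sufficiently large absolute constant $c$; $Z=\Theta(\|A\|)$ means $Z\in[\|A\|/C,C\|A\|]$ for a fixed constant $C$, and the implied constants in $O(\cdot)$ may depend on $C$.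
   Formalization: The case A = 0, b ≠ 0 is excluded (no Ã exists there), and log(n/ε) in B and log(1/ε) in the query bound are read as at least 1 (base 2), since for ε near 1 the literal query bound would allow no query at all. *)

theory Defs
  imports
    "HOL-Probability.Probability_Mass_Function"
    "HOL-Analysis.L2_Norm"
    "Jordan_Normal_Form.Matrix"
begin

section \<open>Vectors and matrices\<close>

definition vnorm :: "real Matrix.vec \<Rightarrow> real" where
  "vnorm v = L2_set (vec_index v) {..<dim_vec v}"

definition spectral_norm :: "real mat \<Rightarrow> real" where
  "spectral_norm A =
     Sup {vnorm (A *\<^sub>v v) | v. v \<in> carrier_vec (dim_col A) \<and> vnorm v \<le> 1}"

definition eps_matvec ::
    "real \<Rightarrow> real mat \<Rightarrow> (real Matrix.vec \<Rightarrow> real Matrix.vec) \<Rightarrow> bool" where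
  "eps_matvec u A F \<longleftrightarrow>
     (\<forall>w \<in> carrier_vec (dim_col A).
        F w \<in> carrier_vec (dim_row A) \<and>
        vnorm (F w - A *\<^sub>v w) \<le> u * spectral_norm A * vnorm w)"

section \<open>Machine model\<close>

text \<open>
  Algorithms are programs of a small imperative language, so that one finite program serves all
  \<open>n\<close>, \<open>\<epsilon>\<close>, \<open>A\<close>, \<open>b\<close>, \<open>Z\<close>. A program sees finitely many word-sized registers for natural numbers
  (loop counters and addresses) and an array of real numbers subject to rounding. It has access
  to \<open>A\<close> only through the two matrix-vector instructions.
\<close>

datatype aexp = N nat | V nat | Add aexp aexp | Sub aexp aexp | Mul aexp aexp

primrec aval :: "aexp \<Rightarrow> (nat \<Rightarrow> nat) \<Rightarrow> nat" where
  "aval (N k) r = k"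
| "aval (V x) r = r x"
| "aval (Add a a') r = aval a r + aval a' r"
| "aval (Sub a a') r = aval a r - aval a' r"
| "aval (Mul a a') r = aval a r * aval a' r"

datatype fop = FAdd | FSub | FMul | FDiv

fun fop_val :: "fop \<Rightarrow> real \<Rightarrow> real \<Rightarrow> real" where
  "fop_val FAdd x y = x + y"
| "fop_val FSub x y = x - y"
| "fop_val FMul x y = x * y"
| "fop_val FDiv x y = x / y"

text \<open>
  Operands of real-valued instructions are addresses in the array, the first one being the
  destination. \<open>RLess\<close> compares the contents of two array cells, \<open>NLess\<close> compares natural numbers.
\<close>

datatype bexp = NLess aexp aexp | RLess aexp aexp | Neg bexp | Conj bexp bexp

datatype com =
    Skip
  | Assign nat aexp
  | Flip nat
  | Load aexp aexp
  | Copy aexp aexp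
  | Arith fop aexp aexp aexp
  | Sqrt aexp aexp
  | MatVec aexp aexp
  | MatVecT aexp aexp
  | Seq com com
  | Cond bexp com com
  | While bexp com

record state =
  regs :: "nat \<Rightarrow> nat"
  mem :: "real list"
  tape :: "bool list"
  nops :: nat
  queries :: nat

primrec bval :: "bexp \<Rightarrow> state \<Rightarrow> bool" where
  "bval (NLess a a') s = (aval a (regs s) < aval a' (regs s))"
| "bval (RLess a a') s = (mem s ! aval a (regs s) < mem s ! aval a' (regs s))"
| "bval (Neg g) s = (\<not> bval g s)"
| "bval (Conj g g') s = (bval g s \<and> bval g' s)"

primrec bsafe :: "bexp \<Rightarrow> state \<Rightarrow> bool" where
  "bsafe (NLess a a') s = True"
| "bsafe (RLess a a') s =
     (aval a (regs s) < length (mem s) \<and> aval a' (regs s) < length (mem s))"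
| "bsafe (Neg g) s = bsafe g s"
| "bsafe (Conj g g') s = (bsafe g s \<and> bsafe g' s)"

text \<open>
  \<open>theta E k\<close> is the relative error of the \<open>k\<close>-th rounded operation of a run, and \<open>mv E k\<close>,
  \<open>mvT E k\<close> answer the query with index \<open>k\<close> (both kinds of queries share one counter). As all
  sequences are quantified over, this covers errors that depend on the whole history of the run
  and matrix-vector procedures that answer the same query differently at different times.
  \<open>wmax E\<close> is the largest number that fits into a register.
\<close>

record env =
  ndim :: nat
  wmax :: real
  theta :: "nat \<Rightarrow> real"
  mv :: "nat \<Rightarrow> real Matrix.vec \<Rightarrow> real Matrix.vec"
  mvT :: "nat \<Rightarrow> real Matrix.vec \<Rightarrow> real Matrix.vec"

definition set_reg :: "nat \<Rightarrow> nat \<Rightarrow> state \<Rightarrow> state" where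
  "set_reg x v s = s\<lparr>regs := (regs s)(x := v)\<rparr>"

definition store_rounded :: "env \<Rightarrow> nat \<Rightarrow> real \<Rightarrow> state \<Rightarrow> state" where
  "store_rounded E i z s =
     s\<lparr>mem := (mem s)[i := (1 + theta E (nops s)) * z], nops := Suc (nops s)\<rparr>"

definition block :: "nat \<Rightarrow> nat \<Rightarrow> state \<Rightarrow> real Matrix.vec" where
  "block m i s = vec_of_list (take m (drop i (mem s)))"

definition store_answer :: "env \<Rightarrow> nat \<Rightarrow> real Matrix.vec \<Rightarrow> state \<Rightarrow> state" where
  "store_answer E i y s =
     s\<lparr>mem := take i (mem s) @ list_of_vec y @ drop (i + ndim E) (mem s),
       queries := Suc (queries s)\<rparr>"

text \<open>
  Big-step semantics. There is no rule for a faulty step (array access out of bounds, register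
  overflow, exhausted random tape, division by zero, square root of a negative number), so
  \<open>\<exists>t. exec E c s t\<close> means that the run terminates without a fault.
\<close>

inductive exec :: "env \<Rightarrow> com \<Rightarrow> state \<Rightarrow> state \<Rightarrow> bool" for E :: env where
  Skip: "exec E Skip s s"
| Assign: "real (aval a (regs s)) \<le> wmax E \<Longrightarrow>
    exec E (Assign x a) s (set_reg x (aval a (regs s)) s)"
| Flip: "tape s = \<beta> # w \<Longrightarrow>
    exec E (Flip x) s (set_reg x (of_bool \<beta>) (s\<lparr>tape := w\<rparr>))"
| Load: "aval d (regs s) < length (mem s) \<Longrightarrow> real (aval a (regs s)) \<le> wmax E \<Longrightarrow>
    exec E (Load d a) s (store_rounded E (aval d (regs s)) (real (aval a (regs s))) s)"
| Copy: "aval d (regs s) < length (mem s) \<Longrightarrow> aval a (regs s) < length (mem s) \<Longrightarrow>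
    exec E (Copy d a) s (s\<lparr>mem := (mem s)[aval d (regs s) := mem s ! aval a (regs s)]\<rparr>)"
| Arith: "aval d (regs s) < length (mem s) \<Longrightarrow>
    aval a (regs s) < length (mem s) \<Longrightarrow> aval a' (regs s) < length (mem s) \<Longrightarrow>
    (f = FDiv \<Longrightarrow> mem s ! aval a' (regs s) \<noteq> 0) \<Longrightarrow>
    exec E (Arith f d a a') s
      (store_rounded E (aval d (regs s))
        (fop_val f (mem s ! aval a (regs s)) (mem s ! aval a' (regs s))) s)"
| Sqrt: "aval d (regs s) < length (mem s) \<Longrightarrow> aval a (regs s) < length (mem s) \<Longrightarrow>
    0 \<le> mem s ! aval a (regs s) \<Longrightarrow>
    exec E (Sqrt d a) s
      (store_rounded E (aval d (regs s)) (sqrt (mem s ! aval a (regs s))) s)"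
| MatVec: "aval d (regs s) + ndim E \<le> length (mem s) \<Longrightarrow>
    aval a (regs s) + ndim E \<le> length (mem s) \<Longrightarrow>
    exec E (MatVec d a) s
      (store_answer E (aval d (regs s))
        (mv E (queries s) (block (ndim E) (aval a (regs s)) s)) s)"
| MatVecT: "aval d (regs s) + ndim E \<le> length (mem s) \<Longrightarrow>
    aval a (regs s) + ndim E \<le> length (mem s) \<Longrightarrow>
    exec E (MatVecT d a) s
      (store_answer E (aval d (regs s))
        (mvT E (queries s) (block (ndim E) (aval a (regs s)) s)) s)"
| Seq: "exec E c s s' \<Longrightarrow> exec E c' s' t \<Longrightarrow> exec E (Seq c c') s t"
| CondTrue: "bsafe g s \<Longrightarrow> bval g s \<Longrightarrow> exec E c s t \<Longrightarrow> exec E (Cond g c c') s t"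
| CondFalse: "bsafe g s \<Longrightarrow> \<not> bval g s \<Longrightarrow> exec E c' s t \<Longrightarrow> exec E (Cond g c c') s t"
| WhileFalse: "bsafe g s \<Longrightarrow> \<not> bval g s \<Longrightarrow> exec E (While g c) s s"
| WhileTrue: "bsafe g s \<Longrightarrow> bval g s \<Longrightarrow> exec E c s s' \<Longrightarrow> exec E (While g c) s' t \<Longrightarrow>
    exec E (While g c) s t"

section \<open>Inputs and resource bounds\<close>

text \<open>
  Logarithms are read as at least 1 where they measure precision or query complexity. This
  matters only if the argument is below 2: literally, \<open>log (1/\<epsilon>)\<close> tends to 0 for \<open>\<epsilon>\<close> tending to 1,
  and no query at all would be allowed.
\<close>

definition lg :: "real \<Rightarrow> real" where
  "lg x = max 1 (log 2 x)"

definition precision :: "nat \<Rightarrow> real \<Rightarrow> real" where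
  "precision n \<epsilon> = lg (real n / \<epsilon>)"

definition admissible_env ::
    "nat \<Rightarrow> nat \<Rightarrow> real \<Rightarrow> real \<Rightarrow> real mat \<Rightarrow> env \<Rightarrow> bool" where
  "admissible_env K n \<epsilon> u A E \<longleftrightarrow>
     ndim E = n \<and> wmax E = 2 powr (real K * precision n \<epsilon>) \<and>
     (\<forall>k. \<bar>theta E k\<bar> \<le> u) \<and>
     (\<forall>k. eps_matvec u A (mv E k)) \<and> (\<forall>k. eps_matvec u (transpose_mat A) (mvT E k))"

text \<open>
  The array holds \<open>b\<close>, \<open>\<epsilon>\<close>, \<open>Z\<close> and \<open>K * n\<close> work cells, and its length never changes.
  Register 0 holds \<open>n\<close>. The result \<open>x\<close> is left in the first \<open>n\<close> cells.
\<close>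

definition init_state ::
    "nat \<Rightarrow> nat \<Rightarrow> real \<Rightarrow> real Matrix.vec \<Rightarrow> real \<Rightarrow> bool list \<Rightarrow> state" where
  "init_state K n \<epsilon> b Z w =
     \<lparr>regs = (\<lambda>_. 0)(0 := n),
      mem = list_of_vec b @ [\<epsilon>, Z] @ replicate (K * n) 0,
      tape = w, nops = 0, queries = 0\<rparr>"

definition result :: "nat \<Rightarrow> state \<Rightarrow> real Matrix.vec" where
  "result n t = block n 0 t"

definition random_tapes :: "nat \<Rightarrow> nat \<Rightarrow> bool list set" where
  "random_tapes K n = {w. length w = nat \<lfloor>real K * real n * log 2 (real n)\<rfloor>}"

definition query_bound :: "nat \<Rightarrow> nat \<Rightarrow> real \<Rightarrow> real" where
  "query_bound K n \<epsilon> = real K * (real n * lg (1 / \<epsilon>) / \<epsilon> ^ 3)"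

definition backward_solution ::
    "nat \<Rightarrow> real \<Rightarrow> real mat \<Rightarrow> real Matrix.vec \<Rightarrow> real Matrix.vec \<Rightarrow> bool" where
  "backward_solution n \<epsilon> A b x \<longleftrightarrow>
     (\<exists>A' \<in> carrier_mat n n. A' *\<^sub>v x = b \<and> spectral_norm (A' - A) \<le> \<epsilon> * spectral_norm A)"

end

theory Submission
  imports Defs "Jordan_Normal_Form.Determinant"
begin

text \<open>
  For a scale \<open>\<beta>\<close> comparable to \<open>\<parallel>A\<parallel>\<close> consider the \<open>n \<times> (n + 1)\<close> matrix \<open>M = [A, \<beta> b/\<parallel>b\<parallel>]\<close>. If
  \<open>z = (x, \<tau>)\<close> satisfies \<open>\<parallel>M z\<parallel> \<le> \<epsilon>' \<beta> \<parallel>z\<parallel>\<close>, then, after moving \<open>\<tau>\<close> away from 0 by \<open>\<epsilon>' \<parallel>x\<parallel>\<close>, the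
  vector \<open>y = - \<parallel>b\<parallel> x / (\<beta> \<tau>)\<close> has residual \<open>\<parallel>A y - b\<parallel> = O(\<epsilon>' \<parallel>A\<parallel> \<parallel>y\<parallel>)\<close>, and a rank one correction of
  \<open>A\<close> turns it into an exact solution. No case distinction on the condition number of \<open>A\<close> is needed.

  Such a \<open>z\<close> is found by iterating \<open>z \<mapsto> z - M\<^sup>T M z / (4 \<beta>\<^sup>2)\<close> from a random vector \<open>g\<close>. Having more
  columns than rows, \<open>M\<close> has an exact unit null vector \<open>e\<close>, and the iteration preserves \<open>\<langle>z, e\<rangle>\<close>, which
  keeps \<open>\<parallel>z\<parallel>\<close> bounded away from 0. The sequence \<open>\<parallel>z\<^sub>k\<parallel>\<^sup>2\<close> is log-convex, so its last relative decrease,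
  which dominates \<open>\<parallel>M z\<parallel>\<^sup>2 / (4 \<beta>\<^sup>2 \<parallel>z\<parallel>\<^sup>2)\<close>, is at most the average one, \<open>O(log n / T)\<close>. As the exact
  iteration is a contraction, rounding errors only add up.

  Since the precision must not depend on \<open>C\<close>, a step size derived from \<open>Z\<close> alone would be too small.
  Instead the scales \<open>p Z / C\<close> are tried for \<open>p = 1, 2, \<dots>\<close> until the computed \<open>\<parallel>M z\<parallel>\<close> is small enough;
  this happens no later than at the first scale above \<open>\<parallel>A\<parallel>\<close>. For \<open>n = 1\<close> there are no random bits, and
  the system is solved by one division.
\<close>

text \<open>The obstacle is that errors and query answers are chosen after the tape, so the random
  event must concern the tape alone. It is a lower bound for |<g, e>|, where e is a unit null vector
  of M at one scale p with \<beta> between ||A|| and 2 ||A||; p and e depend only on A, b, Z and C.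
  The other scales carry no probabilistic claim. At a scale below ||A|| the iterate may grow without
  control, which does no harm: the program still runs without fault, and whatever passes the test at
  a scale up to 2 ||A|| yields a solution. The event excludes a failed test at p, so no scale beyond
  p is reached, and one start vector can serve all scales.

  The budgets are looser than the method: 4 (n + 1) random bits, and of order n/\<epsilon>^2 queries
  per scale, with n standing in for log n. The number of scales depends on C and enters the query
  count and the word size, but not the precision. Rounding is harmless because order n/\<epsilon>^2
  steps, each with relative error of order n u, drift by far less than the guaranteed size of the
  iterate once u is below a fixed power of \<epsilon>/n.\<close>

section \<open>Euclidean norms\<close>

abbreviation nrm :: "nat \<Rightarrow> (nat \<Rightarrow> real) \<Rightarrow> real" where
  "nrm m f \<equiv> L2_set f {..<m}"

definition ip :: "nat \<Rightarrow> (nat \<Rightarrow> real) \<Rightarrow> (nat \<Rightarrow> real) \<Rightarrow> real" where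
  "ip m f g = (\<Sum>i<m. f i * g i)"

lemma ip_self: "ip m f f = (nrm m f)\<^sup>2"
  by (simp add: ip_def L2_set_def sum_nonneg power2_eq_square)

lemma ip_commute: "ip m f g = ip m g f"
  by (simp add: ip_def mult.commute)

lemma sum_abs_mult_le_nrm: "(\<Sum>i<m. \<bar>f i\<bar> * \<bar>g i\<bar>) \<le> nrm m f * nrm m g"
  by (rule L2_set_mult_ineq)

lemma abs_ip_le: "\<bar>ip m f g\<bar> \<le> nrm m f * nrm m g"
proof -
  have "\<bar>ip m f g\<bar> \<le> (\<Sum>i<m. \<bar>f i\<bar> * \<bar>g i\<bar>)"
    unfolding ip_def by (rule order_trans[OF sum_abs]) (simp add: abs_mult)
  then show ?thesis using sum_abs_mult_le_nrm[of f g m] by linarith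
qed

lemma nrm_Suc_sq: "(nrm (Suc n) f)\<^sup>2 = (nrm n f)\<^sup>2 + (f n)\<^sup>2"
  unfolding ip_self[symmetric] by (simp add: ip_def power2_eq_square)

lemma nrm_cong: "(\<And>i. i < m \<Longrightarrow> f i = g i) \<Longrightarrow> nrm m f = nrm m g"
  by (rule L2_set_cong) auto

lemma nrm_abs: "nrm m (\<lambda>i. \<bar>f i\<bar>) = nrm m f"
  by (simp add: L2_set_def)

lemma nrm_scale: "nrm m (\<lambda>i. c * f i) = \<bar>c\<bar> * nrm m f"
proof -
  have "nrm m (\<lambda>i. c * f i) = nrm m (\<lambda>i. \<bar>c\<bar> * f i)"
    by (simp add: L2_set_def power_mult_distrib)
  then show ?thesis by (simp add: L2_set_right_distrib)
qed

lemma nrm_mono_abs: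
  assumes "\<And>i. i < m \<Longrightarrow> \<bar>f i\<bar> \<le> g i"
  shows "nrm m f \<le> nrm m g"
proof -
  have "nrm m (\<lambda>i. \<bar>f i\<bar>) \<le> nrm m g"
    by (rule L2_set_mono) (use assms in auto)
  then show ?thesis by (simp add: nrm_abs)
qed

lemma nrm_add: "nrm m (\<lambda>i. f i + g i) \<le> nrm m f + nrm m g"
  by (rule L2_set_triangle_ineq)

lemma nrm_minus_commute: "nrm m (\<lambda>i. f i - g i) = nrm m (\<lambda>i. g i - f i)"
  by (simp add: L2_set_def power2_commute)

lemma nrm_diff_triangle: "nrm m f \<le> nrm m g + nrm m (\<lambda>i. f i - g i)"
  using nrm_add[of g "\<lambda>i. f i - g i" m] by simp

lemma nrm_triangle3: "nrm m (\<lambda>i. f i - h i) \<le> nrm m (\<lambda>i. f i - g i) + nrm m (\<lambda>i. g i - h i)"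
  using nrm_add[of "\<lambda>i. f i - g i" "\<lambda>i. g i - h i" m] by simp

lemma nrm_le_lincomb2:
  assumes "\<And>i. i < m \<Longrightarrow> \<bar>f i\<bar> \<le> a * \<bar>g i\<bar> + b * \<bar>h i\<bar>" "0 \<le> a" "0 \<le> b"
  shows "nrm m f \<le> a * nrm m g + b * nrm m h"
proof -
  have "nrm m f \<le> nrm m (\<lambda>i. a * \<bar>g i\<bar> + b * \<bar>h i\<bar>)"
    by (rule nrm_mono_abs) (use assms in auto)
  also have "\<dots> \<le> nrm m (\<lambda>i. a * \<bar>g i\<bar>) + nrm m (\<lambda>i. b * \<bar>h i\<bar>)"
    by (rule nrm_add)
  finally show ?thesis using assms by (simp add: nrm_scale nrm_abs)
qed

lemma nrm_le_lincomb3: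
  assumes "\<And>i. i < m \<Longrightarrow> \<bar>f i\<bar> \<le> a * \<bar>g i\<bar> + b * \<bar>h i\<bar> + c * \<bar>k i\<bar>" "0 \<le> a" "0 \<le> b" "0 \<le> c"
  shows "nrm m f \<le> a * nrm m g + b * nrm m h + c * nrm m k"
proof -
  have "nrm m f \<le> nrm m (\<lambda>i. (a * \<bar>g i\<bar> + b * \<bar>h i\<bar>) + c * \<bar>k i\<bar>)"
    by (rule nrm_mono_abs) (use assms in auto)
  also have "\<dots> \<le> nrm m (\<lambda>i. a * \<bar>g i\<bar> + b * \<bar>h i\<bar>) + nrm m (\<lambda>i. c * \<bar>k i\<bar>)"
    by (rule nrm_add)
  also have "nrm m (\<lambda>i. a * \<bar>g i\<bar> + b * \<bar>h i\<bar>) \<le> a * nrm m g + b * nrm m h"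
    by (rule nrm_le_lincomb2) (use assms in auto)
  finally show ?thesis using assms by (simp add: nrm_scale nrm_abs)
qed

section \<open>The linear iteration\<close>

definition mat_app :: "nat \<Rightarrow> (nat \<Rightarrow> nat \<Rightarrow> real) \<Rightarrow> (nat \<Rightarrow> real) \<Rightarrow> nat \<Rightarrow> real" where
  "mat_app m a z i = (\<Sum>j<m. a i j * z j)"

lemma ip_mat_app: "ip n (mat_app m a z) w = ip m z (mat_app n (\<lambda>i j. a j i) w)"
proof -
  have "ip n (mat_app m a z) w = (\<Sum>i<n. \<Sum>j<m. a i j * z j * w i)"
    by (simp add: ip_def mat_app_def sum_distrib_right)
  also have "\<dots> = (\<Sum>j<m. \<Sum>i<n. a i j * z j * w i)" by (rule sum.swap)
  also have "\<dots> = ip m z (mat_app n (\<lambda>i j. a j i) w)"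
    by (simp add: ip_def mat_app_def sum_distrib_left mult_ac)
  finally show ?thesis .
qed

lemma mat_app_diff: "mat_app m a (\<lambda>i. f i - g i) = (\<lambda>i. mat_app m a f i - mat_app m a g i)"
  by (simp add: mat_app_def right_diff_distrib sum_subtractf fun_eq_iff)

lemma mat_app_scale: "mat_app m a (\<lambda>i. c * f i) = (\<lambda>i. c * mat_app m a f i)"
  by (simp add: mat_app_def sum_distrib_left mult_ac fun_eq_iff)

lemma mat_app_cong: "(\<And>j. j < m \<Longrightarrow> a i j = a' i j) \<Longrightarrow> (\<And>j. j < m \<Longrightarrow> f j = g j) \<Longrightarrow>
    mat_app m a f i = mat_app m a' g i"
  by (simp add: mat_app_def)

text \<open>With y the transposed image of w, moving the matrix across the inner product gives |y|^2
  = <a y, w> \<le> L |y| |w|, and one factor |y| cancels.\<close>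

lemma nrm_transpose_le:
  assumes "\<And>z. nrm n (mat_app m a z) \<le> L * nrm m z" "0 \<le> L"
  shows "nrm m (mat_app n (\<lambda>i j. a j i) w) \<le> L * nrm n w"
proof -
  let ?y = "mat_app n (\<lambda>i j. a j i) w"
  have "(nrm m ?y)\<^sup>2 = ip n (mat_app m a ?y) w"
    by (subst ip_mat_app) (simp add: ip_self)
  also have "\<dots> \<le> nrm n (mat_app m a ?y) * nrm n w"
    using abs_ip_le[of n "mat_app m a ?y" w] by linarith
  also have "\<dots> \<le> (L * nrm m ?y) * nrm n w"
    by (intro mult_right_mono assms) simp
  finally have "nrm m ?y * nrm m ?y \<le> nrm m ?y * (L * nrm n w)"
    by (simp add: power2_eq_square mult_ac)
  then show ?thesis
    using assms(2) L2_set_nonneg[of ?y "{..<m}"]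
    by (cases "nrm m ?y = 0") (simp_all add: mult_le_cancel_left_pos)
qed

definition gd_step :: "nat \<Rightarrow> nat \<Rightarrow> (nat \<Rightarrow> nat \<Rightarrow> real) \<Rightarrow> real \<Rightarrow> (nat \<Rightarrow> real) \<Rightarrow> nat \<Rightarrow> real" where
  "gd_step n m a \<eta> z j = z j - \<eta> * mat_app n (\<lambda>i j. a j i) (mat_app m a z) j"

lemma gd_step_diff:
  "gd_step n m a \<eta> (\<lambda>i. f i - g i) j = gd_step n m a \<eta> f j - gd_step n m a \<eta> g j"
  by (simp add: gd_step_def mat_app_diff algebra_simps)

lemma ip_gd_step: "ip m (gd_step n m a \<eta> z) y = ip m z y - \<eta> * ip n (mat_app m a z) (mat_app m a y)"
proof -
  have "ip m (gd_step n m a \<eta> z) y = ip m z y - \<eta> * ip m (mat_app n (\<lambda>i j. a j i) (mat_app m a z)) y"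
    by (simp add: ip_def gd_step_def algebra_simps sum_subtractf sum_distrib_left)
  also have "ip m (mat_app n (\<lambda>i j. a j i) (mat_app m a z)) y = ip n (mat_app m a z) (mat_app m a y)"
    by (subst (1 2) ip_commute) (rule ip_mat_app[symmetric])
  finally show ?thesis .
qed

text \<open>The step is I - \<eta> M^T M, a self-adjoint map. The log-convexity of the norms rests
  on this.\<close>

lemma ip_gd_step_sym: "ip m (gd_step n m a \<eta> z) y = ip m z (gd_step n m a \<eta> y)"
  unfolding ip_gd_step ip_commute[of m z "gd_step n m a \<eta> y"]
  by (simp add: ip_commute)

text \<open>Expanding the square gives -2 \<eta> |M z|^2 + \<eta>^2 |M^T M z|^2. The second term is
  at most \<eta> |M z|^2 because \<eta> L^2 \<le> 1, so half of the gain survives.\<close>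

lemma nrm_gd_step:
  assumes L: "\<And>z. nrm n (mat_app m a z) \<le> L * nrm m z" "0 \<le> L" and \<eta>: "0 \<le> \<eta>" "\<eta> * L\<^sup>2 \<le> 1"
  shows "(nrm m (gd_step n m a \<eta> z))\<^sup>2 \<le> (nrm m z)\<^sup>2 - \<eta> * (nrm n (mat_app m a z))\<^sup>2"
proof -
  let ?w = "mat_app m a z" and ?y = "mat_app n (\<lambda>i j. a j i) (mat_app m a z)"
  have "(nrm m (gd_step n m a \<eta> z))\<^sup>2 = ip m z (gd_step n m a \<eta> z) - \<eta> * ip n ?w (mat_app m a (gd_step n m a \<eta> z))"
    unfolding ip_self[symmetric] by (rule ip_gd_step)
  also have "ip m z (gd_step n m a \<eta> z) = (nrm m z)\<^sup>2 - \<eta> * (nrm n ?w)\<^sup>2"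
    by (subst ip_gd_step_sym[symmetric]) (simp add: ip_gd_step ip_self)
  also have "ip n ?w (mat_app m a (gd_step n m a \<eta> z)) = ip m (gd_step n m a \<eta> z) ?y"
    by (subst ip_commute) (rule ip_mat_app)
  also have "\<dots> = ip m z ?y - \<eta> * ip m ?y ?y"
    by (simp add: ip_def gd_step_def algebra_simps sum_subtractf sum_distrib_left)
  also have "ip m z ?y = (nrm n ?w)\<^sup>2" by (subst ip_mat_app[symmetric]) (rule ip_self)
  also have "ip m ?y ?y = (nrm m ?y)\<^sup>2" by (rule ip_self)
  finally have *: "(nrm m (gd_step n m a \<eta> z))\<^sup>2 =
      (nrm m z)\<^sup>2 - 2 * \<eta> * (nrm n ?w)\<^sup>2 + \<eta>\<^sup>2 * (nrm m ?y)\<^sup>2"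
    by (simp add: algebra_simps power2_eq_square)
  have "(nrm m ?y)\<^sup>2 \<le> (L * nrm n ?w)\<^sup>2"
    using nrm_transpose_le[OF L, of ?w] by (intro power_mono) auto
  then have "\<eta>\<^sup>2 * (nrm m ?y)\<^sup>2 \<le> \<eta>\<^sup>2 * (L * nrm n ?w)\<^sup>2"
    by (intro mult_left_mono) auto
  also have "\<dots> = \<eta> * (nrm n ?w)\<^sup>2 * (\<eta> * L\<^sup>2)"
    by (simp add: power2_eq_square mult_ac)
  also have "\<dots> \<le> \<eta> * (nrm n ?w)\<^sup>2"
    using \<eta> by (intro mult_left_le) auto
  finally show ?thesis using * by linarith
qed

lemma nrm_gd_step_le:
  assumes "\<And>z. nrm n (mat_app m a z) \<le> L * nrm m z" "0 \<le> L" "0 \<le> \<eta>" "\<eta> * L\<^sup>2 \<le> 1"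
  shows "nrm m (gd_step n m a \<eta> z) \<le> nrm m z"
proof (rule power2_le_imp_le)
  have "0 \<le> \<eta> * (nrm n (mat_app m a z))\<^sup>2" using assms(3) by simp
  with nrm_gd_step[OF assms, of z] show "(nrm m (gd_step n m a \<eta> z))\<^sup>2 \<le> (nrm m z)\<^sup>2" by linarith
qed simp

section \<open>Residual of the exact iteration\<close>

lemma log_convex_decay:
  fixes r :: "nat \<Rightarrow> real"
  assumes pos: "\<And>k. 0 < r k" and conv: "\<And>k. (r (Suc k))\<^sup>2 \<le> r k * r (Suc (Suc k))" and T: "0 < T"
  shows "r T - r (Suc T) \<le> ln (r 0 / r T) / real T * r T"
proof -
  \<comment> \<open>The quotients of consecutive terms increase, so the first T of them are at most
    \<open>q T\<close> and \<open>r T \<le> q T ^ T * r 0\<close>. With ln q \<le> q - 1 the average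
    logarithmic decrease bounds 1 - \<open>q T\<close>, the last relative decrease.\<close>
  define q where "q k = r (Suc k) / r k" for k
  have qpos: "0 < q k" for k by (simp add: q_def pos)
  have "q k \<le> q (Suc k)" for k
    using conv[of k] pos[of k] pos[of "Suc k"] by (simp add: q_def field_simps power2_eq_square)
  then have qmono: "i \<le> k \<Longrightarrow> q i \<le> q k" for i k by (rule lift_Suc_mono_le)
  have "k \<le> T \<Longrightarrow> r k \<le> q T ^ k * r 0" for k
  proof (induction k)
    case (Suc k)
    have "r (Suc k) = q k * r k" using pos[of k] by (simp add: q_def)
    also have "\<dots> \<le> q T * (q T ^ k * r 0)"
      using Suc qmono[of k T] qpos[of T] pos[of k] by (intro mult_mono) (auto simp: less_imp_le)
    finally show ?case by (simp add: mult_ac)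
  qed simp
  then have "r T / r 0 \<le> q T ^ T" using pos[of 0] by (simp add: field_simps)
  then have "ln (r T / r 0) \<le> ln (q T ^ T)" using pos[of 0] pos[of T] qpos[of T] by simp
  also have "\<dots> = real T * ln (q T)" using qpos[of T] by (simp add: ln_realpow)
  also have "\<dots> \<le> real T * (q T - 1)" using qpos[of T] by (intro mult_left_mono ln_le_minus_one) auto
  finally have "real T * (1 - q T) \<le> ln (r 0 / r T)"
    using pos[of 0] pos[of T] by (simp add: ln_div algebra_simps)
  then have "1 - q T \<le> ln (r 0 / r T) / real T" using T by (simp add: field_simps)
  then have "(1 - q T) * r T \<le> ln (r 0 / r T) / real T * r T" using pos[of T] by (intro mult_right_mono) auto
  moreover have "(1 - q T) * r T = r T - r (Suc T)" using pos[of T] by (simp add: q_def field_simps)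
  ultimately show ?thesis by simp
qed

definition gd_iter :: "nat \<Rightarrow> nat \<Rightarrow> (nat \<Rightarrow> nat \<Rightarrow> real) \<Rightarrow> real \<Rightarrow> (nat \<Rightarrow> real) \<Rightarrow> nat \<Rightarrow> nat \<Rightarrow> real" where
  "gd_iter n m a \<eta> g k = (gd_step n m a \<eta> ^^ k) g"

lemma gd_iter_0 [simp]: "gd_iter n m a \<eta> g 0 = g"
  by (simp add: gd_iter_def)

lemma gd_iter_Suc: "gd_iter n m a \<eta> g (Suc k) = gd_step n m a \<eta> (gd_iter n m a \<eta> g k)"
  by (simp add: gd_iter_def)

lemma nrm_gd_iter_le:
  assumes "\<And>z. nrm n (mat_app m a z) \<le> L * nrm m z" "0 \<le> L" "0 \<le> \<eta>" "\<eta> * L\<^sup>2 \<le> 1"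
  shows "nrm m (gd_iter n m a \<eta> g k) \<le> nrm m g"
proof (induction k)
  case (Suc k)
  show ?case unfolding gd_iter_Suc by (rule order_trans[OF nrm_gd_step_le[OF assms] Suc])
qed simp

lemma gd_iter_residual:
  assumes L: "\<And>z. nrm n (mat_app m a z) \<le> L * nrm m z" "0 \<le> L" and \<eta>: "0 \<le> \<eta>" "\<eta> * L\<^sup>2 \<le> 1"
    and e: "nrm m e = 1" "\<And>i. i < n \<Longrightarrow> mat_app m a e i = 0"
    and g: "\<kappa> \<le> \<bar>ip m g e\<bar>" "0 < \<kappa>" "nrm m g \<le> D" and T: "0 < T"
  shows "\<kappa> \<le> nrm m (gd_iter n m a \<eta> g T)"
    and "\<eta> * (nrm n (mat_app m a (gd_iter n m a \<eta> g T)))\<^sup>2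
      \<le> ln (D\<^sup>2 / \<kappa>\<^sup>2) / real T * (nrm m (gd_iter n m a \<eta> g T))\<^sup>2"
proof -
  let ?z = "gd_iter n m a \<eta> g"
  have inv: "ip m (?z k) e = ip m g e" for k
  proof (induction k)
    case (Suc k)
    have "ip n (mat_app m a (?z k)) (mat_app m a e) = 0" using e(2) by (simp add: ip_def)
    then show ?case using Suc by (simp add: gd_iter_Suc ip_gd_step)
  qed simp
  have low: "\<kappa> \<le> nrm m (?z k)" for k
    using abs_ip_le[of m "?z k" e] inv[of k] g(1) e(1) by simp
  then show "\<kappa> \<le> nrm m (?z T)" .
  define r where "r k = (nrm m (?z k))\<^sup>2" for k
  have pos: "0 < r k" for k using low[of k] g(2) by (simp add: r_def)
  have conv: "(r (Suc k))\<^sup>2 \<le> r k * r (Suc (Suc k))" for k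
  proof -
    \<comment> \<open>For the self-adjoint step S, <S z, S z> = <z, S S z>. Cauchy-Schwarz applied
      to the right side is the log-convexity.\<close>
    have "r (Suc k) = ip m (?z k) (?z (Suc (Suc k)))"
      unfolding r_def ip_self[symmetric] gd_iter_Suc by (rule ip_gd_step_sym)
    then have "\<bar>r (Suc k)\<bar> \<le> nrm m (?z k) * nrm m (?z (Suc (Suc k)))"
      using abs_ip_le[of m "?z k" "?z (Suc (Suc k))"] by simp
    then have "\<bar>r (Suc k)\<bar>\<^sup>2 \<le> (nrm m (?z k) * nrm m (?z (Suc (Suc k))))\<^sup>2"
      by (intro power_mono) auto
    then show ?thesis by (simp add: r_def power_mult_distrib)
  qed
  \<comment> \<open>The residual of iterate T is paid for by the decrease from T to T + 1, a step
    that exists only in the analysis.\<close>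
  have "\<eta> * (nrm n (mat_app m a (?z T)))\<^sup>2 \<le> r T - r (Suc T)"
    using nrm_gd_step[OF L(1) L(2) \<eta>, of "?z T"] by (simp add: r_def gd_iter_Suc)
  also have "\<dots> \<le> ln (r 0 / r T) / real T * r T"
    by (rule log_convex_decay[of r, OF pos conv T])
  also have "\<dots> \<le> ln (D\<^sup>2 / \<kappa>\<^sup>2) / real T * r T"
  proof -
    have "r 0 \<le> D\<^sup>2" using g(3) by (simp add: r_def power_mono)
    moreover have "\<kappa>\<^sup>2 \<le> r T" using low[of T] g(2) by (simp add: r_def power_mono)
    ultimately have "r 0 / r T \<le> D\<^sup>2 / \<kappa>\<^sup>2" using g(2) by (intro frac_le) auto
    then have "ln (r 0 / r T) \<le> ln (D\<^sup>2 / \<kappa>\<^sup>2)" using pos[of 0] pos[of T] by (intro ln_mono) auto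
    then show ?thesis using pos[of T] by (intro mult_right_mono divide_right_mono) auto
  qed
  finally show "\<eta> * (nrm n (mat_app m a (?z T)))\<^sup>2
      \<le> ln (D\<^sup>2 / \<kappa>\<^sup>2) / real T * (nrm m (?z T))\<^sup>2" by (simp add: r_def)
qed

lemma gd_iter_perturbed_step:
  assumes L: "\<And>z. nrm n (mat_app m a z) \<le> L * nrm m z" "0 \<le> L" "0 \<le> \<eta>" "\<eta> * L\<^sup>2 \<le> 1"
    and "nrm m (\<lambda>j. y' j - gd_step n m a \<eta> y j) \<le> d"
    and "nrm m (\<lambda>j. y j - gd_iter n m a \<eta> g k j) \<le> f"
  shows "nrm m (\<lambda>j. y' j - gd_iter n m a \<eta> g (Suc k) j) \<le> f + d"
proof -
  have "nrm m (\<lambda>j. gd_step n m a \<eta> y j - gd_iter n m a \<eta> g (Suc k) j)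
      = nrm m (gd_step n m a \<eta> (\<lambda>j. y j - gd_iter n m a \<eta> g k j))"
    by (rule nrm_cong) (simp add: gd_iter_Suc gd_step_diff)
  also have "\<dots> \<le> f" using nrm_gd_step_le[OF L] assms(6) by (rule order_trans)
  finally show ?thesis
    using nrm_triangle3[of y' "gd_iter n m a \<eta> g (Suc k)" m "gd_step n m a \<eta> y"] assms(5) by linarith
qed

text \<open>A zero row makes the matrix square and singular: its transpose visibly kills the last
  unit vector, so the determinant vanishes without any rank argument.\<close>

lemma wide_matrix_kernel:
  fixes a :: "nat \<Rightarrow> nat \<Rightarrow> real"
  obtains e where "nrm (Suc n) e = 1" "\<And>i. i < n \<Longrightarrow> mat_app (Suc n) a e i = 0"
proof -
  define M where "M = mat (Suc n) (Suc n) (\<lambda>(i, j). if i < n then a i j else 0)"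
  have M: "M \<in> carrier_mat (Suc n) (Suc n)" by (simp add: M_def)
  have "transpose_mat M *\<^sub>v unit_vec (Suc n) n = 0\<^sub>v (Suc n)"
    by (rule eq_vecI) (auto simp: M_def)
  moreover have "unit_vec (Suc n) n \<noteq> (0\<^sub>v (Suc n) :: real Matrix.vec)"
    by (auto simp: vec_eq_iff)
  ultimately have "det (transpose_mat M) = 0"
    using det_0_iff_vec_prod_zero_field[of "transpose_mat M" "Suc n"] M
    by (metis transpose_carrier_mat unit_vec_carrier)
  then have "det M = 0" using det_transpose[OF M] by simp
  then obtain v where v: "v \<in> carrier_vec (Suc n)" "v \<noteq> 0\<^sub>v (Suc n)" "M *\<^sub>v v = 0\<^sub>v (Suc n)"
    using det_0_iff_vec_prod_zero_field[OF M] by auto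
  let ?c = "nrm (Suc n) (vec_index v)"
  have "?c \<noteq> 0" using v(1,2) by (auto simp: L2_set_eq_0_iff vec_eq_iff)
  then have c: "?c > 0" using L2_set_nonneg[of "vec_index v" "{..<Suc n}"] by linarith
  show thesis
  proof
    show "nrm (Suc n) (\<lambda>i. inverse ?c * v $ i) = 1"
      using c by (subst nrm_scale) simp
    fix i assume i: "i < n"
    have "mat_app (Suc n) a (vec_index v) i = (M *\<^sub>v v) $ i"
      using i v(1) by (auto simp: M_def mat_app_def scalar_prod_def lessThan_atLeast0 intro!: sum.cong)
    also have "\<dots> = 0" using i v(3) by simp
    finally show "mat_app (Suc n) a (\<lambda>i. inverse ?c * v $ i) i = 0"
      by (simp add: mat_app_scale)
  qed
qed

lemma unit_vector_large_entry:
  assumes "nrm m e = 1"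
  obtains k where "k < m" "1 / sqrt (real m) \<le> \<bar>e k\<bar>"
proof -
  have m: "0 < m" using assms by (cases m) auto
  have "\<exists>k<m. 1 / sqrt (real m) \<le> \<bar>e k\<bar>"
  proof (rule ccontr)
    assume "\<not> ?thesis"
    then have *: "\<bar>e k\<bar> < 1 / sqrt (real m)" if "k < m" for k using that by force
    have "(e k)\<^sup>2 < 1 / real m" if "k < m" for k
    proof -
      have "\<bar>e k\<bar>\<^sup>2 < (1 / sqrt (real m))\<^sup>2" using *[OF that] by (intro power_strict_mono) auto
      then show ?thesis by (simp add: power_divide)
    qed
    then have "(\<Sum>k<m. (e k)\<^sup>2) < (\<Sum>k<m. 1 / real m)"
      using m by (intro sum_strict_mono) auto
    then show False using assms m by (simp add: L2_set_def)
  qed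
  then show thesis using that by blast
qed

section \<open>Relative errors\<close>

text \<open>Relative error, with the exact value as last argument. An exact value 0 forces the
  approximation to be 0, so a computed square that is positive certifies a nonzero vector.\<close>

definition ap :: "real \<Rightarrow> real \<Rightarrow> real \<Rightarrow> bool" where
  "ap e x y \<longleftrightarrow> \<bar>x - y\<bar> \<le> e * \<bar>y\<bar>"

lemma apE:
  assumes "ap e x y" "0 \<le> e"
  obtains t where "x = (1 + t) * y" "\<bar>t\<bar> \<le> e"
proof (cases "y = 0")
  case True
  then show thesis using assms that[of 0] by (simp add: ap_def)
next
  case False
  have "\<bar>(x - y) / y\<bar> \<le> e" using assms False by (simp add: ap_def abs_divide divide_le_eq)
  moreover have "x = (1 + (x - y) / y) * y" using False by (simp add: field_simps)
  ultimately show thesis using that by blast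
qed

lemma apI: "x = (1 + t) * y \<Longrightarrow> \<bar>t\<bar> \<le> e \<Longrightarrow> ap e x y"
proof -
  assume "x = (1 + t) * y" "\<bar>t\<bar> \<le> e"
  then have "\<bar>x - y\<bar> = \<bar>t\<bar> * \<bar>y\<bar>" by (simp add: algebra_simps abs_mult)
  then show "ap e x y" using \<open>\<bar>t\<bar> \<le> e\<close> by (simp add: ap_def mult_right_mono)
qed

lemma ap_mono: "ap e x y \<Longrightarrow> e \<le> f \<Longrightarrow> ap f x y"
  unfolding ap_def by (meson abs_ge_zero mult_right_mono order_trans)

lemma ap_refl: "ap 0 x x"
  by (simp add: ap_def)

lemma ap_abs_le: "ap e x y \<Longrightarrow> \<bar>x\<bar> \<le> (1 + e) * \<bar>y\<bar>"
  by (simp add: ap_def algebra_simps)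

lemma ap_pos: "ap e x y \<Longrightarrow> e < 1 \<Longrightarrow> 0 < y \<Longrightarrow> 0 < x"
proof -
  assume a: "ap e x y" "e < 1" "0 < y"
  then have "e * \<bar>y\<bar> < 1 * \<bar>y\<bar>" by (intro mult_strict_right_mono) auto
  then show "0 < x" using a unfolding ap_def by linarith
qed

lemma ap_nonzero: "ap e x y \<Longrightarrow> e < 1 \<Longrightarrow> y \<noteq> 0 \<Longrightarrow> x \<noteq> 0"
proof
  assume a: "ap e x y" "e < 1" "y \<noteq> 0" "x = 0"
  then have "e * \<bar>y\<bar> < 1 * \<bar>y\<bar>" by (intro mult_strict_right_mono) auto
  then show False using a unfolding ap_def by linarith
qed

text \<open>The relative error is (1 + s) (1 + t) (1 + \<theta>) - 1. As all errors are at most 1/8,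
  doubling the first-order sum covers the cross terms, so that bounds stay linear along a chain of
  operations.\<close>

lemma ap_round_mult:
  assumes "ap e x y" "ap f x' y'" "\<bar>\<theta>\<bar> \<le> u"
    and "0 \<le> e" "e \<le> 1/8" "0 \<le> f" "f \<le> 1/8" "u \<le> 1/8"
  shows "ap (2 * (e + f + u)) ((1 + \<theta>) * (x * x')) (y * y')"
proof -
  obtain s where s: "x = (1 + s) * y" "\<bar>s\<bar> \<le> e" using apE[OF assms(1,4)] by blast
  obtain t where t: "x' = (1 + t) * y'" "\<bar>t\<bar> \<le> f" using apE[OF assms(2,6)] by blast
  have b1: "\<bar>s * t\<bar> \<le> 1/8 * \<bar>t\<bar>"
    unfolding abs_mult using s(2) assms(5) by (intro mult_right_mono) auto
  define p where "p = s + t + s * t"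
  have p: "\<bar>p\<bar> \<le> e + f + f / 8" unfolding p_def using b1 s(2) t(2) by linarith
  have b2: "\<bar>\<theta> * p\<bar> \<le> 1/8 * \<bar>p\<bar>"
    unfolding abs_mult[of \<theta>] using assms(3,8) by (intro mult_right_mono) auto
  have "\<bar>\<theta> + p + \<theta> * p\<bar> \<le> 2 * (e + f + u)"
  proof -
    have "\<bar>\<theta> + p + \<theta> * p\<bar> \<le> \<bar>\<theta>\<bar> + \<bar>p\<bar> + \<bar>\<theta> * p\<bar>" by linarith
    also have "\<dots> \<le> u + 9/8 * \<bar>p\<bar>" using b2 assms(3) by simp
    also have "\<dots> \<le> u + 9/8 * (e + f + f / 8)" using p by simp
    also have "\<dots> \<le> 2 * (e + f + u)" using assms(3,4,6) by (simp add: field_simps)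
    finally show ?thesis .
  qed
  moreover have "(1 + \<theta>) * (x * x') = (1 + (\<theta> + p + \<theta> * p)) * (y * y')"
    by (simp add: s t p_def algebra_simps)
  ultimately show ?thesis by (rule apI[rotated])
qed

lemma ap_round:
  assumes "ap e x y" "\<bar>\<theta>\<bar> \<le> u" "0 \<le> e" "e \<le> 1/8" "u \<le> 1/8"
  shows "ap (2 * (e + u)) ((1 + \<theta>) * x) y"
  using ap_round_mult[OF assms(1) ap_refl[of 1] assms(2)] assms by simp

lemma ap_mult:
  assumes "ap e x y" "ap f x' y'" "0 \<le> e" "e \<le> 1/8" "0 \<le> f" "f \<le> 1/8"
  shows "ap (2 * (e + f)) (x * x') (y * y')"
  using ap_round_mult[OF assms(1,2), of 0 0] assms by simp

lemma ap_round_div: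
  assumes "ap e x y" "ap f x' y'" "\<bar>\<theta>\<bar> \<le> u"
    and "0 \<le> e" "e \<le> 1/8" "0 \<le> f" "f \<le> 1/8" "u \<le> 1/8" "y' \<noteq> 0"
  shows "ap (2 * (e + f + u)) ((1 + \<theta>) * (x / x')) (y / y')"
proof -
  obtain s where s: "x = (1 + s) * y" "\<bar>s\<bar> \<le> e" using apE[OF assms(1,4)] by blast
  obtain t where t: "x' = (1 + t) * y'" "\<bar>t\<bar> \<le> f" using apE[OF assms(2,6)] by blast
  define r where "r = (\<theta> + s + \<theta> * s - t) / (1 + t)"
  have pos: "7/8 \<le> 1 + t" using t(2) assms(7) by linarith
  have b: "\<bar>\<theta> * s\<bar> \<le> 1/8 * \<bar>s\<bar>"
    unfolding abs_mult using assms(3,8) by (intro mult_right_mono) auto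
  have "\<bar>r\<bar> = \<bar>\<theta> + s + \<theta> * s - t\<bar> / (1 + t)" using pos by (simp add: r_def abs_divide)
  also have "\<dots> \<le> \<bar>\<theta> + s + \<theta> * s - t\<bar> / (7/8)" using pos by (intro divide_left_mono) auto
  also have "\<dots> \<le> 2 * (e + f + u)"
  proof -
    have "\<bar>\<theta> + s + \<theta> * s - t\<bar> \<le> u + e + e / 8 + f" using b s(2) t(2) assms(3,4,6) by linarith
    moreover have "0 \<le> u" using assms(3) by linarith
    ultimately show ?thesis using assms(4,6) by simp
  qed
  finally have "\<bar>r\<bar> \<le> 2 * (e + f + u)" .
  moreover have "(1 + \<theta>) * (x / x') = (1 + r) * (y / y')"
    using pos assms(9) by (simp add: s t r_def field_simps)
  ultimately show ?thesis by (rule apI[rotated])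
qed

text \<open>A root does not enlarge a relative error: |sqrt x - sqrt y| sqrt y \<le> |x - y|,
  because sqrt x + sqrt y is at least sqrt y.\<close>

lemma ap_sqrt:
  assumes "ap e x y" "0 \<le> x" "0 \<le> y"
  shows "ap e (sqrt x) (sqrt y)"
proof (cases "y = 0")
  case True then show ?thesis using assms by (simp add: ap_def)
next
  case False
  then have y: "0 < sqrt y" using assms by simp
  have "\<bar>sqrt x - sqrt y\<bar> * sqrt y \<le> \<bar>sqrt x - sqrt y\<bar> * (sqrt x + sqrt y)"
    using assms by (intro mult_left_mono) auto
  also have "\<dots> = \<bar>(sqrt x - sqrt y) * (sqrt x + sqrt y)\<bar>" using assms by (simp add: abs_mult)
  also have "(sqrt x - sqrt y) * (sqrt x + sqrt y) = x - y" using assms by (simp add: algebra_simps)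
  also have "\<bar>x - y\<bar> \<le> e * y" using assms by (simp add: ap_def)
  also have "e * y = e * sqrt y * sqrt y" using assms by simp
  finally show ?thesis using y assms by (simp add: ap_def)
qed

section \<open>Spectral norm and backward errors\<close>

abbreviation mfun :: "real mat \<Rightarrow> nat \<Rightarrow> nat \<Rightarrow> real" where
  "mfun A \<equiv> \<lambda>i j. A $$ (i, j)"

lemma vnorm_vec: "v \<in> carrier_vec n \<Longrightarrow> vnorm v = nrm n (vec_index v)"
  unfolding vnorm_def by simp

lemma mult_mat_vec_mat_app:
  "A \<in> carrier_mat n k \<Longrightarrow> v \<in> carrier_vec k \<Longrightarrow> i < n \<Longrightarrow> (A *\<^sub>v v) $ i = mat_app k (mfun A) (vec_index v) i"
  by (auto simp: mat_app_def scalar_prod_def lessThan_atLeast0 intro!: sum.cong)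

lemma vnorm_mult_mat_vec:
  assumes "A \<in> carrier_mat n k" "v \<in> carrier_vec k"
  shows "vnorm (A *\<^sub>v v) = nrm n (mat_app k (mfun A) (vec_index v))"
proof -
  have "A *\<^sub>v v \<in> carrier_vec n" using assms by simp
  then have "vnorm (A *\<^sub>v v) = nrm n (vec_index (A *\<^sub>v v))" by (rule vnorm_vec)
  also have "\<dots> = nrm n (mat_app k (mfun A) (vec_index v))"
    by (rule nrm_cong) (use mult_mat_vec_mat_app[OF assms] in blast)
  finally show ?thesis .
qed

text \<open>Provides the upper bound without which the supremum in \<open>spectral_norm\<close>
  would say nothing.\<close>

lemma nrm_mat_app_frobenius:
  "nrm n (mat_app k a z) \<le> nrm n (\<lambda>i. nrm k (a i)) * nrm k z"
proof -
  have "nrm n (mat_app k a z) \<le> nrm n (\<lambda>i. nrm k z * nrm k (a i))"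
  proof (rule nrm_mono_abs)
    fix i
    show "\<bar>mat_app k a z i\<bar> \<le> nrm k z * nrm k (a i)"
      using abs_ip_le[of k "a i" z] by (simp add: mat_app_def ip_def mult_ac)
  qed
  then show ?thesis by (subst (asm) nrm_scale) (simp add: mult_ac)
qed

lemma nrm_mat_app_le_spectral_norm:
  assumes A: "A \<in> carrier_mat n k"
  shows "nrm n (mat_app k (mfun A) z) \<le> spectral_norm A * nrm k z"
proof (cases "nrm k z = 0")
  case True
  then show ?thesis using nrm_mat_app_frobenius[of k "mfun A" z n] by simp
next
  case False
  let ?S = "{vnorm (A *\<^sub>v v) | v. v \<in> carrier_vec (dim_col A) \<and> vnorm v \<le> 1}"
  let ?F = "nrm n (\<lambda>i. nrm k (mfun A i))"
  let ?c = "inverse (nrm k z)"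
  have nz: "0 < nrm k z" using False L2_set_nonneg[of z "{..<k}"] by linarith
  then have c: "0 < ?c" by simp
  define v where "v = vec k (\<lambda>i. ?c * z i)"
  have v: "v \<in> carrier_vec k" by (simp add: v_def)
  have nv: "nrm k (vec_index v) = nrm k (\<lambda>i. ?c * z i)" by (rule nrm_cong) (simp add: v_def)
  also have "\<dots> = 1" using c False by (subst nrm_scale) simp
  finally have nv1: "vnorm v = 1" by (simp add: vnorm_vec[OF v])
  have bdd: "bdd_above ?S"
  proof (rule bdd_aboveI)
    fix x assume "x \<in> ?S"
    then obtain w where w: "w \<in> carrier_vec k" "vnorm w \<le> 1" "x = vnorm (A *\<^sub>v w)"
      using A by auto
    have "x \<le> ?F * nrm k (vec_index w)"
      using w nrm_mat_app_frobenius[of k "mfun A" "vec_index w" n] by (simp add: vnorm_mult_mat_vec[OF A])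
    also have "\<dots> \<le> ?F" using w by (intro mult_left_le) (auto simp: vnorm_vec)
    finally show "x \<le> ?F" .
  qed
  have "vnorm (A *\<^sub>v v) \<in> ?S" using A v nv1 by (auto intro!: exI[of _ v])
  then have "vnorm (A *\<^sub>v v) \<le> spectral_norm A"
    unfolding spectral_norm_def using bdd by (rule cSup_upper)
  moreover have "vnorm (A *\<^sub>v v) = nrm n (mat_app k (mfun A) (\<lambda>i. ?c * z i))"
    unfolding vnorm_mult_mat_vec[OF A v] by (intro nrm_cong mat_app_cong) (simp_all add: v_def)
  moreover have "\<dots> = ?c * nrm n (mat_app k (mfun A) z)"
    using c by (subst mat_app_scale) (simp add: nrm_scale)
  ultimately have "?c * nrm n (mat_app k (mfun A) z) \<le> spectral_norm A" by linarith
  then show ?thesis using nz by (simp add: field_simps)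
qed

lemma spectral_norm_le:
  assumes A: "A \<in> carrier_mat n k" and L: "0 \<le> L"
    and *: "\<And>z. nrm n (mat_app k (mfun A) z) \<le> L * nrm k z"
  shows "spectral_norm A \<le> L"
  unfolding spectral_norm_def
proof (rule cSup_least)
  have "vnorm (0\<^sub>v k :: real Matrix.vec) = 0"
    unfolding vnorm_def by (subst L2_set_eq_0_iff) auto
  then have "vnorm (A *\<^sub>v 0\<^sub>v k) \<in> {vnorm (A *\<^sub>v v) |v. v \<in> carrier_vec (dim_col A) \<and> vnorm v \<le> 1}"
    using A by (intro CollectI exI[of _ "0\<^sub>v k"]) auto
  then show "{vnorm (A *\<^sub>v v) |v. v \<in> carrier_vec (dim_col A) \<and> vnorm v \<le> 1} \<noteq> {}" by blast
next
  fix x assume "x \<in> {vnorm (A *\<^sub>v v) |v. v \<in> carrier_vec (dim_col A) \<and> vnorm v \<le> 1}"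
  then obtain v where v: "v \<in> carrier_vec k" "vnorm v \<le> 1" "x = vnorm (A *\<^sub>v v)" using A by auto
  then have "x \<le> L * nrm k (vec_index v)" using * by (simp add: vnorm_mult_mat_vec[OF A])
  also have "\<dots> \<le> L" using v L by (intro mult_left_le) (auto simp: vnorm_vec)
  finally show "x \<le> L" .
qed

lemma spectral_norm_nonneg:
  assumes "A \<in> carrier_mat n k"
  shows "0 \<le> spectral_norm A"
proof (cases "k = 0")
  case False
  let ?z = "\<lambda>i. if i = 0 then 1 else 0 :: real"
  have "nrm k ?z = 1"
    using False by (simp add: L2_set_def if_distrib[of "\<lambda>x. x\<^sup>2"] cong: if_cong)
  then show ?thesis
    using nrm_mat_app_le_spectral_norm[OF assms, of ?z] L2_set_nonneg[of "mat_app k (mfun A) ?z" "{..<n}"]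
    by (simp del: L2_set_nonneg)
next
  case True
  have "vnorm v \<ge> 0" for v by (simp add: vnorm_def)
  moreover have "{vnorm (A *\<^sub>v v) |v. v \<in> carrier_vec (dim_col A) \<and> vnorm v \<le> 1} = {vnorm (A *\<^sub>v 0\<^sub>v 0)}"
  proof -
    have "carrier_vec 0 = {0\<^sub>v 0 :: real Matrix.vec}" by auto
    moreover have "vnorm (0\<^sub>v 0) \<le> 1" by (simp add: vnorm_def)
    ultimately show ?thesis using assms True by auto
  qed
  ultimately show ?thesis by (simp add: spectral_norm_def)
qed

text \<open>The error of a transposed query is measured by the norm of the transpose; this turns it
  into a multiple of \<open>spectral_norm A\<close>.\<close>

lemma spectral_norm_transpose_le:
  assumes A: "A \<in> carrier_mat n k"
  shows "spectral_norm (transpose_mat A) \<le> spectral_norm A"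
proof (rule spectral_norm_le)
  show "transpose_mat A \<in> carrier_mat k n" using A by simp
  show "0 \<le> spectral_norm A" by (rule spectral_norm_nonneg[OF A])
  fix z
  have "nrm k (mat_app n (mfun (transpose_mat A)) z) = nrm k (mat_app n (\<lambda>i j. mfun A j i) z)"
    using A by (intro nrm_cong mat_app_cong) auto
  also have "\<dots> \<le> spectral_norm A * nrm n z"
    by (rule nrm_transpose_le[OF nrm_mat_app_le_spectral_norm[OF A] spectral_norm_nonneg[OF A]])
  finally show "nrm k (mat_app n (mfun (transpose_mat A)) z) \<le> spectral_norm A * nrm n z" .
qed

lemma spectral_norm_pos:
  assumes A: "A \<in> carrier_mat n k" and nz: "A \<noteq> 0\<^sub>m n k"
  shows "0 < spectral_norm A"
proof -
  obtain i j where ij: "i < n" "j < k" "A $$ (i, j) \<noteq> 0"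
    using A nz by (metis carrier_matD eq_matI index_zero_mat)
  let ?z = "\<lambda>l. if l = j then 1 else 0 :: real"
  have "mat_app k (mfun A) ?z i = A $$ (i, j)"
    using ij by (simp add: mat_app_def if_distrib[of "\<lambda>x. _ * x"] cong: if_cong)
  then have "nrm n (mat_app k (mfun A) ?z) \<noteq> 0"
    using ij by (auto simp: L2_set_eq_0_iff intro!: bexI[of _ i])
  then have "0 < nrm n (mat_app k (mfun A) ?z)"
    using L2_set_nonneg[of "mat_app k (mfun A) ?z" "{..<n}"] by linarith
  also have "\<dots> \<le> spectral_norm A * nrm k ?z" by (rule nrm_mat_app_le_spectral_norm[OF A])
  finally show ?thesis using L2_set_nonneg[of ?z "{..<k}"] by (simp add: zero_less_mult_iff)
qed

lemma eps_matvecD: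
  assumes "eps_matvec u A F" "A \<in> carrier_mat n k" "w \<in> carrier_vec k"
  shows "F w \<in> carrier_vec n"
    and "nrm n (\<lambda>i. F w $ i - mat_app k (mfun A) (vec_index w) i) \<le> u * spectral_norm A * nrm k (vec_index w)"
proof -
  show F: "F w \<in> carrier_vec n" using assms by (auto simp: eps_matvec_def)
  have *: "vnorm (F w - A *\<^sub>v w) \<le> u * spectral_norm A * vnorm w"
    using assms by (auto simp: eps_matvec_def)
  have "F w - A *\<^sub>v w \<in> carrier_vec n" using F assms by simp
  then have "vnorm (F w - A *\<^sub>v w) = nrm n (\<lambda>i. (F w - A *\<^sub>v w) $ i)" by (simp add: vnorm_vec)
  also have "\<dots> = nrm n (\<lambda>i. F w $ i - mat_app k (mfun A) (vec_index w) i)"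
    using F assms(2,3) by (intro nrm_cong) (simp add: mult_mat_vec_mat_app[OF assms(2,3), symmetric])
  finally show "nrm n (\<lambda>i. F w $ i - mat_app k (mfun A) (vec_index w) i) \<le> u * spectral_norm A * nrm k (vec_index w)"
    using * assms(3) by (simp add: vnorm_vec)
qed

lemma backward_solution_of_residual:
  assumes A: "A \<in> carrier_mat n n" and b: "b \<in> carrier_vec n" and x: "x \<in> carrier_vec n"
    and x0: "0 < nrm n (vec_index x)" and \<epsilon>: "0 \<le> \<epsilon>"
    and res: "nrm n (\<lambda>i. mat_app n (mfun A) (vec_index x) i - b $ i) \<le> \<epsilon> * spectral_norm A * nrm n (vec_index x)"
  shows "backward_solution n \<epsilon> A b x"
proof -
  let ?q = "(nrm n (vec_index x))\<^sup>2"
  let ?r = "\<lambda>i. mat_app n (mfun A) (vec_index x) i - b $ i"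
  \<comment> \<open>With r the residual, r x^T / |x|^2 is a matrix of smallest norm that maps x to
    r; its norm is |r| / |x|.\<close>
  define A' where "A' = mat n n (\<lambda>(i, j). A $$ (i, j) - ?r i * x $ j / ?q)"
  have A': "A' \<in> carrier_mat n n" by (simp add: A'_def)
  have q: "(\<Sum>j<n. x $ j * x $ j) = ?q" using ip_self[of n "vec_index x"] by (simp add: ip_def)
  have "A' *\<^sub>v x = b"
  proof (rule eq_vecI)
    fix i assume "i < dim_vec b"
    then have i: "i < n" using b by simp
    have "(A' *\<^sub>v x) $ i = mat_app n (mfun A') (vec_index x) i"
      by (rule mult_mat_vec_mat_app[OF A' x i])
    also have "\<dots> = (\<Sum>j<n. A $$ (i, j) * x $ j - ?r i / ?q * (x $ j * x $ j))"
      unfolding mat_app_def[of n "mfun A'"] using i by (intro sum.cong) (simp_all add: A'_def algebra_simps)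
    also have "\<dots> = mat_app n (mfun A) (vec_index x) i - ?r i / ?q * ?q"
      unfolding sum_subtractf sum_distrib_left[symmetric] q by (simp add: mat_app_def)
    also have "\<dots> = b $ i" using x0 by simp
    finally show "(A' *\<^sub>v x) $ i = b $ i" .
  qed (use A' b in simp)
  moreover have "spectral_norm (A' - A) \<le> \<epsilon> * spectral_norm A"
  proof (rule spectral_norm_le)
    show "A' - A \<in> carrier_mat n n" using A by (rule minus_carrier_mat)
    show "0 \<le> \<epsilon> * spectral_norm A" using \<epsilon> spectral_norm_nonneg[OF A] by simp
    fix z
    have "nrm n (mat_app n (mfun (A' - A)) z) = nrm n (\<lambda>i. (- ip n (vec_index x) z / ?q) * ?r i)"
    proof (rule nrm_cong)
      fix i assume i: "i < n"
      have "mat_app n (mfun (A' - A)) z i = (\<Sum>j<n. (- ?r i / ?q) * (x $ j * z j))"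
        unfolding mat_app_def[of n "mfun (A' - A)"] using i A by (intro sum.cong) (auto simp: A'_def algebra_simps minus_divide_left)
      also have "\<dots> = (- ?r i / ?q) * ip n (vec_index x) z"
        by (simp only: ip_def sum_distrib_left)
      also have "\<dots> = (- ip n (vec_index x) z / ?q) * ?r i"
        by (simp only: mult_minus_left mult_minus_right times_divide_eq_left times_divide_eq_right
            mult.commute[of _ "ip n (vec_index x) z"])
      finally show "mat_app n (mfun (A' - A)) z i = (- ip n (vec_index x) z / ?q) * ?r i" .
    qed
    also have "\<dots> = \<bar>ip n (vec_index x) z\<bar> / ?q * nrm n ?r"
      by (subst nrm_scale) (simp add: abs_divide)
    also have "\<dots> \<le> (nrm n (vec_index x) * nrm n z) / ?q * (\<epsilon> * spectral_norm A * nrm n (vec_index x))"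
      by (intro mult_mono divide_right_mono abs_ip_le res) auto
    also have "\<dots> = \<epsilon> * spectral_norm A * nrm n z" using x0 by (simp add: power2_eq_square)
    finally show "nrm n (mat_app n (mfun (A' - A)) z) \<le> \<epsilon> * spectral_norm A * nrm n z" .
  qed
  ultimately show ?thesis using A' unfolding backward_solution_def by blast
qed

section \<open>Random start vectors\<close>

text \<open>Four bits per entry because one bad value in sixteen stays below the allowed failure
  rate 0.1, while one in eight would not.\<close>

definition nibble :: "bool list \<Rightarrow> nat \<Rightarrow> nat" where
  "nibble w j = of_bool (w ! (4 * j)) + 2 * of_bool (w ! (4 * j + 1))
     + 4 * of_bool (w ! (4 * j + 2)) + 8 * of_bool (w ! (4 * j + 3))"

lemma nibble_le: "nibble w j \<le> 15"
  by (simp add: nibble_def of_bool_def)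

lemma nibble_inj:
  assumes "nibble w j = nibble w' j"
  shows "w ! (4 * j) = w' ! (4 * j)" "w ! (4 * j + 1) = w' ! (4 * j + 1)"
    "w ! (4 * j + 2) = w' ! (4 * j + 2)" "w ! (4 * j + 3) = w' ! (4 * j + 3)"
  using assms unfolding nibble_def of_bool_def by (auto split: if_splits)

text \<open>Once all other bits are fixed, at most one value of the nibble belonging to a large entry
  of \<open>e\<close> can make the inner product small.\<close>

lemma card_small_inner_product:
  assumes k: "k < m" and L: "4 * m \<le> L" and ek: "e k \<noteq> 0"
  shows "16 * card {w :: bool list. length w = L \<and> \<bar>ip m (\<lambda>j. real (nibble w j)) e\<bar> < \<bar>e k\<bar> / 2} \<le> 2 ^ L"
    (is "16 * card ?B \<le> _")
proof -
  let ?f = "\<lambda>w :: bool list. take (4 * k) w @ drop (4 * k + 4) w"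
  \<comment> \<open>Deleting the four bits of nibble k is injective on the bad tapes, so there are
    no more of them than tapes of length L - 4.\<close>
  have "inj_on ?f ?B"
  proof (rule inj_onI)
    fix w w' assume w: "w \<in> ?B" and w': "w' \<in> ?B" and f: "?f w = ?f w'"
    have len: "length w = L" "length w' = L" using w w' by auto
    have "take (4 * k) w = take (4 * k) w'" "drop (4 * k + 4) w = drop (4 * k + 4) w'"
      using f len by (auto simp: append_eq_append_conv)
    then have lo: "w ! i = w' ! i" if "i < 4 * k" for i
      using that by (metis nth_take)
    have hi: "w ! i = w' ! i" if "4 * k + 4 \<le> i" "i < L" for i
    proof -
      have "drop (4 * k + 4) w ! (i - (4 * k + 4)) = drop (4 * k + 4) w' ! (i - (4 * k + 4))"
        using \<open>drop (4 * k + 4) w = drop (4 * k + 4) w'\<close> by simp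
      then show ?thesis using that len by simp
    qed
    have same: "nibble w j = nibble w' j" if "j < m" "j \<noteq> k" for j
    proof -
      have "w ! (4 * j + i) = w' ! (4 * j + i)" if "i < 4" for i
        using lo[of "4 * j + i"] hi[of "4 * j + i"] that \<open>j < m\<close> \<open>j \<noteq> k\<close> L
        by (cases "j < k") auto
      from this[of 0] this[of 1] this[of 2] this[of 3] show ?thesis by (simp add: nibble_def)
    qed
    have "ip m (\<lambda>j. real (nibble w j)) e - ip m (\<lambda>j. real (nibble w' j)) e
        = (\<Sum>j<m. (real (nibble w j) - real (nibble w' j)) * e j)"
      by (simp add: ip_def sum_subtractf algebra_simps)
    also have "\<dots> = (\<Sum>j\<in>{k}. (real (nibble w j) - real (nibble w' j)) * e j)"
      using k same by (intro sum.mono_neutral_right) auto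
    \<comment> \<open>Both inner products are below |e k| / 2 in modulus, so they differ by less
      than |e k|. But their difference is an integer multiple of \<open>e k\<close>, hence
      0.\<close>
    finally have "\<bar>(real (nibble w k) - real (nibble w' k)) * e k\<bar> < \<bar>e k\<bar>"
      using w w' by auto
    then have "\<bar>real (nibble w k) - real (nibble w' k)\<bar> < 1" using ek by (simp add: abs_mult)
    then have "nibble w k = nibble w' k" by linarith
    note mid = nibble_inj[OF this]
    show "w = w'"
    proof (rule nth_equalityI)
      fix i assume "i < length w"
      moreover have "i < 4 * k \<or> i = 4 * k \<or> i = 4 * k + 1 \<or> i = 4 * k + 2 \<or> i = 4 * k + 3 \<or> 4 * k + 4 \<le> i"
        by arith
      ultimately show "w ! i = w' ! i" using lo hi mid len by auto
    qed (simp add: len)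
  qed
  moreover have "finite {w :: bool list. length w = L - 4}"
    using finite_lists_length_eq[of "UNIV :: bool set" "L - 4"] by simp
  moreover have "?f ` ?B \<subseteq> {w. length w = L - 4}" using k L by auto
  ultimately have "card ?B \<le> card {w :: bool list. length w = L - 4}" 
    by (intro card_inj_on_le)
  also have "\<dots> = 2 ^ (L - 4)" using card_lists_length_eq[of "UNIV :: bool set" "L - 4"] by simp
  finally have "16 * card ?B \<le> 2 ^ 4 * 2 ^ (L - 4)" by simp
  also have "\<dots> = 2 ^ L" using k L by (subst power_add[symmetric]) simp
  finally show ?thesis .
qed

lemma prob_large_inner_product:
  assumes k: "k < m" and L: "4 * m \<le> L" and ek: "e k \<noteq> 0"
    and S: "\<And>w. length w = L \<Longrightarrow> \<bar>e k\<bar> / 2 \<le> \<bar>ip m (\<lambda>j. real (nibble w j)) e\<bar> \<Longrightarrow> w \<in> S"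
  shows "measure_pmf.prob (pmf_of_set {w :: bool list. length w = L}) S \<ge> 0.9"
proof -
  let ?W = "{w :: bool list. length w = L}"
  let ?B = "{w :: bool list. length w = L \<and> \<bar>ip m (\<lambda>j. real (nibble w j)) e\<bar> < \<bar>e k\<bar> / 2}"
  have fin: "finite ?W" using finite_lists_length_eq[of "UNIV :: bool set" L] by simp
  have cW: "card ?W = 2 ^ L" using card_lists_length_eq[of "UNIV :: bool set" L] by simp
  have ne: "?W \<noteq> {}" using Ex_list_of_length[of L] by blast
  have "?W - ?B \<subseteq> ?W \<inter> S" using S by force
  then have "card (?W - ?B) \<le> card (?W \<inter> S)" using fin by (intro card_mono) auto
  moreover have "card (?W - ?B) = card ?W - card ?B"
    using fin by (intro card_Diff_subset) (auto intro: finite_subset[of _ ?W])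
  ultimately have "card ?W \<le> card (?W \<inter> S) + card ?B" by linarith
  then have "real (card ?W) \<le> real (card (?W \<inter> S)) + real (card ?B)" by linarith
  moreover have "16 * real (card ?B) \<le> real (card ?W)"
  proof -
    have "real (16 * card ?B) \<le> real (2 ^ L)"
      by (rule of_nat_mono) (rule card_small_inner_product[of k m L e, OF assms(1-3)])
    then show ?thesis using cW by simp
  qed
  ultimately have "0.9 * real (card ?W) \<le> real (card (?W \<inter> S))" by simp
  moreover have "0 < real (card ?W)" using cW by simp
  ultimately have "0.9 \<le> real (card (?W \<inter> S)) / real (card ?W)" by (simp add: field_simps)
  then show ?thesis using measure_pmf_of_set[OF ne fin] by simp
qed

section \<open>Rounding errors of one iteration\<close>

definition bordered :: "nat \<Rightarrow> (nat \<Rightarrow> nat \<Rightarrow> real) \<Rightarrow> real \<Rightarrow> (nat \<Rightarrow> real) \<Rightarrow> nat \<Rightarrow> nat \<Rightarrow> real" where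
  "bordered n a \<beta> b i j = (if j < n then a i j else \<beta> * b i)"

lemma mat_app_bordered: "mat_app (Suc n) (bordered n a \<beta> b) z i = mat_app n a z i + \<beta> * z n * b i"
  by (simp add: mat_app_def bordered_def)

lemma mat_app_bordered_transpose:
  "mat_app n (\<lambda>i j. bordered n a \<beta> b j i) w j = (if j < n then mat_app n (\<lambda>i j. a j i) w j else \<beta> * ip n b w)"
  by (simp add: mat_app_def bordered_def ip_def sum_distrib_left mult_ac)

lemma nrm_le_Suc: "nrm n z \<le> nrm (Suc n) z"
  by (rule power2_le_imp_le) (auto simp: nrm_Suc_sq)

lemma abs_le_nrm_Suc: "\<bar>z n\<bar> \<le> nrm (Suc n) z"
  by (rule power2_le_imp_le) (auto simp: nrm_Suc_sq)

lemma nrm_Suc_le: "nrm (Suc n) z \<le> nrm n z + \<bar>z n\<bar>"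
  by (rule power2_le_imp_le) (auto simp: nrm_Suc_sq power2_sum)

lemma nrm_bordered_le:
  assumes "\<And>z. nrm n (mat_app n a z) \<le> s * nrm n z" "nrm n b = 1" "0 \<le> \<beta>"
  shows "nrm n (mat_app (Suc n) (bordered n a \<beta> b) z) \<le> s * nrm n z + \<beta> * \<bar>z n\<bar>"
proof -
  have "nrm n (mat_app (Suc n) (bordered n a \<beta> b) z) \<le> nrm n (mat_app n a z) + nrm n (\<lambda>i. \<beta> * z n * b i)"
    unfolding mat_app_bordered by (rule nrm_add)
  also have "nrm n (\<lambda>i. \<beta> * z n * b i) = \<beta> * \<bar>z n\<bar>"
    using assms by (subst nrm_scale) (simp add: abs_mult)
  finally show ?thesis using assms(1)[of z] by linarith
qed

lemma nrm_bordered_le':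
  assumes "\<And>z. nrm n (mat_app n a z) \<le> s * nrm n z" "nrm n b = 1" "0 \<le> \<beta>" "s \<le> \<beta>"
  shows "nrm n (mat_app (Suc n) (bordered n a \<beta> b) z) \<le> 2 * \<beta> * nrm (Suc n) z"
proof -
  have "s * nrm n z \<le> \<beta> * nrm (Suc n) z"
    using assms(3,4) nrm_le_Suc[of z n] by (intro mult_mono) auto
  moreover have "\<beta> * \<bar>z n\<bar> \<le> \<beta> * nrm (Suc n) z"
    using assms(3) abs_le_nrm_Suc[of z n] by (intro mult_left_mono)
  ultimately show ?thesis using nrm_bordered_le[OF assms(1-3), of z] by linarith
qed

text \<open>The bound is in terms of s |x| + \<beta> |z n|, with x the first n entries of z, and
  does not rely on s \<le> \<beta>: it must also hold when a scale below the norm is accepted. The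
  300 covers 272 + 6 from the last column and 7 from the query and the additions.\<close>

lemma bordered_product_error:
  assumes s: "\<And>z. nrm n (mat_app n a z) \<le> s * nrm n z" "0 \<le> s" and b: "nrm n b = 1" and \<beta>: "0 \<le> \<beta>"
    and u: "0 \<le> u" "u \<le> \<nu>" "\<nu> \<le> 1/2^20"
    and v: "nrm n (\<lambda>i. v i - mat_app n a z i) \<le> u * s * nrm n z"
    and \<alpha>: "ap (26 * \<nu>) \<alpha> (\<beta> * z n)" and q: "\<And>i. i < n \<Longrightarrow> ap (110 * \<nu>) (q i) (b i)"
    and w: "\<And>i. i < n \<Longrightarrow> \<bar>w i - (v i + \<alpha> * q i)\<bar> \<le> 3 * u * (\<bar>v i\<bar> + \<bar>\<alpha> * q i\<bar>)"
  shows "nrm n (\<lambda>i. w i - mat_app (Suc n) (bordered n a \<beta> b) z i) \<le> 300 * \<nu> * (s * nrm n z + \<beta> * \<bar>z n\<bar>)"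
proof -
  let ?f = "\<lambda>i. \<beta> * z n * b i" and ?d = "\<lambda>i. v i - mat_app n a z i"
  have \<nu>: "0 \<le> \<nu>" using u by linarith
  have pw: "\<bar>w i - mat_app (Suc n) (bordered n a \<beta> b) z i\<bar> \<le> 1 * \<bar>?d i\<bar> + (3 * u) * \<bar>v i\<bar> + (278 * \<nu>) * \<bar>?f i\<bar>"
    if "i < n" for i
  proof -
    have "ap (2 * (26 * \<nu> + 110 * \<nu>)) (\<alpha> * q i) (?f i)"
      using \<alpha> q[OF that] by (rule ap_mult) (use \<nu> u in auto)
    then have e: "\<bar>\<alpha> * q i - ?f i\<bar> \<le> 272 * \<nu> * \<bar>?f i\<bar>" by (simp add: ap_def)
    also have "\<dots> \<le> 1 * \<bar>?f i\<bar>" using u by (intro mult_right_mono) auto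
    finally have "\<bar>\<alpha> * q i\<bar> \<le> 2 * \<bar>?f i\<bar>" by linarith
    then have "3 * u * \<bar>\<alpha> * q i\<bar> \<le> 3 * \<nu> * (2 * \<bar>?f i\<bar>)" using u by (intro mult_mono) auto
    then have "\<bar>w i - (v i + \<alpha> * q i)\<bar> \<le> 3 * u * \<bar>v i\<bar> + 6 * \<nu> * \<bar>?f i\<bar>"
      using w[OF that] by (simp add: algebra_simps)
    then show ?thesis using e unfolding mat_app_bordered by (simp add: algebra_simps)
  qed
  have "nrm n (\<lambda>i. w i - mat_app (Suc n) (bordered n a \<beta> b) z i)
      \<le> 1 * nrm n ?d + (3 * u) * nrm n v + (278 * \<nu>) * nrm n ?f"
    by (rule nrm_le_lincomb3[OF pw]) (use u \<nu> in auto)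
  also have "nrm n ?f = \<beta> * \<bar>z n\<bar>" using b \<beta> by (subst nrm_scale) (simp add: abs_mult)
  finally have 1: "nrm n (\<lambda>i. w i - mat_app (Suc n) (bordered n a \<beta> b) z i)
      \<le> nrm n ?d + 3 * u * nrm n v + 278 * \<nu> * (\<beta> * \<bar>z n\<bar>)" by simp
  define t where "t = s * nrm n z"
  have t: "0 \<le> t" using s by (simp add: t_def)
  have d: "nrm n ?d \<le> u * t" using v by (simp add: t_def mult_ac)
  have ut: "u * t \<le> 1 * t" using u t by (intro mult_right_mono) auto
  have "nrm n v \<le> 2 * t"
    using nrm_diff_triangle[of v n "mat_app n a z"] s(1)[of z] d ut by (simp add: t_def)
  then have "3 * u * nrm n v \<le> 3 * u * (2 * t)" using u by (intro mult_left_mono) auto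
  moreover have "u * t \<le> \<nu> * t" using u t by (intro mult_right_mono) auto
  moreover have "0 \<le> \<nu> * (\<beta> * \<bar>z n\<bar>)" "0 \<le> \<nu> * t" using \<nu> \<beta> t by simp_all
  ultimately show ?thesis using 1 d by (simp add: t_def[symmetric] algebra_simps)
qed

text \<open>With s \<le> \<beta>, every intermediate vector has norm at most a constant times
  \<beta> |z| or \<beta>^2 |z|, and the factor 1 / (4 \<beta>^2) cancels these powers. What remains
  is an error of 260 \<nu> |z| in the first n entries and of 479 \<nu> |z| in the last one.\<close>

lemma step_error:
  assumes s: "\<And>z. nrm n (mat_app n a z) \<le> s * nrm n z" "0 \<le> s" and b: "nrm n b = 1"
    and \<beta>: "0 < \<beta>" "s \<le> \<beta>"
    and u: "0 \<le> u" "u \<le> \<nu>" "\<nu> \<le> 1/2^20"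
    and w: "nrm n (\<lambda>i. w i - mat_app (Suc n) (bordered n a \<beta> b) z i) \<le> 300 * \<nu> * (s * nrm n z + \<beta> * \<bar>z n\<bar>)"
    and q: "\<And>i. i < n \<Longrightarrow> ap (110 * \<nu>) (q i) (b i)"
    and v: "nrm n (\<lambda>j. v j - mat_app n (\<lambda>i j. a j i) w j) \<le> u * s * nrm n w"
    and h: "ap (130 * \<nu>) h (- 1 / (4 * \<beta>\<^sup>2))"
    and x: "\<And>j. j < n \<Longrightarrow> \<bar>z' j - (z j + h * v j)\<bar> \<le> 3 * u * (\<bar>z j\<bar> + \<bar>h * v j\<bar>)"
    and d: "\<bar>d - ip n q w\<bar> \<le> 4 * \<nu> * (\<Sum>i<n. \<bar>q i\<bar> * \<bar>w i\<bar>)"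
    and bt: "ap (12 * \<nu>) bt \<beta>"
    and \<theta>: "\<bar>\<theta>1\<bar> \<le> u" "\<bar>\<theta>2\<bar> \<le> u" "\<bar>\<theta>3\<bar> \<le> u"
    and z': "z' n = (1 + \<theta>3) * (z n + (1 + \<theta>2) * ((1 + \<theta>1) * (d * bt) * h))"
  shows "nrm (Suc n) (\<lambda>j. z' j - gd_step n (Suc n) (bordered n a \<beta> b) (1 / (4 * \<beta>\<^sup>2)) z j)
    \<le> 1000 * \<nu> * nrm (Suc n) z"
proof -
  let ?a = "bordered n a \<beta> b"
  let ?Z = "nrm (Suc n) z" and ?wo = "mat_app (Suc n) ?a z"
  let ?yo = "mat_app n (\<lambda>i j. a j i) ?wo" and ?\<eta> = "1 / (4 * \<beta>\<^sup>2)"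
  have \<nu>: "0 \<le> \<nu>" using u by linarith
  have Z: "0 \<le> ?Z" by simp
  have b2: "0 < \<beta>\<^sup>2" using \<beta> by simp
  have \<nu>Z: "0 \<le> \<nu> * (\<beta> * ?Z)" "0 \<le> \<nu> * ?Z" "0 \<le> \<beta> * ?Z" using \<nu> \<beta> Z by simp_all
  have sT: "nrm n (mat_app n (\<lambda>i j. a j i) y) \<le> s * nrm n y" for y
    by (rule nrm_transpose_le[OF s])
  have sz: "s * nrm n z + \<beta> * \<bar>z n\<bar> \<le> 2 * \<beta> * ?Z"
  proof -
    have "s * nrm n z \<le> \<beta> * ?Z"
      by (intro mult_mono \<beta> nrm_le_Suc) (use \<beta> in auto)
    moreover have "\<beta> * \<bar>z n\<bar> \<le> \<beta> * ?Z"
      by (intro mult_left_mono abs_le_nrm_Suc) (use \<beta> in auto)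
    ultimately show ?thesis by linarith
  qed
  have "300 * \<nu> * (s * nrm n z + \<beta> * \<bar>z n\<bar>) \<le> 300 * \<nu> * (2 * \<beta> * ?Z)"
    using \<nu> by (intro mult_left_mono sz) auto
  then have dw: "nrm n (\<lambda>i. w i - ?wo i) \<le> 600 * \<nu> * (\<beta> * ?Z)" using w by (simp add: algebra_simps)
  have wo: "nrm n ?wo \<le> 2 * (\<beta> * ?Z)"
    using nrm_bordered_le'[OF s(1) b _ \<beta>(2), of z] \<beta> by (simp add: mult_ac)
  have "600 * \<nu> * (\<beta> * ?Z) \<le> 1 * (\<beta> * ?Z)" using u \<nu>Z by (intro mult_right_mono) auto
  then have nw: "nrm n w \<le> 3 * (\<beta> * ?Z)"
    using nrm_diff_triangle[of w n ?wo] dw wo by linarith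
  have s\<beta>: "s * r \<le> \<beta> * t" if "r \<le> t" "0 \<le> t" for r t
    using that s \<beta> by (meson mult_left_mono mult_right_mono order_trans)
  have dv: "nrm n (\<lambda>j. v j - ?yo j) \<le> 603 * \<nu> * (\<beta>\<^sup>2 * ?Z)"
  proof -
    have "nrm n (\<lambda>j. mat_app n (\<lambda>i j. a j i) w j - ?yo j) \<le> s * nrm n (\<lambda>i. w i - ?wo i)"
      using sT[of "\<lambda>i. w i - ?wo i"] by (simp add: mat_app_diff)
    also have "\<dots> \<le> \<beta> * (600 * \<nu> * (\<beta> * ?Z))" using dw \<nu>Z by (intro s\<beta>) (auto simp: mult_ac)
    finally have 1: "nrm n (\<lambda>j. mat_app n (\<lambda>i j. a j i) w j - ?yo j) \<le> 600 * \<nu> * (\<beta>\<^sup>2 * ?Z)"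
      by (simp add: power2_eq_square mult_ac)
    have "u * (s * nrm n w) \<le> \<nu> * (\<beta> * (3 * (\<beta> * ?Z)))"
      using u s nw \<nu>Z(3) by (intro mult_mono s\<beta>) auto
    then have "nrm n (\<lambda>j. v j - mat_app n (\<lambda>i j. a j i) w j) \<le> 3 * \<nu> * (\<beta>\<^sup>2 * ?Z)"
      using v by (simp add: power2_eq_square mult_ac)
    then show ?thesis
      using 1 nrm_triangle3[of v ?yo n "mat_app n (\<lambda>i j. a j i) w"] by linarith
  qed
  have yo: "nrm n ?yo \<le> 2 * (\<beta>\<^sup>2 * ?Z)"
  proof -
    have "nrm n ?yo \<le> \<beta> * (2 * (\<beta> * ?Z))"
      by (rule order_trans[OF sT s\<beta>]) (use wo \<nu>Z in auto)
    then show ?thesis by (simp add: power2_eq_square mult_ac)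
  qed
  have "603 * \<nu> * (\<beta>\<^sup>2 * ?Z) \<le> 1 * (\<beta>\<^sup>2 * ?Z)" using u Z by (intro mult_right_mono) auto
  then have nv: "nrm n v \<le> 3 * (\<beta>\<^sup>2 * ?Z)"
    using nrm_diff_triangle[of v n ?yo] dv yo by linarith
  obtain t where t: "h = (1 + t) * (- 1 / (4 * \<beta>\<^sup>2))" "\<bar>t\<bar> \<le> 130 * \<nu>" using apE[OF h] \<nu> by auto
  have t1: "\<bar>t\<bar> \<le> 1" using t(2) u by simp
  have \<eta>: "0 < ?\<eta>" using b2 by simp
  have xpart: "nrm n (\<lambda>j. z' j - (z j - ?\<eta> * ?yo j)) \<le> 260 * \<nu> * ?Z"
  proof -
    have pw: "\<bar>z' j - (z j - ?\<eta> * ?yo j)\<bar>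
        \<le> (3 * u) * \<bar>z j\<bar> + (136 * \<nu> * ?\<eta>) * \<bar>v j\<bar> + ?\<eta> * \<bar>v j - ?yo j\<bar>" if "j < n" for j
    proof -
      have "\<bar>h\<bar> = \<bar>1 + t\<bar> * ?\<eta>" unfolding t(1) by (simp add: abs_mult)
      also have "\<dots> \<le> 2 * ?\<eta>" using t1 \<eta> by (intro mult_right_mono) auto
      finally have "\<bar>h * v j\<bar> \<le> 2 * ?\<eta> * \<bar>v j\<bar>" 
        unfolding abs_mult by (intro mult_right_mono) auto
      then have "3 * u * \<bar>h * v j\<bar> \<le> 3 * \<nu> * (2 * ?\<eta> * \<bar>v j\<bar>)" using u \<nu> by (intro mult_mono) auto
      then have 1: "\<bar>z' j - (z j + h * v j)\<bar> \<le> 3 * u * \<bar>z j\<bar> + 6 * \<nu> * ?\<eta> * \<bar>v j\<bar>"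
        using x[OF that] by (simp add: algebra_simps)
      have "h * v j + ?\<eta> * ?yo j = - ?\<eta> * (v j - ?yo j) - t * (?\<eta> * v j)"
        unfolding t(1) using b2 by (simp add: divide_simps) (simp add: algebra_simps)
      then have "\<bar>h * v j + ?\<eta> * ?yo j\<bar> \<le> \<bar>?\<eta> * (v j - ?yo j)\<bar> + \<bar>t * (?\<eta> * v j)\<bar>" by linarith
      also have "\<dots> = ?\<eta> * \<bar>v j - ?yo j\<bar> + \<bar>t\<bar> * (?\<eta> * \<bar>v j\<bar>)" using \<eta> by (simp add: abs_mult)
      also have "\<bar>t\<bar> * (?\<eta> * \<bar>v j\<bar>) \<le> 130 * \<nu> * (?\<eta> * \<bar>v j\<bar>)" using t(2) \<eta> by (intro mult_right_mono) auto
      finally have 2: "\<bar>h * v j + ?\<eta> * ?yo j\<bar> \<le> ?\<eta> * \<bar>v j - ?yo j\<bar> + 130 * \<nu> * ?\<eta> * \<bar>v j\<bar>" by (simp add: mult_ac)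
      have "\<bar>z' j - (z j - ?\<eta> * ?yo j)\<bar> \<le> \<bar>z' j - (z j + h * v j)\<bar> + \<bar>h * v j + ?\<eta> * ?yo j\<bar>" by linarith
      with 1 2 have "\<bar>z' j - (z j - ?\<eta> * ?yo j)\<bar> \<le> (3 * u * \<bar>z j\<bar> + 6 * \<nu> * ?\<eta> * \<bar>v j\<bar>)
          + (?\<eta> * \<bar>v j - ?yo j\<bar> + 130 * \<nu> * ?\<eta> * \<bar>v j\<bar>)" by (meson add_mono order_trans)
      then show ?thesis by (simp add: algebra_simps)
    qed
    have "nrm n (\<lambda>j. z' j - (z j - ?\<eta> * ?yo j))
        \<le> (3 * u) * nrm n z + (136 * \<nu> * ?\<eta>) * nrm n v + ?\<eta> * nrm n (\<lambda>j. v j - ?yo j)"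
      by (rule nrm_le_lincomb3[OF pw]) (use u \<nu> \<eta> in auto)
    also have "\<dots> \<le> (3 * \<nu>) * ?Z + (136 * \<nu> * ?\<eta>) * (3 * (\<beta>\<^sup>2 * ?Z)) + ?\<eta> * (603 * \<nu> * (\<beta>\<^sup>2 * ?Z))"
      using u \<nu> \<eta> by (intro add_mono mult_mono nv dv nrm_le_Suc order_refl) auto
    also have "\<dots> = (3 + 102 + 603 / 4) * (\<nu> * ?Z)" using b2 by (simp add: field_simps)
    also have "\<dots> \<le> 260 * (\<nu> * ?Z)" using \<nu>Z by (intro mult_right_mono) auto
    finally show ?thesis by (simp add: mult_ac)
  qed
  let ?Do = "ip n b ?wo"
  have dD: "\<bar>d - ?Do\<bar> \<le> 960 * \<nu> * (\<beta> * ?Z)"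
  proof -
    have q2: "\<bar>q i\<bar> \<le> 2 * \<bar>b i\<bar>" if "i < n" for i
    proof -
      have "(1 + 110 * \<nu>) * \<bar>b i\<bar> \<le> 2 * \<bar>b i\<bar>" using u by (intro mult_right_mono) auto
      then show ?thesis using ap_abs_le[OF q[OF that]] by linarith
    qed
    have "(\<Sum>i<n. \<bar>q i\<bar> * \<bar>w i\<bar>) \<le> (\<Sum>i<n. 2 * (\<bar>b i\<bar> * \<bar>w i\<bar>))"
    proof (rule sum_mono)
      fix i assume "i \<in> {..<n}"
      then have "\<bar>q i\<bar> * \<bar>w i\<bar> \<le> (2 * \<bar>b i\<bar>) * \<bar>w i\<bar>" by (intro mult_right_mono q2) auto
      then show "\<bar>q i\<bar> * \<bar>w i\<bar> \<le> 2 * (\<bar>b i\<bar> * \<bar>w i\<bar>)" by (simp add: mult_ac)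
    qed
    also have "\<dots> \<le> 2 * nrm n w"
      using sum_abs_mult_le_nrm[of b w n] b by (simp add: sum_distrib_left[symmetric])
    finally have "4 * \<nu> * (\<Sum>i<n. \<bar>q i\<bar> * \<bar>w i\<bar>) \<le> 4 * \<nu> * (2 * (3 * (\<beta> * ?Z)))"
      using nw \<nu> by (intro mult_left_mono) auto
    then have 1: "\<bar>d - ip n q w\<bar> \<le> 24 * \<nu> * (\<beta> * ?Z)" using d by (simp add: mult_ac)
    have "nrm n (\<lambda>i. q i - b i) \<le> (110 * \<nu>) * nrm n b + 0 * nrm n b"
      by (rule nrm_le_lincomb2) (use q \<nu> in \<open>auto simp: ap_def\<close>)
    then have "nrm n (\<lambda>i. q i - b i) * nrm n w \<le> (110 * \<nu>) * (3 * (\<beta> * ?Z))"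
      using b nw \<nu> by (intro mult_mono) auto
    moreover have "\<bar>ip n (\<lambda>i. q i - b i) w\<bar> \<le> nrm n (\<lambda>i. q i - b i) * nrm n w" by (rule abs_ip_le)
    moreover have "ip n (\<lambda>i. q i - b i) w = ip n q w - ip n b w"
      by (simp add: ip_def algebra_simps sum_subtractf)
    ultimately have 2: "\<bar>ip n q w - ip n b w\<bar> \<le> 330 * \<nu> * (\<beta> * ?Z)" by (simp add: mult_ac)
    have "\<bar>ip n b (\<lambda>i. w i - ?wo i)\<bar> \<le> nrm n (\<lambda>i. w i - ?wo i)"
      using abs_ip_le[of n b "\<lambda>i. w i - ?wo i"] b by simp
    moreover have "ip n b (\<lambda>i. w i - ?wo i) = ip n b w - ?Do"
      by (simp add: ip_def algebra_simps sum_subtractf)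
    ultimately have "\<bar>ip n b w - ?Do\<bar> \<le> 600 * \<nu> * (\<beta> * ?Z)" using dw by linarith
    moreover have "\<bar>d - ?Do\<bar> \<le> \<bar>d - ip n q w\<bar> + \<bar>ip n q w - ip n b w\<bar> + \<bar>ip n b w - ?Do\<bar>" by linarith
    ultimately show ?thesis using 1 2 \<nu>Z by linarith
  qed
  have "\<bar>?Do\<bar> \<le> 2 * (\<beta> * ?Z)" using abs_ip_le[of n b ?wo] b wo by simp
  moreover have "960 * \<nu> * (\<beta> * ?Z) \<le> 1 * (\<beta> * ?Z)" using u \<nu>Z by (intro mult_right_mono) auto
  moreover have "\<bar>d\<bar> \<le> \<bar>?Do\<bar> + \<bar>d - ?Do\<bar>" by linarith
  ultimately have nd: "\<bar>d\<bar> \<le> 3 * (\<beta> * ?Z)" using dD by linarith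
  \<comment> \<open>The computed change of the last entry; without errors it would be -<b, M z> / (4
    \<beta>).\<close>
  define d2 where "d2 = (1 + \<theta>2) * ((1 + \<theta>1) * (d * bt) * h)"
  have "ap (2 * (0 + 12 * \<nu> + u)) ((1 + \<theta>1) * (d * bt)) (d * \<beta>)"
    using ap_refl bt \<theta>(1) by (rule ap_round_mult) (use u \<nu> in auto)
  then have "ap (26 * \<nu>) ((1 + \<theta>1) * (d * bt)) (d * \<beta>)" by (rule ap_mono) (use u in auto)
  then have "ap (2 * (26 * \<nu> + 130 * \<nu> + u)) d2 (d * \<beta> * (- 1 / (4 * \<beta>\<^sup>2)))"
    unfolding d2_def using h \<theta>(2) by (rule ap_round_mult) (use u \<nu> in auto)
  moreover have "d * \<beta> * (- 1 / (4 * \<beta>\<^sup>2)) = - d / (4 * \<beta>)"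
    using \<beta> by (simp add: power2_eq_square field_simps)
  ultimately have "ap (314 * \<nu>) d2 (- d / (4 * \<beta>))" using u by (auto elim: ap_mono)
  then have "\<bar>d2 + d / (4 * \<beta>)\<bar> \<le> 314 * \<nu> * (\<bar>d\<bar> / (4 * \<beta>))" using \<beta> by (simp add: ap_def abs_divide)
  also have "\<bar>d\<bar> / (4 * \<beta>) \<le> 3/4 * ?Z" using nd \<beta> by (simp add: field_simps)
  then have "314 * \<nu> * (\<bar>d\<bar> / (4 * \<beta>)) \<le> 314 * \<nu> * (3/4 * ?Z)" using \<nu> by (intro mult_left_mono) auto
  finally have d2: "\<bar>d2 + d / (4 * \<beta>)\<bar> \<le> 236 * (\<nu> * ?Z)" using \<nu>Z by (simp add: algebra_simps)
  have "\<bar>d - ?Do\<bar> / (4 * \<beta>) \<le> (960 * \<nu> * (\<beta> * ?Z)) / (4 * \<beta>)" using dD \<beta> by (intro divide_right_mono) auto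
  also have "\<dots> = 240 * (\<nu> * ?Z)" using \<beta> by (simp add: field_simps)
  finally have d3: "\<bar>d / (4 * \<beta>) - ?Do / (4 * \<beta>)\<bar> \<le> 240 * (\<nu> * ?Z)"
    using \<beta> by (simp add: diff_divide_distrib[symmetric] abs_divide)
  have d4: "\<bar>\<theta>3 * (z n + d2)\<bar> \<le> 3 * (\<nu> * ?Z)"
  proof -
    have "236 * \<nu> * ?Z \<le> 1 * ?Z" using u Z by (intro mult_right_mono) auto
    moreover have "\<bar>d / (4 * \<beta>)\<bar> \<le> 3/4 * ?Z" using nd \<beta> by (simp add: field_simps abs_divide)
    moreover have "\<bar>d2\<bar> \<le> \<bar>d2 + d / (4 * \<beta>)\<bar> + \<bar>d / (4 * \<beta>)\<bar>" by linarith
    ultimately have "\<bar>d2\<bar> \<le> 2 * ?Z" using d2 Z by linarith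
    then have "\<bar>z n + d2\<bar> \<le> 3 * ?Z" using abs_le_nrm_Suc[of z n] by linarith
    then have "\<bar>\<theta>3\<bar> * \<bar>z n + d2\<bar> \<le> \<nu> * (3 * ?Z)" using \<theta>(3) u \<nu> by (intro mult_mono) auto
    then show ?thesis by (simp add: abs_mult mult_ac)
  qed
  have gdn: "gd_step n (Suc n) ?a ?\<eta> z n = z n - ?Do / (4 * \<beta>)"
    using \<beta> unfolding gd_step_def mat_app_bordered_transpose by (simp add: power2_eq_square)
  have "\<bar>z' n - gd_step n (Suc n) ?a ?\<eta> z n\<bar>
      = \<bar>\<theta>3 * (z n + d2) + (d2 + d / (4 * \<beta>)) - (d / (4 * \<beta>) - ?Do / (4 * \<beta>))\<bar>"
    unfolding gdn z' d2_def[symmetric] by (simp add: algebra_simps)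
  also have "\<dots> \<le> \<bar>\<theta>3 * (z n + d2)\<bar> + \<bar>d2 + d / (4 * \<beta>)\<bar> + \<bar>d / (4 * \<beta>) - ?Do / (4 * \<beta>)\<bar>"
    by linarith
  also have "\<dots> \<le> 3 * (\<nu> * ?Z) + 236 * (\<nu> * ?Z) + 240 * (\<nu> * ?Z)" by (intro add_mono d2 d3 d4)
  finally have "\<bar>z' n - gd_step n (Suc n) ?a ?\<eta> z n\<bar> \<le> 479 * (\<nu> * ?Z)" by simp
  moreover have "nrm n (\<lambda>j. z' j - gd_step n (Suc n) ?a ?\<eta> z j) = nrm n (\<lambda>j. z' j - (z j - ?\<eta> * ?yo j))"
    by (rule nrm_cong) (simp add: gd_step_def mat_app_bordered_transpose)
  ultimately show ?thesis
    using xpart nrm_Suc_le[of "\<lambda>j. z' j - gd_step n (Suc n) ?a ?\<eta> z j" n] \<nu>Z by (simp add: mult_ac)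
qed

section \<open>The acceptance test\<close>

text \<open>Half of the tolerance for the true residual and an eighth for its rounding make 5/8. The
  square 25/64 becomes at most 1/2 after a generous factor 32/25, while the computed threshold stays
  above half of the exact one.\<close>

lemma test_succeeds:
  assumes w: "nrm n (\<lambda>i. w i - wo i) \<le> e / 8 * \<beta> * Z" and wo: "nrm n wo \<le> e / 2 * \<beta> * Z"
    and R: "ap (4 * \<nu>) R ((nrm n w)\<^sup>2)" and Q: "ap (258 * \<nu>) Q (e\<^sup>2 * \<beta>\<^sup>2 * Z\<^sup>2)"
    and \<nu>: "0 \<le> \<nu>" "\<nu> \<le> 1/2^20" and pos: "0 < e" "0 < \<beta>" "0 < Z"
  shows "R < Q"
proof -
  define t where "t = (e * \<beta> * Z)\<^sup>2"
  have t: "0 < t" using pos by (simp add: t_def)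
  have "nrm n w \<le> 5/8 * (e * \<beta> * Z)"
    using nrm_diff_triangle[of w n wo] w wo by (simp add: algebra_simps)
  then have "(nrm n w)\<^sup>2 \<le> (5/8 * (e * \<beta> * Z))\<^sup>2" by (intro power_mono) auto
  then have n: "(nrm n w)\<^sup>2 \<le> 25/64 * t" by (simp add: t_def power_mult_distrib power_divide)
  have "R \<le> (1 + 4 * \<nu>) * (nrm n w)\<^sup>2" using ap_abs_le[OF R] by simp
  also have "\<dots> \<le> (1 + 4 * \<nu>) * (25/64 * t)" using n \<nu> by (intro mult_left_mono) auto
  also have "\<dots> \<le> 32/25 * (25/64 * t)" using \<nu> t by (intro mult_right_mono) auto
  finally have "R \<le> t / 2" by simp
  moreover have "258 * \<nu> * t < 1/2 * t" using \<nu> t by (intro mult_strict_right_mono) auto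
  moreover have "e\<^sup>2 * \<beta>\<^sup>2 * Z\<^sup>2 = t" by (simp add: t_def power_mult_distrib)
  moreover have "\<bar>Q - t\<bar> \<le> 258 * \<nu> * t" using Q t calculation(3) by (simp add: ap_def)
  ultimately show ?thesis by linarith
qed

text \<open>The computed threshold is at most twice the exact one and the computed square at least
  half of the exact one, so the squares differ by a factor of at most 4 and the norms by 2.\<close>

lemma test_sound:
  assumes RQ: "R < Q"
    and R: "ap (4 * \<nu>) R ((nrm n w)\<^sup>2)" and Q: "ap (258 * \<nu>) Q (e\<^sup>2 * \<beta>\<^sup>2 * Z\<^sup>2)"
    and \<nu>: "0 \<le> \<nu>" "\<nu> \<le> 1/2^20" and pos: "0 \<le> e" "0 \<le> \<beta>" "0 \<le> Z"
  shows "nrm n w \<le> 2 * e * \<beta> * Z"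
proof (rule power2_le_imp_le)
  define t where "t = e\<^sup>2 * \<beta>\<^sup>2 * Z\<^sup>2"
  have t: "0 \<le> t" by (simp add: t_def)
  have "\<bar>Q\<bar> \<le> (1 + 258 * \<nu>) * t" using ap_abs_le[OF Q] t by (simp add: t_def)
  also have "\<dots> \<le> 2 * t" using \<nu> t by (intro mult_right_mono) auto
  finally have "R \<le> 2 * t" using RQ by linarith
  moreover have "4 * \<nu> * (nrm n w)\<^sup>2 \<le> 1/2 * (nrm n w)\<^sup>2" using \<nu> by (intro mult_right_mono) auto
  moreover have "(nrm n w)\<^sup>2 - 4 * \<nu> * (nrm n w)\<^sup>2 \<le> R" using R by (simp add: ap_def abs_if split: if_splits)
  ultimately have "(nrm n w)\<^sup>2 \<le> 4 * t" by linarith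
  then show "(nrm n w)\<^sup>2 \<le> (2 * e * \<beta> * Z)\<^sup>2" by (simp add: t_def power_mult_distrib)
qed (use pos in simp)

text \<open>Soundness of the test at any scale \<beta> \<le> 2 s, whether or not the iteration has
  converged. With f = -c / (\<beta> \<tau>) one has A (f x) - c b = f (A x + \<beta> \<tau> b), so a
  small residual of the bordered matrix becomes one of A. The shares e (rounding of y), 12 e (test)
  and 4 e (shift of \<tau>) make 17 e; the bound 32 e explains the \<epsilon>/32 in the
  program.\<close>

lemma accepted_residual:
  assumes s: "\<And>z. nrm n (mat_app n a z) \<le> s * nrm n z" "0 \<le> s" and b: "nrm n b = 1"
    and \<beta>: "0 < \<beta>" "\<beta> \<le> 2 * s"
    and \<nu>: "0 \<le> \<nu>" "700 * \<nu> \<le> e" and e: "0 < e" "e \<le> 1/32"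
    and w: "nrm n (\<lambda>i. w i - mat_app (Suc n) (bordered n a \<beta> b) z i) \<le> 300 * \<nu> * (s * nrm n z + \<beta> * \<bar>z n\<bar>)"
    and nw: "nrm n w \<le> 2 * e * \<beta> * nrm (Suc n) z"
    and \<tau>: "\<bar>\<tau> - z n\<bar> \<le> 2 * e * nrm n z" "\<tau> \<noteq> 0"
    and c: "0 < c" and z: "0 < nrm n z"
    and y: "\<And>i. i < n \<Longrightarrow> ap (700 * \<nu>) (y i) (- c / (\<beta> * \<tau>) * z i)"
  shows "0 < nrm n y"
    and "nrm n (\<lambda>i. mat_app n a y i - c * b i) \<le> 32 * e * s * nrm n y"
proof -
  let ?wo = "mat_app (Suc n) (bordered n a \<beta> b) z"
  define X where "X = s * nrm n z"
  define M where "M = X + \<beta> * \<bar>z n\<bar>"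
  have s0: "0 < s" using \<beta> by linarith
  have X: "0 < X" using s0 z by (simp add: X_def)
  have M: "0 \<le> M" using X \<beta> by (simp add: M_def)
  have "nrm n w \<le> 2 * e * (\<beta> * nrm n z + \<beta> * \<bar>z n\<bar>)"
  proof -
    have "2 * e * \<beta> * nrm (Suc n) z \<le> 2 * e * \<beta> * (nrm n z + \<bar>z n\<bar>)"
      using e \<beta> by (intro mult_left_mono nrm_Suc_le) auto
    then show ?thesis using nw by (simp add: algebra_simps)
  qed
  also have "\<dots> \<le> 2 * e * (2 * M)"
  proof -
    have "\<beta> * nrm n z \<le> 2 * s * nrm n z" using \<beta> by (intro mult_right_mono) auto
    then have "\<beta> * nrm n z + \<beta> * \<bar>z n\<bar> \<le> 2 * M"
    proof -
      have "0 \<le> \<beta> * \<bar>z n\<bar>" using \<beta> by simp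
      then show ?thesis using \<open>\<beta> * nrm n z \<le> 2 * s * nrm n z\<close> unfolding M_def X_def by argo
    qed
    then show ?thesis using e by (intro mult_left_mono) auto
  qed
  finally have "nrm n w \<le> 4 * (e * M)" by simp
  moreover have "300 * \<nu> * M \<le> e * M" using \<nu> M by (intro mult_right_mono) auto
  ultimately have wo: "nrm n ?wo \<le> 5 * (e * M)"
    using nrm_diff_triangle[of ?wo n w] w by (simp add: nrm_minus_commute[of _ ?wo] M_def X_def)
  have eM: "5 * (e * M) \<le> 5/32 * M" using e M mult_right_mono[of e "1/32" M] by linarith
  \<comment> \<open>As b is a unit vector, \<beta> |z n| is at most the residual plus |A x|. Hence a
    tolerance relative to all of z is, up to a constant, one relative to s |x| alone.\<close>
  have "\<beta> * \<bar>z n\<bar> = nrm n (\<lambda>i. (\<beta> * z n) * b i)" using b \<beta> by (subst nrm_scale) (simp add: abs_mult)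
  also have "\<dots> = nrm n (\<lambda>i. ?wo i - mat_app n a z i)" by (simp add: mat_app_bordered)
  also have "\<dots> \<le> nrm n ?wo + X"
    using nrm_triangle3[of ?wo "mat_app n a z" n "\<lambda>_. 0"] s(1)[of z]
    using nrm_scale[of "- 1" "mat_app n a z" n] by (simp add: X_def)
  finally have "M \<le> 2 * X + 5 * (e * M)" using wo by (simp add: M_def)
  then have "M \<le> 12/5 * X" using eM X by linarith
  then have "e * M \<le> e * (12/5 * X)" using e by (intro mult_left_mono) auto
  then have wo12: "nrm n ?wo \<le> 12 * (e * X)" using wo by simp
  let ?r = "\<lambda>i. mat_app n a z i + \<beta> * \<tau> * b i"
  have "nrm n ?r \<le> nrm n ?wo + nrm n (\<lambda>i. ?r i - ?wo i)" by (rule nrm_diff_triangle)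
  also have "nrm n (\<lambda>i. ?r i - ?wo i) = nrm n (\<lambda>i. (\<beta> * (\<tau> - z n)) * b i)"
    by (rule nrm_cong) (simp add: mat_app_bordered algebra_simps)
  also have "\<dots> = \<beta> * \<bar>\<tau> - z n\<bar>" using b \<beta> by (subst nrm_scale) (simp add: abs_mult)
  also have "\<dots> \<le> (2 * s) * (2 * e * nrm n z)" using \<beta> \<tau> s by (intro mult_mono) auto
  also have "\<dots> = 4 * (e * X)" by (simp add: X_def)
  finally have r: "nrm n ?r \<le> 16 * (e * X)" using wo12 by linarith
  define f where "f = - c / (\<beta> * \<tau>)"
  have f0: "0 < \<bar>f\<bar>" using c \<beta> \<tau> by (simp add: f_def)
  define Y where "Y = \<bar>f\<bar> * nrm n z"
  have Y: "0 < Y" using f0 z by (simp add: Y_def)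
  have dy: "nrm n (\<lambda>i. y i - f * z i) \<le> 700 * \<nu> * Y"
  proof -
    have "nrm n (\<lambda>i. y i - f * z i) \<le> (700 * \<nu>) * nrm n (\<lambda>i. f * z i) + 0 * nrm n z"
      by (rule nrm_le_lincomb2) (use y \<nu> in \<open>auto simp: ap_def f_def\<close>)
    then show ?thesis by (simp add: nrm_scale Y_def)
  qed
  have \<nu>Y: "700 * \<nu> * Y \<le> e * Y" using \<nu> Y by (intro mult_right_mono) auto
  have eY: "e * Y \<le> 1/32 * Y" using e Y by (intro mult_right_mono) auto
  have "Y \<le> nrm n y + nrm n (\<lambda>i. f * z i - y i)"
    using nrm_diff_triangle[of "\<lambda>i. f * z i" n y] by (simp add: nrm_scale Y_def)
  then have Yy: "Y \<le> 32/31 * nrm n y"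
    using dy \<nu>Y eY by (simp add: nrm_minus_commute[of _ "\<lambda>i. f * z i"])
  then show "0 < nrm n y" using Y by linarith
  have "nrm n (\<lambda>i. mat_app n a y i - c * b i)
      \<le> nrm n (\<lambda>i. mat_app n a y i - f * mat_app n a z i) + nrm n (\<lambda>i. f * mat_app n a z i - c * b i)"
    by (rule nrm_triangle3)
  also have "nrm n (\<lambda>i. mat_app n a y i - f * mat_app n a z i) = nrm n (mat_app n a (\<lambda>i. y i - f * z i))"
    by (simp add: mat_app_diff mat_app_scale)
  also have "\<dots> \<le> s * (700 * \<nu> * Y)" using s(1) dy by (rule order_trans[OF _ mult_left_mono]) (use s in auto)
  also have "\<dots> \<le> s * (e * Y)" using \<nu>Y s by (intro mult_left_mono)
  also have "nrm n (\<lambda>i. f * mat_app n a z i - c * b i) = nrm n (\<lambda>i. f * ?r i)"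
    by (rule nrm_cong) (use \<beta> \<tau> in \<open>simp add: f_def field_simps\<close>)
  also have "\<dots> = \<bar>f\<bar> * nrm n ?r" by (rule nrm_scale)
  also have "\<dots> \<le> \<bar>f\<bar> * (16 * (e * X))" using r by (intro mult_left_mono) auto
  also have "\<dots> = 16 * (s * (e * Y))" by (simp add: X_def Y_def mult_ac)
  finally have "nrm n (\<lambda>i. mat_app n a y i - c * b i) \<le> 17 * (s * (e * Y))" by (simp add: mult_ac)
  also have "\<dots> \<le> 17 * (s * (e * (32/31 * nrm n y)))" using Yy s e by (intro mult_left_mono) auto
  also have "\<dots> \<le> 32 * (s * (e * nrm n y))" using s e by simp
  finally show "nrm n (\<lambda>i. mat_app n a y i - c * b i) \<le> 32 * e * s * nrm n y" by (simp add: mult_ac)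
qed

section \<open>Reasoning about programs\<close>

text \<open>Total correctness: a fault has no rule in \<open>exec\<close>, so the mere existence of
  a final state excludes faults and divergence. All errors are fixed in advance by
  \<open>E\<close>.\<close>

definition wp :: "env \<Rightarrow> com \<Rightarrow> (state \<Rightarrow> bool) \<Rightarrow> state \<Rightarrow> bool" where
  "wp E c Q s \<longleftrightarrow> (\<exists>t. exec E c s t \<and> Q t)"

lemma wp_mono: "wp E c Q s \<Longrightarrow> (\<And>t. Q t \<Longrightarrow> Q' t) \<Longrightarrow> wp E c Q' s"
  unfolding wp_def by blast

lemma wp_Skip: "Q s \<Longrightarrow> wp E Skip Q s"
  unfolding wp_def using exec.Skip by blast

lemma wp_Seq: "wp E c (wp E c' Q) s \<Longrightarrow> wp E (Seq c c') Q s"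
  unfolding wp_def using exec.Seq by blast

lemma wp_Assign: "real (aval a (regs s)) \<le> wmax E \<Longrightarrow> Q (set_reg x (aval a (regs s)) s) \<Longrightarrow>
    wp E (Assign x a) Q s"
  unfolding wp_def using exec.Assign by blast

lemma wp_Flip: "tape s = \<beta> # w \<Longrightarrow> Q (set_reg x (of_bool \<beta>) (s\<lparr>tape := w\<rparr>)) \<Longrightarrow> wp E (Flip x) Q s"
  unfolding wp_def using exec.Flip by blast

lemma wp_Cond: "bsafe g s \<Longrightarrow> (bval g s \<Longrightarrow> wp E c Q s) \<Longrightarrow> (\<not> bval g s \<Longrightarrow> wp E c' Q s) \<Longrightarrow>
    wp E (Cond g c c') Q s"
  unfolding wp_def using exec.CondTrue exec.CondFalse by (cases "bval g s") blast+

lemma wp_While_unfold: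
  "bsafe g s \<Longrightarrow> (bval g s \<Longrightarrow> wp E c (wp E (While g c) Q) s) \<Longrightarrow> (\<not> bval g s \<Longrightarrow> Q s) \<Longrightarrow>
    wp E (While g c) Q s"
  unfolding wp_def using exec.WhileTrue exec.WhileFalse by (cases "bval g s") blast+

lemma wp_While:
  fixes f :: "state \<Rightarrow> nat"
  assumes "I s" "\<And>t. I t \<Longrightarrow> bsafe g t" "\<And>t. I t \<Longrightarrow> \<not> bval g t \<Longrightarrow> Q t"
    and "\<And>t. I t \<Longrightarrow> bval g t \<Longrightarrow> wp E c (\<lambda>t'. I t' \<and> f t' < f t) t"
  shows "wp E (While g c) Q s"
  using assms(1)
proof (induction "f s" arbitrary: s rule: less_induct)
  case less
  show ?case
  proof (rule wp_While_unfold)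
    show "bsafe g s" by (rule assms(2)[OF less.prems])
    show "\<not> bval g s \<Longrightarrow> Q s" by (rule assms(3)[OF less.prems])
    assume "bval g s"
    from assms(4)[OF less.prems this] show "wp E c (wp E (While g c) Q) s"
      by (rule wp_mono) (use less.hyps in blast)
  qed
qed

definition For :: "nat \<Rightarrow> aexp \<Rightarrow> com \<Rightarrow> com" where
  "For r l c = Seq (Assign r (N 0)) (While (NLess (V r) l) (Seq c (Assign r (Add (V r) (N 1)))))"

text \<open>The limit \<open>l\<close> is evaluated anew at every test, so it must keep its value m
  under the invariant; m \<le> \<open>wmax E\<close> prevents an overflow of the counter. The
  invariant speaks of the state in which the counter already has its new value.\<close>

lemma wp_For:
  assumes I0: "I 0 (set_reg r 0 s)"
    and step: "\<And>k t. k < m \<Longrightarrow> I k t \<Longrightarrow> regs t r = k \<Longrightarrow>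
      wp E c (\<lambda>t'. regs t' r = k \<and> I (Suc k) (set_reg r (Suc k) t')) t"
    and l: "\<And>k t. k \<le> m \<Longrightarrow> I k t \<Longrightarrow> aval l (regs t) = m"
    and m: "real m \<le> wmax E"
    and fin: "\<And>t. I m t \<Longrightarrow> Q t"
  shows "wp E (For r l c) Q s"
  unfolding For_def
proof (rule wp_Seq, rule wp_Assign)
  have w: "0 \<le> wmax E" using m by (meson of_nat_0_le_iff order_trans)
  then show "real (aval (N 0) (regs s)) \<le> wmax E" by simp
  show "wp E (While (NLess (V r) l) (Seq c (Assign r (Add (V r) (N 1))))) Q
     (set_reg r (aval (N 0) (regs s)) s)"
  proof (rule wp_While[where I = "\<lambda>t. regs t r \<le> m \<and> I (regs t r) t" and f = "\<lambda>t. m - regs t r"])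
    show "regs (set_reg r (aval (N 0) (regs s)) s) r \<le> m \<and>
      I (regs (set_reg r (aval (N 0) (regs s)) s) r) (set_reg r (aval (N 0) (regs s)) s)"
      using I0 by (simp add: set_reg_def)
  next
    fix t assume t: "regs t r \<le> m \<and> I (regs t r) t" and "\<not> bval (NLess (V r) l) t"
    then have "regs t r = m" using l[of "regs t r" t] by simp
    then show "Q t" using t fin by simp
  next
    fix t assume t: "regs t r \<le> m \<and> I (regs t r) t" and g: "bval (NLess (V r) l) t"
    then have k: "regs t r < m" using l[of "regs t r" t] by simp
    show "wp E (Seq c (Assign r (Add (V r) (N 1))))
        (\<lambda>t'. (regs t' r \<le> m \<and> I (regs t' r) t') \<and> m - regs t' r < m - regs t r) t"
    proof (rule wp_Seq, rule wp_mono[OF step[OF k]])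
      fix t' assume "regs t' r = regs t r \<and> I (Suc (regs t r)) (set_reg r (Suc (regs t r)) t')"
      then show "wp E (Assign r (Add (V r) (N 1)))
          (\<lambda>t'. (regs t' r \<le> m \<and> I (regs t' r) t') \<and> m - regs t' r < m - regs t r) t'"
        using k m by (intro wp_Assign) (auto simp: set_reg_def)
    qed (use t in auto)
  qed simp
qed

text \<open>The effect of \<open>store_rounded\<close> once the rounded value is known. The rules
  below quantify over all errors of size at most u, so the operation counter that selects the error
  is never tracked.\<close>

definition put :: "nat \<Rightarrow> real \<Rightarrow> state \<Rightarrow> state" where
  "put i x s = s\<lparr>mem := (mem s)[i := x], nops := Suc (nops s)\<rparr>"

lemma put_simps [simp]:
  "regs (put i x s) = regs s" "mem (put i x s) = (mem s)[i := x]"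
  "tape (put i x s) = tape s" "queries (put i x s) = queries s"
  by (simp_all add: put_def)

lemma set_reg_simps [simp]:
  "regs (set_reg r v s) = (regs s)(r := v)" "mem (set_reg r v s) = mem s"
  "tape (set_reg r v s) = tape s" "queries (set_reg r v s) = queries s"
  by (simp_all add: set_reg_def)

definition ad :: "nat \<Rightarrow> nat \<Rightarrow> aexp" where
  "ad k c = Add (Mul (N k) (V 0)) (N c)"

lemma aval_ad [simp]: "aval (ad k c) r = k * r 0 + c"
  by (simp add: ad_def)

text \<open>A footprint: X and R are the cells and registers that may have changed, q is the number
  of queries made. \<open>nops\<close> is left free, since any error sequence is allowed
  anyway.\<close>

definition frame :: "nat \<Rightarrow> nat set \<Rightarrow> nat set \<Rightarrow> state \<Rightarrow> state \<Rightarrow> bool" where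
  "frame q X R s t \<longleftrightarrow> length (mem t) = length (mem s) \<and> tape t = tape s \<and> queries t = queries s + q \<and>
     (\<forall>j. j \<notin> X \<longrightarrow> mem t ! j = mem s ! j) \<and> (\<forall>r. r \<notin> R \<longrightarrow> regs t r = regs s r)"

lemma frame_refl: "frame 0 X R s s"
  by (simp add: frame_def)

lemma frame_trans: "frame q X R s t \<Longrightarrow> frame q' X R t t' \<Longrightarrow> frame (q + q') X R s t'"
  by (simp add: frame_def)

lemma frame_mono: "frame q X R s t \<Longrightarrow> X \<subseteq> X' \<Longrightarrow> R \<subseteq> R' \<Longrightarrow> frame q X' R' s t"
  unfolding frame_def by blast

lemma frame_set_reg: "frame q X R s t \<Longrightarrow> r \<in> R \<Longrightarrow> frame q X R s (set_reg r v t)"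
  by (simp add: frame_def)

lemma frame_put: "frame q X R s t \<Longrightarrow> i \<in> X \<Longrightarrow> frame q X R s (put i x t)"
  by (auto simp: frame_def) (metis nth_list_update_neq)

lemma frame_memD: "frame q X R s t \<Longrightarrow> j \<notin> X \<Longrightarrow> mem t ! j = mem s ! j"
  by (simp add: frame_def)

lemma frame_regD: "frame q X R s t \<Longrightarrow> r \<notin> R \<Longrightarrow> regs t r = regs s r"
  by (simp add: frame_def)

lemma frame_lenD: "frame q X R s t \<Longrightarrow> length (mem t) = length (mem s)"
  by (simp add: frame_def)

definition Dot :: "aexp \<Rightarrow> aexp \<Rightarrow> aexp \<Rightarrow> aexp \<Rightarrow> com" where
  "Dot d p q l = Seq (Load d (N 0)) (For 1 l (Seq
     (Arith FMul (ad 1 2) (Add p (V 1)) (Add q (V 1))) (Arith FAdd d d (ad 1 2))))"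

definition Axpy :: "aexp \<Rightarrow> aexp \<Rightarrow> aexp \<Rightarrow> aexp \<Rightarrow> aexp \<Rightarrow> com" where
  "Axpy d p a q l = For 1 l (Seq (Arith FMul (ad 1 2) a (Add q (V 1)))
     (Arith FAdd (Add d (V 1)) (Add p (V 1)) (ad 1 2)))"

section \<open>Error bounds for rounded vector operations\<close>

locale machine =
  fixes E :: env and n :: nat and u :: real and A :: "real mat"
  assumes n_pos: "1 \<le> n" and ndim: "ndim E = n" and A: "A \<in> carrier_mat n n"
    and u_nonneg: "0 \<le> u" and theta: "\<And>k. \<bar>theta E k\<bar> \<le> u"
    and mv: "\<And>k. eps_matvec u A (mv E k)" and mvT: "\<And>k. eps_matvec u (transpose_mat A) (mvT E k)"
begin

lemma wp_Arith:
  assumes "aval d (regs s) < length (mem s)" "aval a (regs s) < length (mem s)" "aval a' (regs s) < length (mem s)"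
    and "f = FDiv \<Longrightarrow> mem s ! aval a' (regs s) \<noteq> 0"
    and "\<And>\<theta>. \<bar>\<theta>\<bar> \<le> u \<Longrightarrow> Q (put (aval d (regs s))
       ((1 + \<theta>) * fop_val f (mem s ! aval a (regs s)) (mem s ! aval a' (regs s))) s)"
  shows "wp E (Arith f d a a') Q s"
  unfolding wp_def
  using exec.Arith[where E = E, OF assms(1-4)] assms(5)[OF theta[of "nops s"]]
  by (auto simp: store_rounded_def put_def)

lemma wp_Load:
  assumes "aval d (regs s) < length (mem s)" "real (aval a (regs s)) \<le> wmax E"
    and "\<And>\<theta>. \<bar>\<theta>\<bar> \<le> u \<Longrightarrow> Q (put (aval d (regs s)) ((1 + \<theta>) * real (aval a (regs s))) s)"
  shows "wp E (Load d a) Q s"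
  unfolding wp_def
  using exec.Load[OF assms(1,2)] assms(3)[OF theta[of "nops s"]]
  by (auto simp: store_rounded_def put_def)

lemma wp_Sqrt:
  assumes "aval d (regs s) < length (mem s)" "aval a (regs s) < length (mem s)" "0 \<le> mem s ! aval a (regs s)"
    and "\<And>\<theta>. \<bar>\<theta>\<bar> \<le> u \<Longrightarrow> Q (put (aval d (regs s)) ((1 + \<theta>) * sqrt (mem s ! aval a (regs s))) s)"
  shows "wp E (Sqrt d a) Q s"
  unfolding wp_def
  using exec.Sqrt[where E = E, OF assms(1-3)] assms(4)[OF theta[of "nops s"]]
  by (auto simp: store_rounded_def put_def)

abbreviation sp :: real where "sp \<equiv> spectral_norm A"

abbreviation seg :: "nat \<Rightarrow> state \<Rightarrow> nat \<Rightarrow> real" where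
  "seg p s \<equiv> \<lambda>i. mem s ! (p + i)"

lemma block_index: "p + n \<le> length (mem s) \<Longrightarrow> block n p s \<in> carrier_vec n"
  "p + n \<le> length (mem s) \<Longrightarrow> i < n \<Longrightarrow> block n p s $ i = mem s ! (p + i)"
  unfolding block_def by (simp_all add: carrier_dim_vec vec_of_list_index)

lemma store_answer_frame:
  assumes "d + n \<le> length (mem s)" "y \<in> carrier_vec n"
  shows "frame 1 {d..<d + n} {} s (store_answer E d y s)"
    and "\<And>i. i < n \<Longrightarrow> mem (store_answer E d y s) ! (d + i) = y $ i"
proof -
  have ly: "length (list_of_vec y) = n" using assms by simp
  have m: "mem (store_answer E d y s) = take d (mem s) @ list_of_vec y @ drop (d + n) (mem s)"
    by (simp add: store_answer_def ndim)
  have "mem (store_answer E d y s) ! j = mem s ! j" if "j \<notin> {d..<d + n}" for j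
  proof (cases "j < d")
    case True then show ?thesis using assms by (simp add: m nth_append)
  next
    case False
    then have "d + n \<le> j" using that by auto
    then show ?thesis using assms ly n_pos unfolding m by (auto simp: nth_append min_def)
  qed
  then show "frame 1 {d..<d + n} {} s (store_answer E d y s)"
    using assms ly by (simp add: frame_def m) (simp add: store_answer_def)
  show "mem (store_answer E d y s) ! (d + i) = y $ i" if "i < n" for i
    using that assms ly unfolding m by (simp add: nth_append list_of_vec_index)
qed

lemma wp_MatVec:
  assumes d: "aval d (regs s) = D" "D + n \<le> length (mem s)" and a: "aval a (regs s) = P" "P + n \<le> length (mem s)"
    and Q: "\<And>t. frame 1 {D..<D + n} {} s t \<Longrightarrow>
      nrm n (\<lambda>i. seg D t i - mat_app n (mfun A) (seg P s) i) \<le> u * sp * nrm n (seg P s) \<Longrightarrow> Q t"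
  shows "wp E (MatVec d a) Q s"
proof -
  let ?w = "block n P s"
  let ?y = "mv E (queries s) ?w"
  note w = block_index[OF a(2)]
  note y = eps_matvecD[OF mv A w(1), of "queries s"]
  let ?t = "store_answer E D ?y s"
  have ex: "exec E (MatVec d a) s ?t"
    using exec.MatVec[of d s E a] d a by (simp add: ndim)
  have fr: "frame 1 {D..<D + n} {} s ?t" by (rule store_answer_frame(1)[OF d(2) y(1)])
  have "nrm n (\<lambda>i. seg D ?t i - mat_app n (mfun A) (seg P s) i)
      = nrm n (\<lambda>i. ?y $ i - mat_app n (mfun A) (vec_index ?w) i)"
    by (intro nrm_cong arg_cong2[of _ _ _ _ "(-)"] mat_app_cong)
      (simp_all add: store_answer_frame(2)[OF d(2) y(1)] w)
  moreover have "nrm n (vec_index ?w) = nrm n (seg P s)" by (rule nrm_cong) (simp add: w)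
  ultimately have "Q ?t" using Q[OF fr] y(2) by simp
  then show ?thesis unfolding wp_def using ex by blast
qed

lemma wp_MatVecT:
  assumes d: "aval d (regs s) = D" "D + n \<le> length (mem s)" and a: "aval a (regs s) = P" "P + n \<le> length (mem s)"
    and Q: "\<And>t. frame 1 {D..<D + n} {} s t \<Longrightarrow>
      nrm n (\<lambda>i. seg D t i - mat_app n (\<lambda>i j. mfun A j i) (seg P s) i) \<le> u * sp * nrm n (seg P s) \<Longrightarrow> Q t"
  shows "wp E (MatVecT d a) Q s"
proof -
  let ?w = "block n P s"
  let ?y = "mvT E (queries s) ?w"
  note w = block_index[OF a(2)]
  have AT: "transpose_mat A \<in> carrier_mat n n" using A by simp
  note y = eps_matvecD[OF mvT AT w(1), of "queries s"]
  let ?t = "store_answer E D ?y s"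
  have ex: "exec E (MatVecT d a) s ?t"
    using exec.MatVecT[of d s E a] d a by (simp add: ndim)
  have fr: "frame 1 {D..<D + n} {} s ?t" by (rule store_answer_frame(1)[OF d(2) y(1)])
  have "nrm n (\<lambda>i. seg D ?t i - mat_app n (\<lambda>i j. mfun A j i) (seg P s) i)
      = nrm n (\<lambda>i. ?y $ i - mat_app n (mfun (transpose_mat A)) (vec_index ?w) i)"
    using A by (intro nrm_cong arg_cong2[of _ _ _ _ "(-)"] mat_app_cong)
      (simp_all add: store_answer_frame(2)[OF d(2) y(1)] w)
  moreover have "nrm n (vec_index ?w) = nrm n (seg P s)" by (rule nrm_cong) (simp add: w)
  moreover have "u * spectral_norm (transpose_mat A) * nrm n (vec_index ?w) \<le> u * sp * nrm n (vec_index ?w)"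
    using u_nonneg by (intro mult_right_mono mult_left_mono spectral_norm_transpose_le[OF A]) auto
  ultimately have "Q ?t" using Q[OF fr] y(2) by simp
  then show ?thesis unfolding wp_def using ex by blast
qed

text \<open>Quantifying over all register contents with n in register 0 makes an address independent
  of loop counters, so it keeps its value throughout a loop.\<close>

definition addr :: "aexp \<Rightarrow> nat \<Rightarrow> bool" where
  "addr p k \<longleftrightarrow> (\<forall>r. r 0 = n \<longrightarrow> aval p r = k)"

lemma addr_ad: "k * n + c = j \<Longrightarrow> addr (ad k c) j"
  by (simp add: addr_def)

lemma addrD: "addr p k \<Longrightarrow> r 0 = n \<Longrightarrow> aval p r = k"
  by (simp add: addr_def)

text \<open>Induction step of the usual dot product bound. The new contributions are 2 u B + 3 u |x
  y|, and 4 u (B + |x y|) covers them; the smallness of 4 (k + 1) u keeps the old error below B, so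
  that rounding it once more costs at most u B.\<close>

lemma dot_step_error:
  fixes acc S B x y :: real
  assumes acc: "\<bar>acc - S\<bar> \<le> 4 * real k * u * B" and S: "\<bar>S\<bar> \<le> B"
    and \<theta>: "\<bar>\<theta>1\<bar> \<le> u" "\<bar>\<theta>2\<bar> \<le> u" and k: "4 * real (Suc k) * u \<le> 1"
  shows "\<bar>(1 + \<theta>2) * (acc + (1 + \<theta>1) * (x * y)) - (S + x * y)\<bar> \<le> 4 * real (Suc k) * u * (B + \<bar>x\<bar> * \<bar>y\<bar>)"
proof -
  let ?p = "\<bar>x\<bar> * \<bar>y\<bar>"
  have B: "0 \<le> B" using S by linarith
  have "1 * u \<le> 4 * real (Suc k) * u" using u_nonneg by (intro mult_right_mono) auto
  then have u1: "u \<le> 1" using k by linarith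
  have p: "0 \<le> ?p" by simp
  have "(1 + \<theta>2) * (acc + (1 + \<theta>1) * (x * y)) - (S + x * y)
      = (acc - S) + \<theta>2 * (acc - S) + \<theta>2 * S + \<theta>1 * (x * y) + \<theta>2 * (x * y) + \<theta>2 * (\<theta>1 * (x * y))"
    by (simp add: algebra_simps)
  also have "\<bar>\<dots>\<bar> \<le> \<bar>acc - S\<bar> + \<bar>\<theta>2 * (acc - S)\<bar> + \<bar>\<theta>2 * S\<bar> + \<bar>\<theta>1 * (x * y)\<bar> + \<bar>\<theta>2 * (x * y)\<bar>
      + \<bar>\<theta>2 * (\<theta>1 * (x * y))\<bar>" by linarith
  also have "\<dots> \<le> 4 * real k * u * B + u * (1 * B) + u * B + u * ?p + u * ?p + 1 * (u * ?p)"
  proof (intro add_mono acc)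
    have "4 * real k * u \<le> 1" using k u_nonneg by (simp add: algebra_simps)
    then have "4 * real k * u * B \<le> 1 * B" using B by (intro mult_right_mono)
    then have "\<bar>acc - S\<bar> \<le> 1 * B" using acc by linarith
    then show "\<bar>\<theta>2 * (acc - S)\<bar> \<le> u * (1 * B)" unfolding abs_mult using \<theta> u_nonneg by (intro mult_mono) auto
    show "\<bar>\<theta>2 * S\<bar> \<le> u * B" unfolding abs_mult using \<theta> S u_nonneg by (intro mult_mono) auto
    show 1: "\<bar>\<theta>1 * (x * y)\<bar> \<le> u * ?p" unfolding abs_mult using \<theta> by (intro mult_right_mono) auto
    show "\<bar>\<theta>2 * (x * y)\<bar> \<le> u * ?p" unfolding abs_mult using \<theta> by (intro mult_right_mono) auto
    show "\<bar>\<theta>2 * (\<theta>1 * (x * y))\<bar> \<le> 1 * (u * ?p)"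
      unfolding abs_mult[of \<theta>2] using 1 \<theta> u1 u_nonneg by (intro mult_mono) auto
  qed
  also have "\<dots> \<le> 4 * real (Suc k) * u * (B + ?p)"
  proof -
    have "0 \<le> real k * u * ?p" "0 \<le> u * B" "0 \<le> u * ?p" using u_nonneg B by simp_all
    then show ?thesis by (simp add: algebra_simps)
  qed
  finally show ?thesis .
qed

text \<open>Cell \<open>n + 2\<close> receives the products and must lie outside both operands. The
  operands may coincide, which gives squared norms.\<close>

lemma wp_Dot:
  assumes r0: "regs s 0 = n" and ad: "addr d D" "addr p P" "addr q Q'" "addr l m"
    and len: "D < length (mem s)" "n + 2 < length (mem s)" "P + m \<le> length (mem s)" "Q' + m \<le> length (mem s)"
    and dis: "D \<noteq> n + 2" "D \<notin> {P..<P + m}" "D \<notin> {Q'..<Q' + m}" "n + 2 \<notin> {P..<P + m}" "n + 2 \<notin> {Q'..<Q' + m}"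
    and m: "real m \<le> wmax E" "4 * real m * u \<le> 1"
    and Q: "\<And>t. frame 0 {D, n + 2} {1} s t \<Longrightarrow> \<bar>mem t ! D - ip m (seg P s) (seg Q' s)\<bar>
        \<le> 4 * real m * u * (\<Sum>i<m. \<bar>seg P s i\<bar> * \<bar>seg Q' s i\<bar>) \<Longrightarrow> Q t"
  shows "wp E (Dot d p q l) Q s"
  unfolding Dot_def
proof (rule wp_Seq, rule wp_Load)
  have w: "0 \<le> wmax E" using m by (meson of_nat_0_le_iff order_trans)
  show "aval d (regs s) < length (mem s)" using ad(1) len r0 by (simp add: addrD)
  show "real (aval (N 0) (regs s)) \<le> wmax E" using w by simp
  fix \<theta> :: real
  define s1 where "s1 = put (aval d (regs s)) ((1 + \<theta>) * real (aval (N 0) (regs s))) s"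
  have s1: "frame 0 {D, n + 2} {1} s s1" "mem s1 ! D = 0"
    unfolding s1_def using r0 ad len by (auto simp: addrD intro!: frame_put frame_refl)
  let ?S = "\<lambda>k. ip k (seg P s) (seg Q' s)" and ?B = "\<lambda>k. \<Sum>i<k. \<bar>seg P s i\<bar> * \<bar>seg Q' s i\<bar>"
  let ?I = "\<lambda>k t. frame 0 {D, n + 2} {1} s t \<and> \<bar>mem t ! D - ?S k\<bar> \<le> 4 * real k * u * ?B k"
  show "wp E (For 1 l (Seq (Arith FMul (ad 1 2) (Add p (V 1)) (Add q (V 1))) (Arith FAdd d d (ad 1 2)))) Q s1"
  proof (rule wp_For[where I = ?I and m = m])
    show "?I 0 (set_reg 1 0 s1)" using s1 by (auto simp: ip_def intro!: frame_set_reg)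
    show "real m \<le> wmax E" by (rule m)
    show "Q t" if "?I m t" for t using that Q by blast
    show "aval l (regs t) = m" if "?I k t" for k t
      using that r0 ad by (auto simp: addrD frame_regD)
    fix k t assume k: "k < m" and t: "?I k t" and rt: "regs t 1 = k"
    have t0: "regs t 0 = n" using t r0 frame_regD[of 0 "{D, n+2}" "{1}" s t 0] by simp
    have lt: "length (mem t) = length (mem s)" using t frame_lenD by blast
    have mt: "mem t ! (P + k) = mem s ! (P + k)" "mem t ! (Q' + k) = mem s ! (Q' + k)"
      using t k dis by (auto intro!: frame_memD)
    have av: "aval d (regs t) = D" "aval p (regs t) = P" "aval q (regs t) = Q'"
      using t0 ad by (simp_all add: addrD)
    show "wp E (Seq (Arith FMul (ad 1 2) (Add p (V 1)) (Add q (V 1))) (Arith FAdd d d (ad 1 2)))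
       (\<lambda>t'. regs t' 1 = k \<and> ?I (Suc k) (set_reg 1 (Suc k) t')) t"
    proof (rule wp_Seq, rule wp_Arith, goal_cases)
      case (5 \<theta>1)
      show ?case
      proof (rule wp_Arith, goal_cases)
        case (5 \<theta>2)
        have "\<bar>(1 + \<theta>2) * (mem t ! D + (1 + \<theta>1) * (seg P s k * seg Q' s k)) - (?S k + seg P s k * seg Q' s k)\<bar>
            \<le> 4 * real (Suc k) * u * (?B k + \<bar>seg P s k\<bar> * \<bar>seg Q' s k\<bar>)"
        proof (rule dot_step_error)
          show "\<bar>?S k\<bar> \<le> ?B k" unfolding ip_def by (rule order_trans[OF sum_abs]) (simp add: abs_mult)
          have "4 * real (Suc k) * u \<le> 4 * real m * u" using k u_nonneg by (intro mult_right_mono) auto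
          then show "4 * real (Suc k) * u \<le> 1" using m by linarith
        qed (use t \<open>\<bar>\<theta>1\<bar> \<le> u\<close> \<open>\<bar>\<theta>2\<bar> \<le> u\<close> in auto)
        then show ?case
          using t rt lt len dis by (auto simp: av t0 mt ip_def intro!: frame_set_reg frame_put)
      qed (use len lt in \<open>auto simp: av t0\<close>)
    qed (use len lt k rt in \<open>auto simp: av t0\<close>)
  qed
qed

lemma axpy_step_error:
  fixes x y :: real
  assumes "\<bar>\<theta>1\<bar> \<le> u" "\<bar>\<theta>2\<bar> \<le> u" "u \<le> 1"
  shows "\<bar>(1 + \<theta>2) * (x + (1 + \<theta>1) * y) - (x + y)\<bar> \<le> 3 * u * (\<bar>x\<bar> + \<bar>y\<bar>)"
proof -
  have "(1 + \<theta>2) * (x + (1 + \<theta>1) * y) - (x + y) = \<theta>2 * x + \<theta>1 * y + \<theta>2 * y + \<theta>2 * (\<theta>1 * y)"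
    by (simp add: algebra_simps)
  also have "\<bar>\<dots>\<bar> \<le> \<bar>\<theta>2 * x\<bar> + \<bar>\<theta>1 * y\<bar> + \<bar>\<theta>2 * y\<bar> + \<bar>\<theta>2 * (\<theta>1 * y)\<bar>" by linarith
  also have "\<dots> \<le> u * \<bar>x\<bar> + u * \<bar>y\<bar> + u * \<bar>y\<bar> + 1 * (u * \<bar>y\<bar>)"
  proof (intro add_mono)
    show "\<bar>\<theta>2 * x\<bar> \<le> u * \<bar>x\<bar>" unfolding abs_mult using assms by (intro mult_right_mono) auto
    show 1: "\<bar>\<theta>1 * y\<bar> \<le> u * \<bar>y\<bar>" unfolding abs_mult using assms by (intro mult_right_mono) auto
    show "\<bar>\<theta>2 * y\<bar> \<le> u * \<bar>y\<bar>" unfolding abs_mult using assms by (intro mult_right_mono) auto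
    show "\<bar>\<theta>2 * (\<theta>1 * y)\<bar> \<le> 1 * (u * \<bar>y\<bar>)"
      unfolding abs_mult[of \<theta>2] using 1 assms u_nonneg by (intro mult_mono) auto
  qed
  also have "\<dots> \<le> 3 * u * (\<bar>x\<bar> + \<bar>y\<bar>)" using u_nonneg by (simp add: algebra_simps)
  finally show ?thesis .
qed

text \<open>The target may be the first summand itself, because entry k is read before it is
  overwritten. This is how the iterate is updated in place.\<close>

lemma wp_Axpy:
  assumes r0: "regs s 0 = n" and ad: "addr d D" "addr p P" "addr a a0" "addr q Q'" "addr l m"
    and len: "D + m \<le> length (mem s)" "n + 2 < length (mem s)" "a0 < length (mem s)"
      "P + m \<le> length (mem s)" "Q' + m \<le> length (mem s)"
    and dis: "n + 2 \<notin> {D..<D + m}" "n + 2 \<notin> {P..<P + m}" "n + 2 \<notin> {Q'..<Q' + m}" "a0 \<noteq> n + 2" "a0 \<notin> {D..<D + m}"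
      "D + m \<le> Q' \<or> Q' + m \<le> D" "D = P \<or> D + m \<le> P \<or> P + m \<le> D"
    and m: "real m \<le> wmax E" "u \<le> 1"
    and Q: "\<And>t. frame 0 ({n + 2} \<union> {D..<D + m}) {1} s t \<Longrightarrow>
      (\<And>i. i < m \<Longrightarrow> \<bar>seg D t i - (seg P s i + mem s ! a0 * seg Q' s i)\<bar>
         \<le> 3 * u * (\<bar>seg P s i\<bar> + \<bar>mem s ! a0 * seg Q' s i\<bar>)) \<Longrightarrow> Q t"
  shows "wp E (Axpy d p a q l) Q s"
  unfolding Axpy_def
proof -
  let ?I = "\<lambda>k t. frame 0 ({n + 2} \<union> {D..<D + k}) {1} s t \<and>
    (\<forall>i<k. \<bar>seg D t i - (seg P s i + mem s ! a0 * seg Q' s i)\<bar>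
         \<le> 3 * u * (\<bar>seg P s i\<bar> + \<bar>mem s ! a0 * seg Q' s i\<bar>))"
  show "wp E (For 1 l (Seq (Arith FMul (ad 1 2) a (Add q (V 1)))
     (Arith FAdd (Add d (V 1)) (Add p (V 1)) (ad 1 2)))) Q s"
  proof (rule wp_For[where I = ?I and m = m])
    show "?I 0 (set_reg 1 0 s)" by (auto intro!: frame_set_reg frame_refl)
    show "real m \<le> wmax E" by (rule m)
    show "Q t" if "?I m t" for t using that Q by blast
    show "aval l (regs t) = m" if "?I k t" for k t
      using that r0 ad by (auto simp: addrD frame_regD)
    fix k t assume k: "k < m" and t: "?I k t" and rt: "regs t 1 = k"
    have fr: "frame 0 ({n + 2} \<union> {D..<D + k}) {1} s t" using t by blast
    have fr': "frame 0 ({n + 2} \<union> {D..<D + Suc k}) {1} s t" using fr by (rule frame_mono) auto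
    have t0: "regs t 0 = n" using frame_regD[OF fr, of 0] r0 by simp
    have lt: "length (mem t) = length (mem s)" by (rule frame_lenD[OF fr])
    have mP: "mem t ! (P + k) = mem s ! (P + k)"
      by (rule frame_memD[OF fr]) (use k dis(2,7) in auto)
    have mQ: "mem t ! (Q' + k) = mem s ! (Q' + k)"
      by (rule frame_memD[OF fr]) (use k dis(3,6) in auto)
    have ma: "mem t ! a0 = mem s ! a0"
      by (rule frame_memD[OF fr]) (use k dis(4,5) in auto)
    note mt = mP mQ ma
    have av: "aval d (regs t) = D" "aval p (regs t) = P" "aval q (regs t) = Q'" "aval a (regs t) = a0"
      using t0 ad by (simp_all add: addrD)
    show "wp E (Seq (Arith FMul (ad 1 2) a (Add q (V 1))) (Arith FAdd (Add d (V 1)) (Add p (V 1)) (ad 1 2)))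
       (\<lambda>t'. regs t' 1 = k \<and> ?I (Suc k) (set_reg 1 (Suc k) t')) t"
    proof (rule wp_Seq, rule wp_Arith, goal_cases)
      case (5 \<theta>1)
      show ?case
      proof (rule wp_Arith, goal_cases)
        case (5 \<theta>2)
        let ?v = "(1 + \<theta>2) * (seg P s k + (1 + \<theta>1) * (mem s ! a0 * seg Q' s k))"
        have ne: "n + 2 \<noteq> P + k" using dis k by auto
        have neD: "n + 2 \<noteq> D + k'" if "k' < m" for k' using dis that by auto
        have new: "\<bar>?v - (seg P s k + mem s ! a0 * seg Q' s k)\<bar> \<le> 3 * u * (\<bar>seg P s k\<bar> + \<bar>mem s ! a0 * seg Q' s k\<bar>)"
          by (rule axpy_step_error) (use \<open>\<bar>\<theta>1\<bar> \<le> u\<close> \<open>\<bar>\<theta>2\<bar> \<le> u\<close> m in auto)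
        have old: "\<bar>seg D t i - (seg P s i + mem s ! a0 * seg Q' s i)\<bar>
         \<le> 3 * u * (\<bar>seg P s i\<bar> + \<bar>mem s ! a0 * seg Q' s i\<bar>)" if "i < k" for i using t that by blast
        show ?case
        proof (intro conjI allI impI, goal_cases)
          case 1 show ?case using rt by simp
        next
          case 2 show ?case using rt fr' by (auto simp: av t0 intro!: frame_set_reg frame_put)
        next
          case (3 i)
          show ?case
          proof (cases "i = k")
            case True
            then show ?thesis using new rt lt len k ne by (simp add: av t0 mt)
          next
            case False
            then have "i < k" "n + 2 \<noteq> D + i" using 3 k neD by auto
            then show ?thesis using old rt by (simp add: av t0)
          qed
        qed
      qed (use len lt k rt in \<open>auto simp: av t0\<close>)
    qed (use len lt k rt in \<open>auto simp: av t0\<close>)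
  qed
qed

end

section \<open>The algorithm\<close>

text \<open>
  With \<open>n\<close> in register 0, the scalar cells \<open>n + 2 + k\<close> hold: 0 scratch, 1 \<open>\<parallel>b\<parallel>\<^sup>2\<close>, 2 \<open>\<parallel>b\<parallel>\<close>, 3 one,
  4 zero, 5 minus one, 6 \<open>\<epsilon>/32\<close>, 7 \<open>(\<epsilon>/32)\<^sup>2\<close>, 8 the scale \<open>\<beta>\<close>, 9 the negated step size
  \<open>-1/(4\<beta>\<^sup>2)\<close>, 10 to 15 intermediate results. Blocks of \<open>n + 1\<close> cells start at \<open>n + 18\<close> (the iterate
  \<open>(x, \<tau>)\<close>), \<open>2n + 19\<close> (the random start vector), \<open>3n + 20\<close> (\<open>b/\<parallel>b\<parallel>\<close>), \<open>4n + 21\<close> (\<open>Ax + \<beta>\<tau>b/\<parallel>b\<parallel>\<close>),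
  \<open>5n + 22\<close> (answers of queries) and \<open>6n + 23\<close> (zeros).
  Register 1 is the index of vector loops, 2 counts iterations, 3 counts scales, 4 holds a number
  of order \<open>1/\<epsilon>\<close>, 5 is set when an iterate has been accepted, and 6 to 9 receive random bits.
\<close>

definition Product :: com where
  "Product = Seq (MatVec (ad 5 22) (ad 1 18)) (Seq (Arith FMul (ad 1 12) (ad 1 10) (ad 2 18))
     (Axpy (ad 4 21) (ad 5 22) (ad 1 12) (ad 3 20) (ad 1 0)))"

definition Step :: com where
  "Step = Seq (MatVecT (ad 5 22) (ad 4 21)) (Seq (Axpy (ad 1 18) (ad 1 18) (ad 1 11) (ad 5 22) (ad 1 0))
     (Seq (Dot (ad 1 12) (ad 3 20) (ad 4 21) (ad 1 0)) (Seq (Arith FMul (ad 1 12) (ad 1 12) (ad 1 10))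
     (Seq (Arith FMul (ad 1 12) (ad 1 12) (ad 1 11)) (Arith FAdd (ad 2 18) (ad 2 18) (ad 1 12))))))"

definition Scale :: "nat \<Rightarrow> com" where
  "Scale C = Seq (Load (ad 1 17) (V 3)) (Seq (Arith FMul (ad 1 17) (ad 1 17) (ad 1 1))
     (Seq (Load (ad 1 16) (N C)) (Arith FDiv (ad 1 10) (ad 1 17) (ad 1 16))))"

definition StepSize :: com where
  "StepSize = Seq (Arith FMul (ad 1 17) (ad 1 10) (ad 1 10)) (Seq (Load (ad 1 16) (N 4))
     (Seq (Arith FDiv (ad 1 16) (ad 1 7) (ad 1 16)) (Arith FDiv (ad 1 11) (ad 1 16) (ad 1 17))))"

definition Reset :: com where
  "Reset = Axpy (ad 1 18) (ad 6 23) (ad 1 5) (ad 2 19) (ad 1 1)"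

definition Iterate :: com where
  "Iterate = For 2 (Mul (N (2 ^ 23)) (Mul (V 0) (Mul (V 4) (V 4)))) (Seq Product Step)"

definition Measure :: com where
  "Measure = Seq (Dot (ad 1 13) (ad 4 21) (ad 4 21) (ad 1 0)) (Seq (Dot (ad 1 14) (ad 1 18) (ad 1 18) (ad 1 1))
     (Seq (Dot (ad 1 15) (ad 1 18) (ad 1 18) (ad 1 0)) (Seq (Arith FMul (ad 1 14) (ad 1 14) (ad 1 10))
     (Seq (Arith FMul (ad 1 14) (ad 1 14) (ad 1 10)) (Arith FMul (ad 1 14) (ad 1 14) (ad 1 9))))))"

definition Output :: com where
  "Output = Seq (Sqrt (ad 1 15) (ad 1 15)) (Seq (Arith FMul (ad 1 15) (ad 1 8) (ad 1 15))
     (Seq (Cond (RLess (ad 2 18) (ad 1 6)) (Arith FSub (ad 2 18) (ad 2 18) (ad 1 15))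
        (Arith FAdd (ad 2 18) (ad 2 18) (ad 1 15)))
     (Seq (Arith FMul (ad 1 16) (ad 1 10) (ad 2 18)) (Seq (Arith FDiv (ad 1 16) (ad 1 4) (ad 1 16))
     (Seq (Arith FMul (ad 1 16) (ad 1 16) (ad 1 7)) (Axpy (ad 0 0) (ad 6 23) (ad 1 16) (ad 1 18) (ad 1 0)))))))"

section \<open>Error analysis of the program at one scale\<close>

locale solver = machine +
  fixes b :: "real Matrix.vec" and \<epsilon> Z :: real and C :: nat and g :: "nat \<Rightarrow> real"
  assumes b: "b \<in> carrier_vec n" and b_pos: "0 < nrm n (vec_index b)" and sp_pos: "0 < sp"
    and eps: "0 < \<epsilon>" "\<epsilon> < 1" and small: "u * 2 ^ 60 * (real n / \<epsilon>) ^ 5 \<le> 1"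
    and C: "1 \<le> C" and Z: "sp \<le> real C * Z" "Z \<le> real C * sp"
    and wm: "2 ^ 40 * (real n / \<epsilon>) ^ 3 \<le> wmax E" "real (C\<^sup>2 + 2) \<le> wmax E"
    and g: "\<And>i. 0 \<le> g i" "\<And>i. g i \<le> 15"
begin

abbreviation bn :: real where "bn \<equiv> nrm n (vec_index b)"
abbreviation bh :: "nat \<Rightarrow> real" where "bh \<equiv> \<lambda>i. b $ i / bn"
text \<open>The unit of all error bounds below: a dot product of length n has error of order n u,
  and single operations have less.\<close>

definition \<nu> :: real where "\<nu> = real n * u"
abbreviation a :: "nat \<Rightarrow> nat \<Rightarrow> real" where "a \<equiv> mfun A"

lemma nrm_bh: "nrm n bh = 1"
proof -
  have "nrm n bh = nrm n (\<lambda>i. inverse bn * b $ i)" by (rule nrm_cong) (simp add: field_simps)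
  also have "\<dots> = 1" using b_pos by (subst nrm_scale) simp
  finally show ?thesis .
qed

lemma n_eps: "1 \<le> real n / \<epsilon>" "real n \<le> real n / \<epsilon>" "1 / \<epsilon> \<le> real n / \<epsilon>"
proof -
  have n1: "1 \<le> real n" using n_pos by simp
  show "real n \<le> real n / \<epsilon>" using eps n1 by (simp add: field_simps)
  then show "1 \<le> real n / \<epsilon>" using n1 by linarith
  show "1 / \<epsilon> \<le> real n / \<epsilon>" using eps n1 by (simp add: divide_right_mono)
qed

lemma u_le_nu: "u \<le> \<nu>"
  using n_pos u_nonneg mult_right_mono[of 1 "real n" u] by (simp add: \<nu>_def)

lemma nu_nonneg: "0 \<le> \<nu>"
  using u_nonneg by (simp add: \<nu>_def)

lemma nu_small_eps: "\<nu> * 2 ^ 60 * (real n / \<epsilon>) ^ 4 \<le> 1"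
proof -
  have "\<nu> * 2 ^ 60 * (real n / \<epsilon>) ^ 4 = u * 2 ^ 60 * (real n * (real n / \<epsilon>) ^ 4)" by (simp add: \<nu>_def)
  also have "\<dots> \<le> u * 2 ^ 60 * ((real n / \<epsilon>) * (real n / \<epsilon>) ^ 4)"
    using u_nonneg n_eps eps by (intro mult_left_mono mult_right_mono) auto
  also have "\<dots> \<le> 1" using small by (simp add: power_Suc[symmetric] del: power_Suc)
  finally show ?thesis .
qed

lemma nu_le: "\<nu> \<le> \<epsilon> / 2 ^ 60"
proof -
  have "(real n / \<epsilon>) ^ 1 \<le> (real n / \<epsilon>) ^ 4" using n_eps by (intro power_increasing) auto
  then have "1 / \<epsilon> \<le> (real n / \<epsilon>) ^ 4" using n_eps by simp
  then have "\<nu> * 2 ^ 60 * (1 / \<epsilon>) \<le> \<nu> * 2 ^ 60 * (real n / \<epsilon>) ^ 4"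
    using nu_nonneg by (intro mult_left_mono) auto
  then have "\<nu> * 2 ^ 60 * (1 / \<epsilon>) \<le> 1" using nu_small_eps by linarith
  then show ?thesis using eps by (simp add: field_simps)
qed

lemma nu_tiny: "\<nu> \<le> 1 / 2 ^ 60"
  using nu_le eps by (simp add: field_simps)

lemma u_tiny: "u \<le> 1 / 2 ^ 60"
  using u_le_nu nu_tiny by linarith

lemma wm_small: "real k \<le> 2 ^ 40 * real n \<Longrightarrow> real k \<le> wmax E"
proof -
  assume k: "real k \<le> 2 ^ 40 * real n"
  have "(real n / \<epsilon>) ^ 1 \<le> (real n / \<epsilon>) ^ 3" using n_eps by (intro power_increasing) auto
  then have "real n \<le> (real n / \<epsilon>) ^ 3" using n_eps by simp
  then show ?thesis using k wm(1) by simp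
qed

lemma sp_bound: "nrm n (mat_app n a z) \<le> sp * nrm n z"
  by (rule nrm_mat_app_le_spectral_norm[OF A])

lemma Z_pos: "0 < Z"
proof (rule ccontr)
  assume "\<not> 0 < Z"
  then have "real C * Z \<le> 0" by (intro mult_nonneg_nonpos) auto
  then show False using Z(1) sp_pos by linarith
qed

abbreviation \<beta> :: "nat \<Rightarrow> real" where "\<beta> p \<equiv> real p * Z / real C"

lemma beta_pos: "1 \<le> p \<Longrightarrow> 0 < \<beta> p"
  using Z_pos C by simp

abbreviation ah :: "nat \<Rightarrow> nat \<Rightarrow> nat \<Rightarrow> real" where "ah p \<equiv> bordered n a (\<beta> p) bh"

text \<open>Footprints of \<open>Product\<close>, of \<open>Step\<close>, and of a whole attempt up
  to the test. The last one avoids every cell that \<open>ready\<close> mentions.\<close>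

abbreviation wset :: "nat set" where "wset \<equiv> {n + 2, n + 12} \<union> {4 * n + 21..<6 * n + 23}"
abbreviation xset :: "nat set" where "xset \<equiv> {n + 2, n + 12} \<union> {n + 18..<2 * n + 19} \<union> {4 * n + 21..<6 * n + 23}"
abbreviation touched :: "nat set" where "touched \<equiv> {n + 2} \<union> {n + 10..<2 * n + 19} \<union> {4 * n + 21..<6 * n + 23}"

text \<open>What survives from one scale to the next. The cells of b itself are absent: from here on
  only |b| and b/|b| are read, and \<open>Output\<close> overwrites b with the solution.\<close>

definition ready :: "state \<Rightarrow> bool" where
  "ready t \<longleftrightarrow> 7 * n + 24 \<le> length (mem t) \<and> regs t 0 = n \<and> mem t ! n = \<epsilon> \<and> mem t ! (n + 1) = Z \<and>
     ap (10 * \<nu>) (mem t ! (n + 4)) bn \<and> ap \<nu> (mem t ! (n + 5)) 1 \<and> mem t ! (n + 6) = 0 \<and>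
     ap (4 * \<nu>) (mem t ! (n + 7)) (- 1) \<and> ap (4 * \<nu>) (mem t ! (n + 8)) (\<epsilon> / 32) \<and>
     ap (18 * \<nu>) (mem t ! (n + 9)) ((\<epsilon> / 32)\<^sup>2) \<and>
     (\<forall>i<n. ap (110 * \<nu>) (seg (3 * n + 20) t i) (bh i)) \<and>
     (\<forall>i<Suc n. ap \<nu> (seg (2 * n + 19) t i) (g i)) \<and>
     (\<forall>i<Suc n. seg (6 * n + 23) t i = 0)"

definition scaled :: "nat \<Rightarrow> state \<Rightarrow> bool" where
  "scaled p t \<longleftrightarrow> ap (12 * \<nu>) (mem t ! (n + 10)) (\<beta> p) \<and> ap (130 * \<nu>) (mem t ! (n + 11)) (- 1 / (4 * (\<beta> p)\<^sup>2))"

lemma tau_cell: "n + 18 + n = 2 * n + 18"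
  by simp

lemma ready_frame:
  assumes "ready s" "frame q touched R s t" "0 \<notin> R"
  shows "ready t"
proof -
  note m = frame_memD[OF assms(2)]
  have "mem t ! j = mem s ! j" if "j \<in> {n, n + 1, n + 4, n + 5, n + 6, n + 7, n + 8, n + 9}" for j
    by (rule m) (use that in auto)
  moreover have "seg (3 * n + 20) t i = seg (3 * n + 20) s i" "seg (2 * n + 19) t i = seg (2 * n + 19) s i" if "i < Suc n" for i
    by (rule m; use that in auto)+
  moreover have "seg (6 * n + 23) t i = seg (6 * n + 23) s i" for i by (rule m) auto
  ultimately show ?thesis
    using assms(1) frame_lenD[OF assms(2)] frame_regD[OF assms(2,3)] unfolding ready_def by simp
qed

lemma scaled_frame: "scaled p s \<Longrightarrow> frame q xset R s t \<Longrightarrow> scaled p t"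
  unfolding scaled_def by (auto simp: frame_memD)

lemma wp_Product:
  assumes s: "ready s" "scaled p s" and p: "1 \<le> p"
    and Q: "\<And>t. frame 1 wset {1} s t \<Longrightarrow>
      nrm n (\<lambda>i. seg (4 * n + 21) t i - mat_app (Suc n) (ah p) (seg (n + 18) s) i)
        \<le> 300 * \<nu> * (sp * nrm n (seg (n + 18) s) + \<beta> p * \<bar>seg (n + 18) s n\<bar>) \<Longrightarrow> Q t"
  shows "wp E Product Q s"
  unfolding Product_def
proof (rule wp_Seq, rule wp_MatVec[of _ _ "5 * n + 22" _ "n + 18"])
  have r0: "regs s 0 = n" and len: "7 * n + 24 \<le> length (mem s)" using s by (auto simp: ready_def)
  show "aval (ad 5 22) (regs s) = 5 * n + 22" "aval (ad 1 18) (regs s) = n + 18" using r0 by auto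
  show "5 * n + 22 + n \<le> length (mem s)" "n + 18 + n \<le> length (mem s)" using len by auto
  fix t1 assume f1: "frame 1 {5 * n + 22..<5 * n + 22 + n} {} s t1"
    and v1: "nrm n (\<lambda>i. seg (5 * n + 22) t1 i - mat_app n a (seg (n + 18) s) i) \<le> u * sp * nrm n (seg (n + 18) s)"
  have r1: "regs t1 0 = n" "length (mem t1) = length (mem s)" using frame_regD[OF f1] frame_lenD[OF f1] r0 by auto
  have m1: "mem t1 ! (n + 10) = mem s ! (n + 10)" "mem t1 ! (2 * n + 18) = mem s ! (2 * n + 18)"
    by (rule frame_memD[OF f1]; simp)+
  have w1: "frame 1 wset {1} s t1" by (rule frame_mono[OF f1]) auto
  show "wp E (Seq (Arith FMul (ad 1 12) (ad 1 10) (ad 2 18)) (Axpy (ad 4 21) (ad 5 22) (ad 1 12) (ad 3 20) (ad 1 0))) Q t1"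
  proof (rule wp_Seq, rule wp_Arith, goal_cases)
    case (5 \<theta>)
    let ?t2 = "put (aval (ad 1 12) (regs t1))
         ((1 + \<theta>) * fop_val FMul (mem t1 ! aval (ad 1 10) (regs t1)) (mem t1 ! aval (ad 2 18) (regs t1))) t1"
    have w2: "frame 1 wset {1} s ?t2" by (rule frame_put[OF w1]) (simp add: r1)
    have \<alpha>: "mem ?t2 ! (n + 12) = (1 + \<theta>) * (mem s ! (n + 10) * mem s ! (2 * n + 18))"
      using r1 m1 len by simp
    have "ap (2 * (12 * \<nu> + 0 + u)) (mem ?t2 ! (n + 12)) (\<beta> p * mem s ! (2 * n + 18))"
      unfolding \<alpha> by (rule ap_round_mult[OF _ ap_refl 5])
        (use s u_tiny nu_tiny nu_nonneg in \<open>auto simp: scaled_def\<close>)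
    then have ap: "ap (26 * \<nu>) (mem ?t2 ! (n + 12)) (\<beta> p * mem s ! (2 * n + 18))"
      by (rule ap_mono) (use u_le_nu in simp)
    have seg2: "seg (5 * n + 22) ?t2 i = seg (5 * n + 22) t1 i" for i using r1 by simp
    have seg3: "seg (3 * n + 20) ?t2 i = seg (3 * n + 20) s i" if "i < n" for i
      by (rule frame_memD[OF w2]) (use that in auto)
    show ?case
    proof (rule wp_Axpy[where D = "4 * n + 21" and P = "5 * n + 22" and ?a0.0 = "n + 12" and Q' = "3 * n + 20" and m = n])
      show "addr (ad 4 21) (4 * n + 21)" "addr (ad 5 22) (5 * n + 22)" "addr (ad 1 12) (n + 12)"
        "addr (ad 3 20) (3 * n + 20)" "addr (ad 1 0) n" by (auto intro!: addr_ad)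
      show "real n \<le> wmax E" by (rule wm_small) simp
      show "u \<le> 1" using u_tiny by simp
      fix t assume f: "frame 0 ({n + 2} \<union> {4 * n + 21..<4 * n + 21 + n}) {1} ?t2 t"
        and w: "\<And>i. i < n \<Longrightarrow> \<bar>seg (4 * n + 21) t i - (seg (5 * n + 22) ?t2 i + mem ?t2 ! (n + 12) * seg (3 * n + 20) ?t2 i)\<bar>
          \<le> 3 * u * (\<bar>seg (5 * n + 22) ?t2 i\<bar> + \<bar>mem ?t2 ! (n + 12) * seg (3 * n + 20) ?t2 i\<bar>)"
      have "frame 0 wset {1} ?t2 t" by (rule frame_mono[OF f]) auto
      from frame_trans[OF w2 this] have ft: "frame 1 wset {1} s t" by simp
      show "Q t"
      proof (rule Q[OF ft])
        show "nrm n (\<lambda>i. seg (4 * n + 21) t i - mat_app (Suc n) (ah p) (seg (n + 18) s) i)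
          \<le> 300 * \<nu> * (sp * nrm n (seg (n + 18) s) + \<beta> p * \<bar>seg (n + 18) s n\<bar>)"
        proof (rule bordered_product_error[where \<alpha> = "mem ?t2 ! (n + 12)" and v = "seg (5 * n + 22) t1" and q = "seg (3 * n + 20) s" and u = u])
          show "ap (26 * \<nu>) (mem ?t2 ! (n + 12)) (\<beta> p * seg (n + 18) s n)"
            using ap unfolding tau_cell .
          show "\<bar>seg (4 * n + 21) t i - (seg (5 * n + 22) t1 i + mem ?t2 ! (n + 12) * seg (3 * n + 20) s i)\<bar>
            \<le> 3 * u * (\<bar>seg (5 * n + 22) t1 i\<bar> + \<bar>mem ?t2 ! (n + 12) * seg (3 * n + 20) s i\<bar>)" if "i < n" for i
            using w[OF that] unfolding seg2 seg3[OF that] .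
          show "ap (110 * \<nu>) (seg (3 * n + 20) s i) (bh i)" if "i < n" for i
            using s that by (simp add: ready_def)
        qed (use sp_bound sp_pos nrm_bh beta_pos[OF p] u_nonneg u_le_nu nu_tiny v1 in auto)
      qed
    qed (use r1 len in auto)
  qed (use r1 len in auto)
qed

text \<open>The run is faultless at every scale, but the error bound is claimed only for sp \<le>
  \<beta>: below that the exact step need not be a contraction, and nothing is said about the
  iterate.\<close>

lemma wp_Step:
  assumes s: "ready s" "scaled p s" and p: "1 \<le> p"
    and W: "nrm n (\<lambda>i. seg (4 * n + 21) s i - mat_app (Suc n) (ah p) (seg (n + 18) s) i)
        \<le> 300 * \<nu> * (sp * nrm n (seg (n + 18) s) + \<beta> p * \<bar>seg (n + 18) s n\<bar>)"
    and Q: "\<And>t. frame 1 xset {1} s t \<Longrightarrow>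
      (sp \<le> \<beta> p \<Longrightarrow> nrm (Suc n) (\<lambda>j. seg (n + 18) t j - gd_step n (Suc n) (ah p) (1 / (4 * (\<beta> p)\<^sup>2)) (seg (n + 18) s) j)
        \<le> 1000 * \<nu> * nrm (Suc n) (seg (n + 18) s)) \<Longrightarrow> Q t"
  shows "wp E Step Q s"
  unfolding Step_def
proof (rule wp_Seq, rule wp_MatVecT[of _ _ "5 * n + 22" _ "4 * n + 21"])
  have r0: "regs s 0 = n" and len: "7 * n + 24 \<le> length (mem s)" using s by (auto simp: ready_def)
  show "aval (ad 5 22) (regs s) = 5 * n + 22" "aval (ad 4 21) (regs s) = 4 * n + 21" using r0 by auto
  show "5 * n + 22 + n \<le> length (mem s)" "4 * n + 21 + n \<le> length (mem s)" using len by auto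
  fix t1 assume f1: "frame 1 {5 * n + 22..<5 * n + 22 + n} {} s t1"
    and v1: "nrm n (\<lambda>i. seg (5 * n + 22) t1 i - mat_app n (\<lambda>i j. a j i) (seg (4 * n + 21) s) i)
      \<le> u * sp * nrm n (seg (4 * n + 21) s)"
  have r1: "regs t1 0 = n" "length (mem t1) = length (mem s)" using frame_regD[OF f1] frame_lenD[OF f1] r0 by auto
  have m1: "mem t1 ! j = mem s ! j" if "j < 5 * n + 22" for j by (rule frame_memD[OF f1]) (use that in auto)
  have x1: "frame 1 xset {1} s t1" by (rule frame_mono[OF f1]) auto
  show "wp E (Seq (Axpy (ad 1 18) (ad 1 18) (ad 1 11) (ad 5 22) (ad 1 0))
     (Seq (Dot (ad 1 12) (ad 3 20) (ad 4 21) (ad 1 0)) (Seq (Arith FMul (ad 1 12) (ad 1 12) (ad 1 10))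
     (Seq (Arith FMul (ad 1 12) (ad 1 12) (ad 1 11)) (Arith FAdd (ad 2 18) (ad 2 18) (ad 1 12)))))) Q t1"
  proof (rule wp_Seq, rule wp_Axpy[where D = "n + 18" and P = "n + 18" and ?a0.0 = "n + 11" and Q' = "5 * n + 22" and m = n])
    show "addr (ad 1 18) (n + 18)" "addr (ad 1 18) (n + 18)" "addr (ad 1 11) (n + 11)"
      "addr (ad 5 22) (5 * n + 22)" "addr (ad 1 0) n" by (auto intro!: addr_ad)
    show "real n \<le> wmax E" by (rule wm_small) simp
    show "u \<le> 1" using u_tiny by simp
    fix t2 assume f2: "frame 0 ({n + 2} \<union> {n + 18..<n + 18 + n}) {1} t1 t2"
      and w2: "\<And>i. i < n \<Longrightarrow> \<bar>seg (n + 18) t2 i - (seg (n + 18) t1 i + mem t1 ! (n + 11) * seg (5 * n + 22) t1 i)\<bar>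
          \<le> 3 * u * (\<bar>seg (n + 18) t1 i\<bar> + \<bar>mem t1 ! (n + 11) * seg (5 * n + 22) t1 i\<bar>)"
    have r2: "regs t2 0 = n" "length (mem t2) = length (mem s)" using frame_regD[OF f2] frame_lenD[OF f2] r1 by auto
    have m2: "mem t2 ! j = mem s ! j" if "n + 2 < j" "j < n + 18 \<or> 2 * n + 18 \<le> j" "j < 5 * n + 22" for j
      using frame_memD[OF f2, of j] m1[of j] that by auto
    have "frame 0 xset {1} t1 t2" by (rule frame_mono[OF f2]) auto
    from frame_trans[OF x1 this] have x2: "frame 1 xset {1} s t2" by simp
    show "wp E (Seq (Dot (ad 1 12) (ad 3 20) (ad 4 21) (ad 1 0)) (Seq (Arith FMul (ad 1 12) (ad 1 12) (ad 1 10))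
     (Seq (Arith FMul (ad 1 12) (ad 1 12) (ad 1 11)) (Arith FAdd (ad 2 18) (ad 2 18) (ad 1 12))))) Q t2"
    proof (rule wp_Seq, rule wp_Dot[where D = "n + 12" and P = "3 * n + 20" and Q' = "4 * n + 21" and m = n])
      show "addr (ad 1 12) (n + 12)" "addr (ad 3 20) (3 * n + 20)" "addr (ad 4 21) (4 * n + 21)" "addr (ad 1 0) n"
        by (auto intro!: addr_ad)
      show "real n \<le> wmax E" by (rule wm_small) simp
      show "4 * real n * u \<le> 1" using nu_tiny by (simp add: \<nu>_def)
      fix t3 assume f3: "frame 0 {n + 12, n + 2} {1} t2 t3"
        and d3: "\<bar>mem t3 ! (n + 12) - ip n (seg (3 * n + 20) t2) (seg (4 * n + 21) t2)\<bar>
          \<le> 4 * real n * u * (\<Sum>i<n. \<bar>seg (3 * n + 20) t2 i\<bar> * \<bar>seg (4 * n + 21) t2 i\<bar>)"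
      have r3: "regs t3 0 = n" "length (mem t3) = length (mem s)" using frame_regD[OF f3] frame_lenD[OF f3] r2 by auto
      have m3: "mem t3 ! j = mem t2 ! j" if "j \<noteq> n + 2" "j \<noteq> n + 12" for j
        by (rule frame_memD[OF f3]) (use that in auto)
      have s3: "mem t3 ! (n + 10) = mem s ! (n + 10)" "mem t3 ! (n + 11) = mem s ! (n + 11)"
        "mem t3 ! (2 * n + 18) = mem s ! (2 * n + 18)"
        by (subst m3, simp, simp, rule m2; use n_pos in simp)+
      have q3: "seg (3 * n + 20) t2 i = seg (3 * n + 20) s i" "seg (4 * n + 21) t2 i = seg (4 * n + 21) s i" if "i < n" for i
        by (rule m2; use that in simp)+
      have d3': "\<bar>mem t3 ! (n + 12) - ip n (seg (3 * n + 20) s) (seg (4 * n + 21) s)\<bar>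
          \<le> 4 * \<nu> * (\<Sum>i<n. \<bar>seg (3 * n + 20) s i\<bar> * \<bar>seg (4 * n + 21) s i\<bar>)"
        using d3 q3 by (simp add: ip_def mult.assoc \<nu>_def)
      have "frame 0 xset {1} t2 t3" by (rule frame_mono[OF f3]) auto
      from frame_trans[OF x2 this] have x3: "frame 1 xset {1} s t3" by simp
      show "wp E (Seq (Arith FMul (ad 1 12) (ad 1 12) (ad 1 10))
         (Seq (Arith FMul (ad 1 12) (ad 1 12) (ad 1 11)) (Arith FAdd (ad 2 18) (ad 2 18) (ad 1 12)))) Q t3"
      proof (intro wp_Seq wp_Arith, goal_cases)
        case (13 \<theta>1 \<theta>2 \<theta>3)
        let ?d2 = "(1 + \<theta>2) * ((1 + \<theta>1) * (mem t3 ! (n + 12) * mem s ! (n + 10)) * mem s ! (n + 11))"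
        define t where "t = put (2 * n + 18) ((1 + \<theta>3) * (mem s ! (2 * n + 18) + ?d2))
          (put (n + 12) ?d2 (put (n + 12) ((1 + \<theta>1) * (mem t3 ! (n + 12) * mem s ! (n + 10))) t3))"
        have "Q t"
        proof (rule Q)
          show "frame 1 xset {1} s t" unfolding t_def by (intro frame_put x3) auto
          assume sb: "sp \<le> \<beta> p"
          have tn: "seg (n + 18) t n = (1 + \<theta>3) * (seg (n + 18) s n + ?d2)"
            unfolding tau_cell using r3 len by (simp add: t_def)
          have tj: "seg (n + 18) t j = seg (n + 18) t2 j" if "j < n" for j
            using m3 that by (simp add: t_def)
          show "nrm (Suc n) (\<lambda>j. seg (n + 18) t j - gd_step n (Suc n) (ah p) (1 / (4 * (\<beta> p)\<^sup>2)) (seg (n + 18) s) j)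
            \<le> 1000 * \<nu> * nrm (Suc n) (seg (n + 18) s)"
          proof (rule step_error[where s = sp and \<beta> = "\<beta> p" and w = "seg (4 * n + 21) s" and q = "seg (3 * n + 20) s"
                and v = "seg (5 * n + 22) t1" and h = "mem s ! (n + 11)" and d = "mem t3 ! (n + 12)"
                and bt = "mem s ! (n + 10)" and u = u and ?\<theta>1.0 = \<theta>1 and ?\<theta>2.0 = \<theta>2 and ?\<theta>3.0 = \<theta>3])
            show "nrm n (mat_app n a z) \<le> sp * nrm n z" for z by (rule sp_bound)
            show "nrm n (\<lambda>i. seg (4 * n + 21) s i - mat_app (Suc n) (ah p) (seg (n + 18) s) i)
              \<le> 300 * \<nu> * (sp * nrm n (seg (n + 18) s) + \<beta> p * \<bar>seg (n + 18) s n\<bar>)" by (rule W)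
            show "nrm n (\<lambda>i. seg (5 * n + 22) t1 i - mat_app n (\<lambda>i j. a j i) (seg (4 * n + 21) s) i)
              \<le> u * sp * nrm n (seg (4 * n + 21) s)" by (rule v1)
            show "\<bar>mem t3 ! (n + 12) - ip n (seg (3 * n + 20) s) (seg (4 * n + 21) s)\<bar>
              \<le> 4 * \<nu> * (\<Sum>i<n. \<bar>seg (3 * n + 20) s i\<bar> * \<bar>seg (4 * n + 21) s i\<bar>)" by (rule d3')
            show "seg (n + 18) t n = (1 + \<theta>3) * (seg (n + 18) s n + ?d2)" by (rule tn)
            show "ap (110 * \<nu>) (seg (3 * n + 20) s i) (bh i)" if "i < n" for i
              using s that by (simp add: ready_def)
            show "ap (130 * \<nu>) (mem s ! (n + 11)) (- 1 / (4 * (\<beta> p)\<^sup>2))" "ap (12 * \<nu>) (mem s ! (n + 10)) (\<beta> p)"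
              using s by (simp_all add: scaled_def)
            show "\<bar>seg (n + 18) t j - (seg (n + 18) s j + mem s ! (n + 11) * seg (5 * n + 22) t1 j)\<bar>
              \<le> 3 * u * (\<bar>seg (n + 18) s j\<bar> + \<bar>mem s ! (n + 11) * seg (5 * n + 22) t1 j\<bar>)" if "j < n" for j
              using w2[OF that] that by (simp add: tj m1)
          qed (use sp_pos nu_tiny nrm_bh beta_pos[OF p] sb u_nonneg u_le_nu 13 in auto)
        qed
        then show ?case using r3 len s3 by (simp add: t_def)
      qed (use r3 len in auto)
    qed (use r2 len in auto)
  qed (use r1 len in auto)
qed

lemma wp_Scale:
  assumes s: "ready s" and p: "regs s 3 = p" "1 \<le> p" "p \<le> C\<^sup>2 + 1"
    and Q: "\<And>t. frame 0 {n + 10, n + 16, n + 17} {} s t \<Longrightarrow> ap (12 * \<nu>) (mem t ! (n + 10)) (\<beta> p) \<Longrightarrow> Q t"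
  shows "wp E (Scale C) Q s"
proof -
  have r0: "regs s 0 = n" and len: "7 * n + 24 \<le> length (mem s)" and Zc: "mem s ! Suc n = Z"
    using s by (auto simp: ready_def)
  have C0: "real C \<noteq> 0" "C \<noteq> 0" using C by auto
  have th: "1 + \<theta> \<noteq> 0" if "\<bar>\<theta>\<bar> \<le> u" for \<theta> using that u_tiny by auto
  have "real p \<le> real (C\<^sup>2 + 2)" using p(3) by (simp del: of_nat_add of_nat_power)
  then have pw: "real p \<le> wmax E" using wm(2) by linarith
  have "C \<le> C\<^sup>2 + 2" using self_le_power[OF C, of 2] by simp
  then have "real C \<le> real (C\<^sup>2 + 2)" by (simp del: of_nat_add of_nat_power)
  then have Cw: "real C \<le> wmax E" using wm(2) by linarith
  show ?thesis
    unfolding Scale_def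
  proof (intro wp_Seq wp_Arith wp_Load, goal_cases)
    case (13 \<theta>1 \<theta>2 \<theta>3 \<theta>4)
    define v1 where "v1 = (1 + \<theta>1) * real p"
    define v2 where "v2 = (1 + \<theta>2) * (v1 * Z)"
    define v3 where "v3 = (1 + \<theta>3) * real C"
    define v4 where "v4 = (1 + \<theta>4) * (v2 / v3)"
    define t where "t = put (n + 10) v4 (put (n + 16) v3 (put (n + 17) v2 (put (n + 17) v1 s)))"
    have a1: "ap \<nu> v1 (real p)" unfolding v1_def by (rule apI[OF refl]) (use 13 u_le_nu in linarith)
    have "ap (2 * (\<nu> + 0 + u)) v2 (real p * Z)" unfolding v2_def
      by (rule ap_round_mult[OF a1 ap_refl 13(2)]) (use nu_nonneg nu_tiny u_tiny in auto)
    then have a2: "ap (4 * \<nu>) v2 (real p * Z)" by (rule ap_mono) (use u_le_nu in simp)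
    have a3: "ap \<nu> v3 (real C)" unfolding v3_def by (rule apI[OF refl]) (use 13 u_le_nu in linarith)
    have "ap (2 * (4 * \<nu> + \<nu> + u)) v4 (\<beta> p)" unfolding v4_def
      by (rule ap_round_div[OF a2 a3 13(4)]) (use nu_nonneg nu_tiny u_tiny C0 in auto)
    then have a4: "ap (12 * \<nu>) v4 (\<beta> p)" by (rule ap_mono) (use u_le_nu in simp)
    have "Q t"
    proof (rule Q)
      show "frame 0 {n + 10, n + 16, n + 17} {} s t" unfolding t_def by (intro frame_put frame_refl) auto
      show "ap (12 * \<nu>) (mem t ! (n + 10)) (\<beta> p)" using a4 len by (simp add: t_def)
    qed
    then show ?case using r0 p len Zc by (simp add: t_def v1_def v2_def v3_def v4_def)
  qed (use r0 len p pw Cw C0 th in auto)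
qed

lemma wp_StepSize:
  assumes s: "ready s" and p: "1 \<le> p" and bt: "ap (12 * \<nu>) (mem s ! (n + 10)) (\<beta> p)"
    and Q: "\<And>t. frame 0 {n + 11, n + 16, n + 17} {} s t \<Longrightarrow> scaled p t \<Longrightarrow> Q t"
  shows "wp E StepSize Q s"
proof -
  have r0: "regs s 0 = n" and len: "7 * n + 24 \<le> length (mem s)" and m1: "ap (4 * \<nu>) (mem s ! (n + 7)) (- 1)"
    using s by (auto simp: ready_def)
  have th: "1 + \<theta> \<noteq> 0" if "\<bar>\<theta>\<bar> \<le> u" for \<theta> using that u_tiny by auto
  have b0: "mem s ! (n + 10) \<noteq> 0" by (rule ap_nonzero[OF bt]) (use nu_tiny beta_pos[OF p] p C in auto)
  have w4: "4 \<le> wmax E" using wm_small[of 4] n_pos by simp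
  have bp: "\<beta> p \<noteq> 0" by (rule not_sym) (rule less_imp_neq[OF beta_pos[OF p]])
  show ?thesis
    unfolding StepSize_def
  proof (intro wp_Seq wp_Arith wp_Load, goal_cases)
    case (15 \<theta>1 \<theta>2 \<theta>3 \<theta>4)
    define v1 where "v1 = (1 + \<theta>1) * (mem s ! (n + 10) * mem s ! (n + 10))"
    define v2 where "v2 = (1 + \<theta>2) * 4"
    define v3 where "v3 = (1 + \<theta>3) * (mem s ! (n + 7) / v2)"
    define v4 where "v4 = (1 + \<theta>4) * (v3 / v1)"
    define t where "t = put (n + 11) v4 (put (n + 16) v3 (put (n + 16) v2 (put (n + 17) v1 s)))"
    have "ap (2 * (12 * \<nu> + 12 * \<nu> + u)) v1 (\<beta> p * \<beta> p)" unfolding v1_def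
      by (rule ap_round_mult[OF bt bt 15(1)]) (use nu_nonneg nu_tiny u_tiny in auto)
    then have a1: "ap (50 * \<nu>) v1 (\<beta> p * \<beta> p)" by (rule ap_mono) (use u_le_nu in simp)
    have a2: "ap \<nu> v2 4" unfolding v2_def by (rule apI[OF refl]) (use 15 u_le_nu in linarith)
    have "ap (2 * (4 * \<nu> + \<nu> + u)) v3 (- 1 / 4)" unfolding v3_def
      by (rule ap_round_div[OF m1 a2 15(3)]) (use nu_nonneg nu_tiny u_tiny in auto)
    then have a3: "ap (12 * \<nu>) v3 (- 1 / 4)" by (rule ap_mono) (use u_le_nu in simp)
    have "ap (2 * (12 * \<nu> + 50 * \<nu> + u)) v4 (- 1 / 4 / (\<beta> p * \<beta> p))" unfolding v4_def
      by (rule ap_round_div[OF a3 a1 15(4)]) (use nu_nonneg nu_tiny u_tiny bp in auto)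
    then have "ap (130 * \<nu>) v4 (- 1 / 4 / (\<beta> p * \<beta> p))" by (rule ap_mono) (use u_le_nu nu_nonneg in simp)
    then have a4: "ap (130 * \<nu>) v4 (- 1 / (4 * (\<beta> p)\<^sup>2))" by (simp add: power2_eq_square)
    have "Q t"
    proof (rule Q)
      show "frame 0 {n + 11, n + 16, n + 17} {} s t" unfolding t_def by (intro frame_put frame_refl) auto
      show "scaled p t" using a4 bt len by (simp add: scaled_def t_def)
    qed
    then show ?case using r0 len by (simp add: t_def v1_def v2_def v3_def v4_def)
  qed (use r0 len w4 b0 th u_tiny in auto)
qed

text \<open>The start vector is copied as 0 + 1 * g. The stored one, the stored g and the operations
  are all rounded, which accounts for the 14 \<nu>.\<close>

lemma wp_Reset:
  assumes s: "ready s"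
    and Q: "\<And>t. frame 0 ({n + 2} \<union> {n + 18..<2 * n + 19}) {1} s t \<Longrightarrow>
      nrm (Suc n) (\<lambda>j. seg (n + 18) t j - g j) \<le> 14 * \<nu> * nrm (Suc n) g \<Longrightarrow> Q t"
  shows "wp E Reset Q s"
  unfolding Reset_def
proof (rule wp_Axpy[where D = "n + 18" and P = "6 * n + 23" and ?a0.0 = "n + 5" and Q' = "2 * n + 19" and m = "Suc n"])
  have r0: "regs s 0 = n" and len: "7 * n + 24 \<le> length (mem s)" and one: "ap \<nu> (mem s ! (n + 5)) 1"
    using s by (auto simp: ready_def)
  show "addr (ad 1 18) (n + 18)" "addr (ad 6 23) (6 * n + 23)" "addr (ad 1 5) (n + 5)"
    "addr (ad 2 19) (2 * n + 19)" "addr (ad 1 1) (Suc n)" by (auto intro!: addr_ad)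
  show "real (Suc n) \<le> wmax E" by (rule wm_small) (use n_pos in simp)
  show "u \<le> 1" using u_tiny by simp
  fix t assume f: "frame 0 ({n + 2} \<union> {n + 18..<n + 18 + Suc n}) {1} s t"
    and w: "\<And>i. i < Suc n \<Longrightarrow> \<bar>seg (n + 18) t i - (seg (6 * n + 23) s i + mem s ! (n + 5) * seg (2 * n + 19) s i)\<bar>
      \<le> 3 * u * (\<bar>seg (6 * n + 23) s i\<bar> + \<bar>mem s ! (n + 5) * seg (2 * n + 19) s i\<bar>)"
  have x: "ap (14 * \<nu>) (seg (n + 18) t i) (g i)" if i: "i < Suc n" for i
  proof -
    let ?y = "mem s ! (n + 5) * seg (2 * n + 19) s i"
    have "ap (3 * u) (seg (n + 18) t i) ?y" using w[OF i] s i by (simp add: ap_def ready_def)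
    then obtain \<theta> where \<theta>: "seg (n + 18) t i = (1 + \<theta>) * ?y" "\<bar>\<theta>\<bar> \<le> 3 * u" using u_nonneg by (elim apE) auto
    have "ap (2 * (\<nu> + \<nu> + 3 * u)) ((1 + \<theta>) * ?y) (1 * g i)"
      by (rule ap_round_mult[OF one _ \<theta>(2)]) (use s i nu_nonneg nu_tiny u_tiny in \<open>auto simp: ready_def\<close>)
    then show ?thesis unfolding \<theta>(1) by (simp, elim ap_mono) (use u_le_nu nu_nonneg in simp)
  qed
  show "Q t"
  proof (rule Q)
    show "frame 0 ({n + 2} \<union> {n + 18..<2 * n + 19}) {1} s t" by (rule frame_mono[OF f]) auto
    have "nrm (Suc n) (\<lambda>j. seg (n + 18) t j - g j) \<le> (14 * \<nu>) * nrm (Suc n) g + 0 * nrm (Suc n) g"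
      by (rule nrm_le_lincomb2) (use x nu_nonneg in \<open>auto simp: ap_def\<close>)
    then show "nrm (Suc n) (\<lambda>j. seg (n + 18) t j - g j) \<le> 14 * \<nu> * nrm (Suc n) g" by simp
  qed
qed (use s in \<open>auto simp: ready_def\<close>)

lemma ah_bound: "sp \<le> \<beta> p \<Longrightarrow> nrm n (mat_app (Suc n) (ah p) z) \<le> 2 * \<beta> p * nrm (Suc n) z"
  by (rule nrm_bordered_le'[OF sp_bound nrm_bh]) (use sp_pos in auto)

text \<open>The step size is 1 / L^2 for the norm bound L = 2 \<beta> of the bordered matrix, the
  largest value that \<open>nrm_gd_step\<close> admits.\<close>

lemma eta_bound: "sp \<le> \<beta> p \<Longrightarrow> 1 / (4 * (\<beta> p)\<^sup>2) * (2 * \<beta> p)\<^sup>2 \<le> 1"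
proof -
  assume "sp \<le> \<beta> p"
  moreover have "1 / (4 * x\<^sup>2) * (2 * x)\<^sup>2 \<le> 1" if "0 < x" for x :: real
    using that by (simp add: power_mult_distrib)
  ultimately show ?thesis using sp_pos by (meson order.strict_trans2)
qed

lemma nrm_g: "nrm (Suc n) g \<le> 16 * real (Suc n)"
proof -
  have "nrm (Suc n) g \<le> (\<Sum>i<Suc n. \<bar>g i\<bar>)" by (rule L2_set_le_sum_abs)
  also have "\<dots> \<le> (\<Sum>i<Suc n. 16)" 
  proof (rule sum_mono)
    fix i
    show "\<bar>g i\<bar> \<le> 16" using g(1)[of i] g(2)[of i] by linarith
  qed
  finally show ?thesis by (simp add: algebra_simps)
qed

text \<open>Here m is of order 1/\<epsilon>, so this is of order n/\<epsilon>^2. The analysis asks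
  for log n/\<epsilon>^2; using n avoids computing a logarithm and still fits the query
  bound.\<close>

definition iters :: "nat \<Rightarrow> nat" where
  "iters m = 2 ^ 23 * (n * (m * m))"

lemma iters_bounds:
  assumes m: "1 / (2 * \<epsilon>) \<le> real m" "real m \<le> 3 / \<epsilon>"
  shows "2 ^ 21 * real n / \<epsilon>\<^sup>2 \<le> real (iters m)" "real (iters m) \<le> 2 ^ 27 * real n / \<epsilon>\<^sup>2"
    "real (iters m) \<le> 2 ^ 27 * (real n / \<epsilon>)\<^sup>2" "0 < iters m"
proof -
  have r: "real (iters m) = 2 ^ 23 * real n * (real m)\<^sup>2" by (simp add: iters_def power2_eq_square)
  have lo: "(1 / (2 * \<epsilon>))\<^sup>2 \<le> (real m)\<^sup>2" using m eps by (intro power_mono) auto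
  have hi: "(real m)\<^sup>2 \<le> (3 / \<epsilon>)\<^sup>2" using m by (intro power_mono) auto
  have "2 ^ 23 * real n * (1 / (2 * \<epsilon>))\<^sup>2 \<le> real (iters m)" unfolding r using lo by (intro mult_left_mono) auto
  then show 1: "2 ^ 21 * real n / \<epsilon>\<^sup>2 \<le> real (iters m)" by (simp add: power_divide power_mult_distrib)
  have "real (iters m) \<le> 2 ^ 23 * real n * (3 / \<epsilon>)\<^sup>2" unfolding r using hi by (intro mult_left_mono) auto
  also have "\<dots> = (2 ^ 23 * 9) * (real n / \<epsilon>\<^sup>2)" by (simp add: power_divide)
  also have "\<dots> \<le> 2 ^ 27 * (real n / \<epsilon>\<^sup>2)" by (intro mult_right_mono) auto
  finally show 2: "real (iters m) \<le> 2 ^ 27 * real n / \<epsilon>\<^sup>2" by simp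
  have "real n * 1 \<le> real n * real n" using n_pos by (intro mult_left_mono) auto
  then have "real n / \<epsilon>\<^sup>2 \<le> (real n / \<epsilon>)\<^sup>2"
    unfolding power_divide by (intro divide_right_mono) (auto simp: power2_eq_square)
  then have "2 ^ 27 * (real n / \<epsilon>\<^sup>2) \<le> 2 ^ 27 * (real n / \<epsilon>)\<^sup>2" by (rule mult_left_mono) simp
  then show "real (iters m) \<le> 2 ^ 27 * (real n / \<epsilon>)\<^sup>2" using 2 by simp
  have "0 < 2 ^ 21 * real n / \<epsilon>\<^sup>2" using n_pos eps by simp
  then show "0 < iters m" using 1 by linarith
qed

text \<open>Of the four powers of n/\<epsilon> available in \<open>nu_small_eps\<close>, two pay for
  the number of steps and two are left as accuracy. A fifth one in the assumption on u went into
  \<nu> = n u.\<close>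

lemma drift_bound:
  assumes m: "1 / (2 * \<epsilon>) \<le> real m" "real m \<le> 3 / \<epsilon>"
  shows "(14 + 2000 * real (iters m)) * \<nu> \<le> \<epsilon> / (2 ^ 20 * (real n)\<^sup>2)"
proof -
  have "1 \<le> (real n / \<epsilon>)\<^sup>2" using n_eps by (simp add: one_le_power)
  then have "14 + 2000 * real (iters m) \<le> 2 ^ 39 * (real n / \<epsilon>)\<^sup>2" using iters_bounds(3)[OF m] by simp
  then have "(14 + 2000 * real (iters m)) * (\<nu> * (real n / \<epsilon>)\<^sup>2) \<le> (2 ^ 39 * (real n / \<epsilon>)\<^sup>2) * (\<nu> * (real n / \<epsilon>)\<^sup>2)"
    using nu_nonneg eps by (intro mult_right_mono) auto
  also have "\<dots> = 2 ^ 39 * (\<nu> * (real n / \<epsilon>) ^ 4)" by (simp only: power2_eq_square power4_eq_xxxx mult_ac)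
  also have "\<dots> \<le> 2 ^ 39 * (1 / 2 ^ 60)" using nu_small_eps by (intro mult_left_mono) (auto simp: field_simps)
  also have "\<dots> \<le> 1 / 2 ^ 20" by simp
  finally have "(14 + 2000 * real (iters m)) * \<nu> * (real n / \<epsilon>)\<^sup>2 \<le> 1 / 2 ^ 20" by (simp add: mult_ac)
  then have "(14 + 2000 * real (iters m)) * \<nu> \<le> \<epsilon>\<^sup>2 / (2 ^ 20 * (real n)\<^sup>2)"
    using eps n_pos by (simp add: field_simps)
  also have "\<dots> \<le> \<epsilon> / (2 ^ 20 * (real n)\<^sup>2)"
    using eps by (intro divide_right_mono) (auto simp: power2_eq_square mult_left_le)
  finally show ?thesis .
qed

lemma wp_Iterate:
  assumes s: "ready s" "scaled p s" and p: "1 \<le> p"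
    and m: "regs s 4 = m" "1 / (2 * \<epsilon>) \<le> real m" "real m \<le> 3 / \<epsilon>"
    and start: "nrm (Suc n) (\<lambda>j. seg (n + 18) s j - g j) \<le> 14 * \<nu> * (16 * real (Suc n))"
    and Q: "\<And>t. frame (2 * iters m) xset {1, 2} s t \<Longrightarrow>
      (sp \<le> \<beta> p \<Longrightarrow> nrm (Suc n) (\<lambda>j. seg (n + 18) t j - gd_iter n (Suc n) (ah p) (1 / (4 * (\<beta> p)\<^sup>2)) g (iters m) j)
         \<le> (14 + 2000 * real (iters m)) * \<nu> * (16 * real (Suc n))) \<Longrightarrow> Q t"
  shows "wp E Iterate Q s"
  unfolding Iterate_def
proof -
  let ?D = "16 * real (Suc n)" and ?\<eta> = "1 / (4 * (\<beta> p)\<^sup>2)"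
  let ?I = "\<lambda>k t. frame (2 * k) xset {1, 2} s t \<and>
    (sp \<le> \<beta> p \<longrightarrow> nrm (Suc n) (\<lambda>j. seg (n + 18) t j - gd_iter n (Suc n) (ah p) ?\<eta> g k j)
         \<le> (14 + 2000 * real k) * \<nu> * ?D)"
  show "wp E (For 2 (Mul (N (2 ^ 23)) (Mul (V 0) (Mul (V 4) (V 4)))) (Seq Product Step)) Q s"
  proof (rule wp_For[where I = ?I and m = "iters m"])
    show "?I 0 (set_reg 2 0 s)" using start by (auto intro!: frame_set_reg frame_refl)
    have "(real n / \<epsilon>)\<^sup>2 \<le> (real n / \<epsilon>) ^ 3" using n_eps by (intro power_increasing) auto
    then have "2 ^ 27 * (real n / \<epsilon>)\<^sup>2 \<le> 2 ^ 40 * (real n / \<epsilon>) ^ 3" using eps by (intro mult_mono) auto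
    then have "real (iters m) \<le> 2 ^ 40 * (real n / \<epsilon>) ^ 3" using iters_bounds(3)[OF m(2,3)] by linarith
    then show "real (iters m) \<le> wmax E" using wm(1) by linarith
    show "Q t" if "?I (iters m) t" for t using that Q by blast
    show "aval (Mul (N (2 ^ 23)) (Mul (V 0) (Mul (V 4) (V 4)))) (regs t) = iters m" if "?I k t" for k t
      using that s m by (auto simp: frame_def ready_def iters_def)
    fix k t assume k: "k < iters m" and t: "?I k t" and rt: "regs t 2 = k"
    have fr: "frame (2 * k) xset {1, 2} s t" using t by blast
    have "frame (2 * k) touched {1, 2} s t" by (rule frame_mono[OF fr]) auto
    then have rd: "ready t" by (rule ready_frame[OF s(1)]) simp
    have sc: "scaled p t" by (rule scaled_frame[OF s(2) fr])
    show "wp E (Seq Product Step) (\<lambda>t'. regs t' 2 = k \<and> ?I (Suc k) (set_reg 2 (Suc k) t')) t"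
    proof (rule wp_Seq, rule wp_Product[OF rd sc p])
      fix t1 assume f1: "frame 1 wset {1} t t1"
        and w1: "nrm n (\<lambda>i. seg (4 * n + 21) t1 i - mat_app (Suc n) (ah p) (seg (n + 18) t) i)
          \<le> 300 * \<nu> * (sp * nrm n (seg (n + 18) t) + \<beta> p * \<bar>seg (n + 18) t n\<bar>)"
      have f1x: "frame 1 xset {1, 2} t t1" by (rule frame_mono[OF f1]) auto
      have "frame 1 touched {1, 2} t t1" by (rule frame_mono[OF f1]) auto
      then have rd1: "ready t1" by (rule ready_frame[OF rd]) simp
      have sc1: "scaled p t1" by (rule scaled_frame[OF sc f1x])
      have x1: "seg (n + 18) t1 i = seg (n + 18) t i" if "i < Suc n" for i
        by (rule frame_memD[OF f1]) (use that in auto)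
      have W: "nrm n (\<lambda>i. seg (4 * n + 21) t1 i - mat_app (Suc n) (ah p) (seg (n + 18) t1) i)
          \<le> 300 * \<nu> * (sp * nrm n (seg (n + 18) t1) + \<beta> p * \<bar>seg (n + 18) t1 n\<bar>)"
      proof -
        have "mat_app (Suc n) (ah p) (seg (n + 18) t1) i = mat_app (Suc n) (ah p) (seg (n + 18) t) i" for i
          by (rule mat_app_cong) (simp_all add: x1)
        moreover have "nrm n (seg (n + 18) t1) = nrm n (seg (n + 18) t)" by (rule nrm_cong) (simp add: x1)
        ultimately show ?thesis using w1 x1[of n] by simp
      qed
      show "wp E Step (\<lambda>t'. regs t' 2 = k \<and> ?I (Suc k) (set_reg 2 (Suc k) t')) t1"
      proof (rule wp_Step[OF rd1 sc1 p W])
        fix t2 assume f2: "frame 1 xset {1} t1 t2"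
          and e2: "sp \<le> \<beta> p \<Longrightarrow> nrm (Suc n) (\<lambda>j. seg (n + 18) t2 j - gd_step n (Suc n) (ah p) ?\<eta> (seg (n + 18) t1) j)
            \<le> 1000 * \<nu> * nrm (Suc n) (seg (n + 18) t1)"
        have f2x: "frame 1 xset {1, 2} t1 t2" by (rule frame_mono[OF f2]) auto
        have f: "frame (2 * Suc k) xset {1, 2} s t2"
          using frame_trans[OF frame_trans[OF fr f1x] f2x] by simp
        have "regs t2 2 = k" using frame_regD[OF f2] frame_regD[OF f1] rt by simp
        moreover have "nrm (Suc n) (\<lambda>j. seg (n + 18) t2 j - gd_iter n (Suc n) (ah p) ?\<eta> g (Suc k) j)
         \<le> (14 + 2000 * real (Suc k)) * \<nu> * ?D" if sb: "sp \<le> \<beta> p"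
        proof -
          have b2: "0 \<le> 2 * \<beta> p" "0 \<le> ?\<eta>" using sb sp_pos by auto
          let ?z = "gd_iter n (Suc n) (ah p) ?\<eta> g k"
          have t1: "nrm (Suc n) (\<lambda>j. seg (n + 18) t1 j - ?z j) = nrm (Suc n) (\<lambda>j. seg (n + 18) t j - ?z j)"
            by (rule nrm_cong) (simp only: x1)
          have e1: "nrm (Suc n) (\<lambda>j. seg (n + 18) t1 j - ?z j) \<le> (14 + 2000 * real k) * \<nu> * ?D"
            using t sb unfolding t1 by blast
          have "nrm (Suc n) ?z \<le> ?D"
            by (rule order_trans[OF nrm_gd_iter_le[OF ah_bound[OF sb] b2 eta_bound[OF sb]] nrm_g])
          \<comment> \<open>Bootstrapping: the drift so far is at most D, so the computed iterate
            has norm at most 2 D, and the relative error 1000 \<nu> of the next step adds at most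
            2000 \<nu> D.\<close>
          moreover have "(14 + 2000 * real k) * \<nu> * ?D \<le> 1 * ?D"
          proof (rule mult_right_mono)
            have "(14 + 2000 * real k) * \<nu> \<le> (14 + 2000 * real (iters m)) * \<nu>"
              using k nu_nonneg by (intro mult_right_mono) auto
            also have "\<dots> \<le> \<epsilon> / (2 ^ 20 * (real n)\<^sup>2)" by (rule drift_bound[OF m(2,3)])
            also have "\<dots> \<le> 1"
            proof -
              have "1 \<le> (real n)\<^sup>2" using n_pos by (simp add: one_le_power)
              then show ?thesis using eps by (simp add: divide_le_eq)
            qed
            finally show "(14 + 2000 * real k) * \<nu> \<le> 1" .
          qed simp
          ultimately have "nrm (Suc n) (seg (n + 18) t1) \<le> 2 * ?D"
            using nrm_diff_triangle[of "seg (n + 18) t1" "Suc n" ?z] e1 by linarith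
          then have "1000 * \<nu> * nrm (Suc n) (seg (n + 18) t1) \<le> 1000 * \<nu> * (2 * ?D)"
            using nu_nonneg by (intro mult_left_mono) auto
          also have "1000 * \<nu> * (2 * ?D) = 2000 * \<nu> * ?D" by simp
          finally have e2': "nrm (Suc n) (\<lambda>j. seg (n + 18) t2 j - gd_step n (Suc n) (ah p) ?\<eta> (seg (n + 18) t1) j)
            \<le> 2000 * \<nu> * ?D"
            by (rule order_trans[OF e2[OF sb]])
          have "nrm (Suc n) (\<lambda>j. seg (n + 18) t2 j - gd_iter n (Suc n) (ah p) ?\<eta> g (Suc k) j)
            \<le> (14 + 2000 * real k) * \<nu> * ?D + 2000 * \<nu> * ?D"
            by (rule gd_iter_perturbed_step[OF ah_bound[OF sb] b2 eta_bound[OF sb] e2' e1])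
          then show ?thesis by (simp add: algebra_simps)
        qed
        ultimately show "regs t2 2 = k \<and> ?I (Suc k) (set_reg 2 (Suc k) t2)"
          using f by (auto intro!: frame_set_reg)
      qed
    qed
  qed
qed

text \<open>A sum of squares has no cancellation, so the absolute dot product bound is a relative
  one.\<close>

lemma ap_of_dot:
  assumes "\<bar>r - ip m x x\<bar> \<le> e * (\<Sum>i<m. \<bar>x i\<bar> * \<bar>x i\<bar>)"
  shows "ap e r ((nrm m x)\<^sup>2)"
proof -
  have "(\<Sum>i<m. \<bar>x i\<bar> * \<bar>x i\<bar>) = (nrm m x)\<^sup>2" unfolding ip_self[symmetric] by (simp add: ip_def)
  then show ?thesis using assms by (simp add: ap_def ip_self)
qed

lemma dot_small: "4 * real n * u = 4 * \<nu>" "4 * real (Suc n) * u \<le> 8 * \<nu>" "4 * real (Suc n) * u \<le> 1" "4 * real n * u \<le> 1"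
proof -
  show 1: "4 * real n * u = 4 * \<nu>" by (simp add: \<nu>_def)
  have "4 * real (Suc n) * u = 4 * \<nu> + 4 * u" by (simp add: \<nu>_def algebra_simps)
  then show 2: "4 * real (Suc n) * u \<le> 8 * \<nu>" using u_le_nu by linarith
  have "8 * \<nu> \<le> 1" using nu_tiny by simp
  then show "4 * real (Suc n) * u \<le> 1" "4 * real n * u \<le> 1" using 1 2 nu_nonneg by linarith+
qed

text \<open>Both sides of the acceptance test are squared, which saves roots and keeps all errors
  relative. The separate |x|^2 guards against x = 0 and is reused by \<open>Output\<close> for the
  shift of \<tau>.\<close>

lemma wp_Measure:
  assumes s: "ready s" and bt: "ap (12 * \<nu>) (mem s ! (n + 10)) (\<beta> p)"
    and Q: "\<And>t. frame 0 {n + 2, n + 13, n + 14, n + 15} {1} s t \<Longrightarrow>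
      ap (4 * \<nu>) (mem t ! (n + 13)) ((nrm n (seg (4 * n + 21) s))\<^sup>2) \<Longrightarrow>
      ap (258 * \<nu>) (mem t ! (n + 14)) ((\<epsilon> / 32)\<^sup>2 * (\<beta> p)\<^sup>2 * (nrm (Suc n) (seg (n + 18) s))\<^sup>2) \<Longrightarrow>
      ap (4 * \<nu>) (mem t ! (n + 15)) ((nrm n (seg (n + 18) s))\<^sup>2) \<Longrightarrow> Q t"
  shows "wp E Measure Q s"
  unfolding Measure_def
proof (rule wp_Seq, rule wp_Dot[where D = "n + 13" and P = "4 * n + 21" and Q' = "4 * n + 21" and m = n])
  let ?F = "{n + 2, n + 13, n + 14, n + 15}"
  have r0: "regs s 0 = n" and len: "7 * n + 24 \<le> length (mem s)" and thr: "ap (18 * \<nu>) (mem s ! (n + 9)) ((\<epsilon> / 32)\<^sup>2)"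
    using s by (auto simp: ready_def)
  show "addr (ad 1 13) (n + 13)" "addr (ad 4 21) (4 * n + 21)" "addr (ad 4 21) (4 * n + 21)" "addr (ad 1 0) n"
    by (auto intro!: addr_ad)
  show "real n \<le> wmax E" by (rule wm_small) simp
  fix t1 assume f1: "frame 0 {n + 13, n + 2} {1} s t1"
    and d1: "\<bar>mem t1 ! (n + 13) - ip n (seg (4 * n + 21) s) (seg (4 * n + 21) s)\<bar>
      \<le> 4 * real n * u * (\<Sum>i<n. \<bar>seg (4 * n + 21) s i\<bar> * \<bar>seg (4 * n + 21) s i\<bar>)"
  have r1: "regs t1 0 = n" "length (mem t1) = length (mem s)" using frame_regD[OF f1] frame_lenD[OF f1] r0 by auto
  have m1: "mem t1 ! j = mem s ! j" if "j \<notin> {n + 13, n + 2}" for j by (rule frame_memD[OF f1 that])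
  have F1: "frame 0 ?F {1} s t1" by (rule frame_mono[OF f1]) auto
  have a1: "ap (4 * \<nu>) (mem t1 ! (n + 13)) ((nrm n (seg (4 * n + 21) s))\<^sup>2)"
    using ap_of_dot[OF d1] by (simp only: dot_small)
  show "wp E (Seq (Dot (ad 1 14) (ad 1 18) (ad 1 18) (ad 1 1))
     (Seq (Dot (ad 1 15) (ad 1 18) (ad 1 18) (ad 1 0)) (Seq (Arith FMul (ad 1 14) (ad 1 14) (ad 1 10))
     (Seq (Arith FMul (ad 1 14) (ad 1 14) (ad 1 10)) (Arith FMul (ad 1 14) (ad 1 14) (ad 1 9)))))) Q t1"
  proof (rule wp_Seq, rule wp_Dot[where D = "n + 14" and P = "n + 18" and Q' = "n + 18" and m = "Suc n"])
    show "addr (ad 1 14) (n + 14)" "addr (ad 1 18) (n + 18)" "addr (ad 1 18) (n + 18)" "addr (ad 1 1) (Suc n)"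
      by (auto intro!: addr_ad)
    show "real (Suc n) \<le> wmax E" by (rule wm_small) (use n_pos in simp)
    fix t2 assume f2: "frame 0 {n + 14, n + 2} {1} t1 t2"
      and d2: "\<bar>mem t2 ! (n + 14) - ip (Suc n) (seg (n + 18) t1) (seg (n + 18) t1)\<bar>
        \<le> 4 * real (Suc n) * u * (\<Sum>i<Suc n. \<bar>seg (n + 18) t1 i\<bar> * \<bar>seg (n + 18) t1 i\<bar>)"
    have r2: "regs t2 0 = n" "length (mem t2) = length (mem s)" using frame_regD[OF f2] frame_lenD[OF f2] r1 by auto
    have m2: "mem t2 ! j = mem t1 ! j" if "j \<notin> {n + 14, n + 2}" for j by (rule frame_memD[OF f2 that])
    have "frame 0 ?F {1} t1 t2" by (rule frame_mono[OF f2]) auto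
    from frame_trans[OF F1 this] have F2: "frame 0 ?F {1} s t2" by simp
    have "nrm (Suc n) (seg (n + 18) t1) = nrm (Suc n) (seg (n + 18) s)" by (rule nrm_cong) (simp add: m1)
    then have a2: "ap (8 * \<nu>) (mem t2 ! (n + 14)) ((nrm (Suc n) (seg (n + 18) s))\<^sup>2)"
      using ap_mono[OF ap_of_dot[OF d2] dot_small(2)] by simp
    show "wp E (Seq (Dot (ad 1 15) (ad 1 18) (ad 1 18) (ad 1 0)) (Seq (Arith FMul (ad 1 14) (ad 1 14) (ad 1 10))
     (Seq (Arith FMul (ad 1 14) (ad 1 14) (ad 1 10)) (Arith FMul (ad 1 14) (ad 1 14) (ad 1 9))))) Q t2"
    proof (rule wp_Seq, rule wp_Dot[where D = "n + 15" and P = "n + 18" and Q' = "n + 18" and m = n])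
      show "addr (ad 1 15) (n + 15)" "addr (ad 1 18) (n + 18)" "addr (ad 1 18) (n + 18)" "addr (ad 1 0) n"
        by (auto intro!: addr_ad)
      show "real n \<le> wmax E" by (rule wm_small) simp
      fix t3 assume f3: "frame 0 {n + 15, n + 2} {1} t2 t3"
        and d3: "\<bar>mem t3 ! (n + 15) - ip n (seg (n + 18) t2) (seg (n + 18) t2)\<bar>
          \<le> 4 * real n * u * (\<Sum>i<n. \<bar>seg (n + 18) t2 i\<bar> * \<bar>seg (n + 18) t2 i\<bar>)"
      have r3: "regs t3 0 = n" "length (mem t3) = length (mem s)" using frame_regD[OF f3] frame_lenD[OF f3] r2 by auto
      have m3: "mem t3 ! j = mem t2 ! j" if "j \<notin> {n + 15, n + 2}" for j by (rule frame_memD[OF f3 that])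
      have "frame 0 ?F {1} t2 t3" by (rule frame_mono[OF f3]) auto
      from frame_trans[OF F2 this] have F3: "frame 0 ?F {1} s t3" by simp
      have "nrm n (seg (n + 18) t2) = nrm n (seg (n + 18) s)" by (rule nrm_cong) (simp add: m1 m2)
      then have a3: "ap (4 * \<nu>) (mem t3 ! (n + 15)) ((nrm n (seg (n + 18) s))\<^sup>2)"
        using ap_of_dot[OF d3] by (simp add: dot_small(1))
      have c3: "mem t3 ! (n + 10) = mem s ! (n + 10)" "mem t3 ! (n + 9) = mem s ! (n + 9)"
        "mem t3 ! (n + 13) = mem t1 ! (n + 13)" "mem t3 ! (n + 14) = mem t2 ! (n + 14)"
        by (simp_all add: m1 m2 m3)
      show "wp E (Seq (Arith FMul (ad 1 14) (ad 1 14) (ad 1 10))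
       (Seq (Arith FMul (ad 1 14) (ad 1 14) (ad 1 10)) (Arith FMul (ad 1 14) (ad 1 14) (ad 1 9)))) Q t3"
      proof (intro wp_Seq wp_Arith, goal_cases)
        case (13 \<theta>1 \<theta>2 \<theta>3)
        let ?z = "(nrm (Suc n) (seg (n + 18) s))\<^sup>2"
        define v1 where "v1 = (1 + \<theta>1) * (mem t2 ! (n + 14) * mem s ! (n + 10))"
        define v2 where "v2 = (1 + \<theta>2) * (v1 * mem s ! (n + 10))"
        define v3 where "v3 = (1 + \<theta>3) * (v2 * mem s ! (n + 9))"
        define t where "t = put (n + 14) v3 (put (n + 14) v2 (put (n + 14) v1 t3))"
        have "ap (2 * (8 * \<nu> + 12 * \<nu> + u)) v1 (?z * \<beta> p)" unfolding v1_def
          by (rule ap_round_mult[OF a2 bt 13(1)]) (use nu_nonneg nu_tiny u_tiny in auto)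
        then have b1: "ap (42 * \<nu>) v1 (?z * \<beta> p)" by (rule ap_mono) (use u_le_nu in simp)
        have "ap (2 * (42 * \<nu> + 12 * \<nu> + u)) v2 (?z * \<beta> p * \<beta> p)" unfolding v2_def
          by (rule ap_round_mult[OF b1 bt 13(2)]) (use nu_nonneg nu_tiny u_tiny in auto)
        then have b2: "ap (110 * \<nu>) v2 (?z * \<beta> p * \<beta> p)" by (rule ap_mono) (use u_le_nu in simp)
        have "ap (2 * (110 * \<nu> + 18 * \<nu> + u)) v3 (?z * \<beta> p * \<beta> p * (\<epsilon> / 32)\<^sup>2)" unfolding v3_def
          by (rule ap_round_mult[OF b2 thr 13(3)]) (use nu_nonneg nu_tiny u_tiny in auto)
        then have "ap (258 * \<nu>) v3 (?z * \<beta> p * \<beta> p * (\<epsilon> / 32)\<^sup>2)" by (rule ap_mono) (use u_le_nu in simp)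
        moreover have "?z * \<beta> p * \<beta> p * (\<epsilon> / 32)\<^sup>2 = (\<epsilon> / 32)\<^sup>2 * (\<beta> p)\<^sup>2 * ?z"
          by (simp only: power2_eq_square mult_ac)
        ultimately have b3: "ap (258 * \<nu>) v3 ((\<epsilon> / 32)\<^sup>2 * (\<beta> p)\<^sup>2 * ?z)" by simp
        have "Q t"
        proof (rule Q)
          show "frame 0 ?F {1} s t" unfolding t_def by (intro frame_put F3) auto
          show "ap (4 * \<nu>) (mem t ! (n + 13)) ((nrm n (seg (4 * n + 21) s))\<^sup>2)" using a1 c3 by (simp add: t_def)
          show "ap (258 * \<nu>) (mem t ! (n + 14)) ((\<epsilon> / 32)\<^sup>2 * (\<beta> p)\<^sup>2 * ?z)" using b3 r3 len by (simp add: t_def)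
          show "ap (4 * \<nu>) (mem t ! (n + 15)) ((nrm n (seg (n + 18) s))\<^sup>2)" using a3 by (simp add: t_def)
        qed
        then show ?case using r3 len c3 by (simp add: t_def v1_def v2_def v3_def)
      qed (use r3 len in auto)
    qed (use r2 len dot_small in auto)
  qed (use r1 len dot_small in auto)
qed (use s dot_small in \<open>auto simp: ready_def\<close>)

lemma wp_Output:
  assumes s: "ready s" "scaled p s" and p: "1 \<le> p"
    and X2: "ap (4 * \<nu>) (mem s ! (n + 15)) ((nrm n (seg (n + 18) s))\<^sup>2)" and pos: "0 < mem s ! (n + 15)"
    and Q: "\<And>t \<tau>. frame 0 (touched \<union> {..<n}) {1} s t \<Longrightarrow>
      \<bar>\<tau> - seg (n + 18) s n\<bar> \<le> 2 * (\<epsilon> / 32) * nrm n (seg (n + 18) s) \<Longrightarrow> \<tau> \<noteq> 0 \<Longrightarrow> 0 < nrm n (seg (n + 18) s) \<Longrightarrow>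
      (\<And>i. i < n \<Longrightarrow> ap (700 * \<nu>) (mem t ! i) (- bn / (\<beta> p * \<tau>) * seg (n + 18) s i)) \<Longrightarrow> Q t"
  shows "wp E Output Q s"
proof -
  let ?F = "touched \<union> {..<n}"
  let ?X = "nrm n (seg (n + 18) s)"
  have r0: "regs s 0 = n" and len: "7 * n + 24 \<le> length (mem s)" and m4: "ap (10 * \<nu>) (mem s ! (n + 4)) bn"
    and m6: "mem s ! (n + 6) = 0" and m7: "ap (4 * \<nu>) (mem s ! (n + 7)) (- 1)" and m8: "ap (4 * \<nu>) (mem s ! (n + 8)) (\<epsilon> / 32)"
    using s by (auto simp: ready_def)
  have bt: "ap (12 * \<nu>) (mem s ! (n + 10)) (\<beta> p)" using s by (simp add: scaled_def)
  have X: "0 < ?X"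
  proof -
    have "?X \<noteq> 0" using X2 pos by (auto simp: ap_def)
    then show ?thesis using L2_set_nonneg[of "seg (n + 18) s" "{..<n}"] by linarith
  qed
  have bp: "\<beta> p \<noteq> 0" by (rule not_sym) (rule less_imp_neq[OF beta_pos[OF p]])
  show ?thesis
    unfolding Output_def
  proof (rule wp_Seq, rule wp_Sqrt, goal_cases)
    case (4 \<theta>1)
    define v1 where "v1 = (1 + \<theta>1) * sqrt (mem s ! (n + 15))"
    have "ap (4 * \<nu>) (sqrt (mem s ! (n + 15))) ?X" using ap_sqrt[OF X2] pos X by simp
    then have "ap (2 * (4 * \<nu> + u)) v1 ?X" unfolding v1_def
      by (rule ap_round[OF _ 4]) (use nu_nonneg nu_tiny u_tiny in auto)
    then have a1: "ap (10 * \<nu>) v1 ?X" by (rule ap_mono) (use u_le_nu in simp)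
    have c1: "put (aval (ad 1 15) (regs s)) ((1 + \<theta>1) * sqrt (mem s ! aval (ad 1 15) (regs s))) s = put (n + 15) v1 s"
      using r0 by (simp add: v1_def)
    show ?case
      unfolding c1
    proof (rule wp_Seq, rule wp_Arith, goal_cases)
      case (5 \<theta>2)
      define v2 where "v2 = (1 + \<theta>2) * (mem s ! (n + 8) * v1)"
      have "ap (2 * (4 * \<nu> + 10 * \<nu> + u)) v2 (\<epsilon> / 32 * ?X)" unfolding v2_def
        by (rule ap_round_mult[OF m8 a1 5]) (use nu_nonneg nu_tiny u_tiny in auto)
      then have a2: "ap (30 * \<nu>) v2 (\<epsilon> / 32 * ?X)" by (rule ap_mono) (use u_le_nu in simp)
      have eX: "0 < \<epsilon> / 32 * ?X" using eps X by simp
      have v2: "0 < v2" by (rule ap_pos[OF a2 _ eX]) (use nu_tiny in simp)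
      have v2u: "v2 \<le> 2 * (\<epsilon> / 32) * ?X"
      proof -
        have "(1 + 30 * \<nu>) * (\<epsilon> / 32 * ?X) \<le> 2 * (\<epsilon> / 32 * ?X)"
          by (intro mult_right_mono less_imp_le[OF eX]) (use nu_tiny in simp)
        moreover have "\<bar>v2\<bar> \<le> (1 + 30 * \<nu>) * (\<epsilon> / 32 * ?X)" using ap_abs_le[OF a2] by (simp only: abs_of_pos[OF eX])
        ultimately have "v2 \<le> 2 * (\<epsilon> / 32 * ?X)" by linarith
        then show ?thesis by (simp only: mult.assoc)
      qed
      define t2 where "t2 = put (n + 15) v2 (put (n + 15) v1 s)"
      have c2: "put (aval (ad 1 15) (regs (put (n + 15) v1 s))) ((1 + \<theta>2) * fop_val FMul
          (mem (put (n + 15) v1 s) ! aval (ad 1 8) (regs (put (n + 15) v1 s)))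
          (mem (put (n + 15) v1 s) ! aval (ad 1 15) (regs (put (n + 15) v1 s)))) (put (n + 15) v1 s) = t2"
        using r0 len by (simp add: v2_def t2_def)
      have F2: "frame 0 ?F {1} s t2" unfolding t2_def by (intro frame_put frame_refl) auto
      have r2: "regs t2 = regs s" "length (mem t2) = length (mem s)" by (simp_all add: t2_def)
      have m2: "mem t2 ! (n + 15) = v2" "mem t2 ! (n + 6) = 0" "mem t2 ! (2 * n + 18) = mem s ! (2 * n + 18)"
        using len m6 by (simp_all add: t2_def)
      \<comment> \<open>The shift has the sign of the old entry, so nothing can cancel and \<tau>
        stays at distance at least \<open>v2 > 0\<close> from 0.\<close>
      define \<tau> where "\<tau> = (if mem s ! (2 * n + 18) < 0 then mem s ! (2 * n + 18) - v2 else mem s ! (2 * n + 18) + v2)"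
      have \<tau>0: "\<tau> \<noteq> 0" using v2 by (auto simp: \<tau>_def)
      have \<tau>1: "\<bar>\<tau> - seg (n + 18) s n\<bar> \<le> 2 * (\<epsilon> / 32) * ?X" using v2 v2u unfolding tau_cell by (simp add: \<tau>_def)
      show ?case
        unfolding c2
      proof (rule wp_Seq, rule wp_mono[where Q = "\<lambda>t. \<exists>\<theta>3. \<bar>\<theta>3\<bar> \<le> u \<and> t = put (2 * n + 18) ((1 + \<theta>3) * \<tau>) t2"])
        show "wp E (Cond (RLess (ad 2 18) (ad 1 6)) (Arith FSub (ad 2 18) (ad 2 18) (ad 1 15))
          (Arith FAdd (ad 2 18) (ad 2 18) (ad 1 15))) (\<lambda>t. \<exists>\<theta>3. \<bar>\<theta>3\<bar> \<le> u \<and> t = put (2 * n + 18) ((1 + \<theta>3) * \<tau>) t2) t2"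
          by (intro wp_Cond wp_Arith) (use r0 r2 len m2 in \<open>auto simp: \<tau>_def\<close>)
      next
        fix t3 assume "\<exists>\<theta>3. \<bar>\<theta>3\<bar> \<le> u \<and> t3 = put (2 * n + 18) ((1 + \<theta>3) * \<tau>) t2"
        then obtain \<theta>3 where \<theta>3: "\<bar>\<theta>3\<bar> \<le> u" and t3: "t3 = put (2 * n + 18) ((1 + \<theta>3) * \<tau>) t2" by blast
        have a3: "ap \<nu> ((1 + \<theta>3) * \<tau>) \<tau>" by (rule apI[OF refl]) (use \<theta>3 u_le_nu in linarith)
        have F3: "frame 0 ?F {1} s t3" unfolding t3 by (intro frame_put F2) auto
        have r3: "regs t3 0 = n" "length (mem t3) = length (mem s)" by (simp_all add: t3 r2 r0)
        have m3: "mem t3 ! (2 * n + 18) = (1 + \<theta>3) * \<tau>" "mem t3 ! (n + 10) = mem s ! (n + 10)"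
          "mem t3 ! (n + 4) = mem s ! (n + 4)" "mem t3 ! (n + 7) = mem s ! (n + 7)"
          using len n_pos by (simp_all add: t3 t2_def)
        show "wp E (Seq (Arith FMul (ad 1 16) (ad 1 10) (ad 2 18)) (Seq (Arith FDiv (ad 1 16) (ad 1 4) (ad 1 16))
          (Seq (Arith FMul (ad 1 16) (ad 1 16) (ad 1 7)) (Axpy (ad 0 0) (ad 6 23) (ad 1 16) (ad 1 18) (ad 1 0))))) Q t3"
        proof (rule wp_Seq, rule wp_Arith, goal_cases)
          case (5 \<theta>4)
          define v4 where "v4 = (1 + \<theta>4) * (mem s ! (n + 10) * ((1 + \<theta>3) * \<tau>))"
          have "ap (2 * (12 * \<nu> + \<nu> + u)) v4 (\<beta> p * \<tau>)" unfolding v4_def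
            by (rule ap_round_mult[OF bt a3 5]) (use nu_nonneg nu_tiny u_tiny in auto)
          then have a4: "ap (28 * \<nu>) v4 (\<beta> p * \<tau>)" by (rule ap_mono) (use u_le_nu in simp)
          have bt0: "\<beta> p * \<tau> \<noteq> 0" using bp \<tau>0 by (rule no_zero_divisors)
          have v4: "v4 \<noteq> 0" by (rule ap_nonzero[OF a4 _ bt0]) (use nu_tiny in simp)
          have c4: "put (aval (ad 1 16) (regs t3)) ((1 + \<theta>4) * fop_val FMul (mem t3 ! aval (ad 1 10) (regs t3))
              (mem t3 ! aval (ad 2 18) (regs t3))) t3 = put (n + 16) v4 t3"
            using r3 m3 by (simp add: v4_def)
          show ?case
            unfolding c4
          proof (rule wp_Seq, rule wp_Arith, goal_cases)
            case (5 \<theta>5)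
            define v5 where "v5 = (1 + \<theta>5) * (mem s ! (n + 4) / v4)"
            have "ap (2 * (10 * \<nu> + 28 * \<nu> + u)) v5 (bn / (\<beta> p * \<tau>))" unfolding v5_def
              by (rule ap_round_div[OF m4 a4 5 _ _ _ _ _ bt0]) (use nu_nonneg nu_tiny u_tiny in auto)
            then have a5: "ap (78 * \<nu>) v5 (bn / (\<beta> p * \<tau>))" by (rule ap_mono) (use u_le_nu in simp)
            have c5: "put (aval (ad 1 16) (regs (put (n + 16) v4 t3))) ((1 + \<theta>5) * fop_val FDiv
                (mem (put (n + 16) v4 t3) ! aval (ad 1 4) (regs (put (n + 16) v4 t3)))
                (mem (put (n + 16) v4 t3) ! aval (ad 1 16) (regs (put (n + 16) v4 t3)))) (put (n + 16) v4 t3)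
                = put (n + 16) v5 (put (n + 16) v4 t3)"
              using r3 m3 len by (simp add: v5_def)
            show ?case
              unfolding c5
            proof (rule wp_Seq, rule wp_Arith, goal_cases)
              case (5 \<theta>6)
              define v6 where "v6 = (1 + \<theta>6) * (v5 * mem s ! (n + 7))"
              have "ap (2 * (78 * \<nu> + 4 * \<nu> + u)) v6 (bn / (\<beta> p * \<tau>) * (- 1))" unfolding v6_def
                by (rule ap_round_mult[OF a5 m7 5]) (use nu_nonneg nu_tiny u_tiny in auto)
              then have "ap (166 * \<nu>) v6 (bn / (\<beta> p * \<tau>) * (- 1))" by (rule ap_mono) (use u_le_nu in simp)
              then have a6: "ap (166 * \<nu>) v6 (- bn / (\<beta> p * \<tau>))" by simp
              define t6 where "t6 = put (n + 16) v6 (put (n + 16) v5 (put (n + 16) v4 t3))"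
              have c6: "put (aval (ad 1 16) (regs (put (n + 16) v5 (put (n + 16) v4 t3)))) ((1 + \<theta>6) * fop_val FMul
                  (mem (put (n + 16) v5 (put (n + 16) v4 t3)) ! aval (ad 1 16) (regs (put (n + 16) v5 (put (n + 16) v4 t3))))
                  (mem (put (n + 16) v5 (put (n + 16) v4 t3)) ! aval (ad 1 7) (regs (put (n + 16) v5 (put (n + 16) v4 t3)))))
                  (put (n + 16) v5 (put (n + 16) v4 t3)) = t6"
                using r3 m3 len by (simp add: v6_def t6_def)
              have F6: "frame 0 ?F {1} s t6" unfolding t6_def by (intro frame_put F3) auto
              have r6: "regs t6 0 = n" "length (mem t6) = length (mem s)" by (simp_all add: t6_def r3)
              have m6: "mem t6 ! (n + 16) = v6" using len r3 by (simp add: t6_def)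
              have x6: "seg (n + 18) t6 i = seg (n + 18) s i" if "i < n" for i
                using that by (simp add: t6_def t3 t2_def)
              have o6: "seg (6 * n + 23) t6 i = 0" if "i < n" for i
              proof -
                have "seg (6 * n + 23) t6 i = seg (6 * n + 23) s i"
                  by (rule frame_memD[OF F6]) auto
                then show ?thesis using s that by (simp add: ready_def)
              qed
              show ?case
                unfolding c6
              proof (rule wp_Axpy[where D = 0 and P = "6 * n + 23" and ?a0.0 = "n + 16" and Q' = "n + 18" and m = n])
                show "addr (ad 0 0) 0" "addr (ad 6 23) (6 * n + 23)" "addr (ad 1 16) (n + 16)"
                  "addr (ad 1 18) (n + 18)" "addr (ad 1 0) n" by (auto intro!: addr_ad)
                show "real n \<le> wmax E" by (rule wm_small) simp
                show "u \<le> 1" using u_tiny by simp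
                fix t assume f: "frame 0 ({n + 2} \<union> {0..<0 + n}) {1} t6 t"
                  and y: "\<And>i. i < n \<Longrightarrow> \<bar>seg 0 t i - (seg (6 * n + 23) t6 i + mem t6 ! (n + 16) * seg (n + 18) t6 i)\<bar>
                    \<le> 3 * u * (\<bar>seg (6 * n + 23) t6 i\<bar> + \<bar>mem t6 ! (n + 16) * seg (n + 18) t6 i\<bar>)"
                have "frame 0 ?F {1} t6 t" by (rule frame_mono[OF f]) auto
                from frame_trans[OF F6 this] have F: "frame 0 ?F {1} s t" by simp
                show "Q t"
                proof (rule Q[OF F \<tau>1 \<tau>0 X])
                  fix i assume i: "i < n"
                  let ?y = "v6 * seg (n + 18) s i"
                  have "ap (3 * u) (mem t ! i) ?y" using y[OF i] by (simp add: ap_def o6[OF i] x6[OF i] m6)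
                  then obtain \<theta> where \<theta>: "mem t ! i = (1 + \<theta>) * ?y" "\<bar>\<theta>\<bar> \<le> 3 * u" using u_nonneg by (elim apE) auto
                  have "ap (2 * (166 * \<nu> + 0 + 3 * u)) ((1 + \<theta>) * ?y) (- bn / (\<beta> p * \<tau>) * seg (n + 18) s i)"
                    by (rule ap_round_mult[OF a6 ap_refl \<theta>(2)]) (use nu_nonneg nu_tiny u_tiny in auto)
                  then show "ap (700 * \<nu>) (mem t ! i) (- bn / (\<beta> p * \<tau>) * seg (n + 18) s i)"
                    unfolding \<theta>(1) by (rule ap_mono) (use u_le_nu nu_nonneg in simp)
                qed
              qed (use r6 len in auto)
            qed (use r3 len in \<open>simp_all\<close>)
          qed (use r3 len v4 in auto)
        qed (use r3 len in auto)
      qed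
    qed (use r0 len in auto)
  qed (use r0 len pos in auto)
qed

text \<open>The only property required of the random vector. It does not mention errors or query
  answers, which may depend on the tape. The threshold is half of 1/(n + 1), a lower bound for the
  largest entry of a unit vector.\<close>

definition kernel_overlap :: "nat \<Rightarrow> bool" where
  "kernel_overlap p \<longleftrightarrow> (\<exists>e. nrm (Suc n) e = 1 \<and> (\<forall>i<n. mat_app (Suc n) (ah p) e i = 0) \<and>
     1 / (2 * real (Suc n)) \<le> \<bar>ip (Suc n) g e\<bar>)"

text \<open>At a scale above the norm, a lucky start vector gives a residual of at most half of the
  test tolerance. The other half is left for the rounding errors of the test.\<close>

lemma converged:
  assumes m: "1 / (2 * \<epsilon>) \<le> real m" "real m \<le> 3 / \<epsilon>" and sb: "sp \<le> \<beta> p" and k: "kernel_overlap p"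
    and z: "nrm (Suc n) (\<lambda>j. z j - gd_iter n (Suc n) (ah p) (1 / (4 * (\<beta> p)\<^sup>2)) g (iters m) j)
         \<le> (14 + 2000 * real (iters m)) * \<nu> * (16 * real (Suc n))"
  shows "0 < nrm (Suc n) z" "0 < nrm n z"
    and "nrm n (mat_app (Suc n) (ah p) z) \<le> \<epsilon> / 32 / 2 * \<beta> p * nrm (Suc n) z"
proof -
  let ?T = "iters m" and ?N = "real (Suc n)" and ?\<eta> = "1 / (4 * (\<beta> p)\<^sup>2)"
  define B where "B = \<beta> p"
  have B: "0 < B" using sb sp_pos by (simp add: B_def)
  let ?zT = "gd_iter n (Suc n) (ah p) ?\<eta> g ?T"
  have T: "0 < ?T" by (rule iters_bounds(4)[OF m])
  obtain e where e: "nrm (Suc n) e = 1" "\<And>i. i < n \<Longrightarrow> mat_app (Suc n) (ah p) e i = 0"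
    "1 / (2 * ?N) \<le> \<bar>ip (Suc n) g e\<bar>" using k unfolding kernel_overlap_def by blast
  have b2: "0 \<le> 2 * \<beta> p" "0 \<le> ?\<eta>" using sb sp_pos by auto
  note R = gd_iter_residual[OF ah_bound[OF sb] b2 eta_bound[OF sb] e(1,2) e(3) _ nrm_g T]
  have \<kappa>: "0 < 1 / (2 * ?N)" by simp
  define y where "y = nrm (Suc n) ?zT"
  have y: "1 / (2 * ?N) \<le> y" using R(1)[OF _ \<kappa>] by (simp add: y_def)
  have y0: "0 < y" using y \<kappa> by linarith
  \<comment> \<open>The quotient is (32 (n + 1)^2)^2. Its logarithm is of order log n; ln x \<le> x
    - 1 trades it for a multiple of n, matching the factor n in \<open>iters\<close>.\<close>
  have lnb: "ln ((16 * ?N)\<^sup>2 / (1 / (2 * ?N))\<^sup>2) \<le> 14 * real n"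
  proof -
    have "(16 * x)\<^sup>2 / (1 / (2 * x))\<^sup>2 = (2 ^ 5 * x ^ 2) ^ 2" for x :: real
      by (simp add: power2_eq_square field_simps)
    from this[of ?N] have "ln ((16 * ?N)\<^sup>2 / (1 / (2 * ?N))\<^sup>2) = ln ((2 ^ 5 * ?N ^ 2) ^ 2)" by (simp only:)
    also have "\<dots> = real 2 * ln (2 ^ 5 * ?N ^ 2)" by (rule ln_realpow)
    also have "real 2 = 2" by simp
    also have "ln (2 ^ 5 * ?N ^ 2) = ln (2 ^ 5) + ln (?N ^ 2)" by (rule ln_mult_pos) auto
    also have "ln (2 ^ 5 :: real) = 5 * ln 2" using ln_realpow[of "2::real" 5] by simp
    also have "ln (?N ^ 2) = 2 * ln ?N" using ln_realpow[of ?N 2] by simp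
    also have "2 * (5 * ln 2 + 2 * ln ?N) \<le> 2 * (5 * 1 + 2 * (?N - 1))"
      using ln_le_minus_one[of "2::real"] ln_le_minus_one[of ?N] by simp
    also have "\<dots> \<le> 14 * real n" using n_pos by simp
    finally show ?thesis .
  qed
  have "?\<eta> * (nrm n (mat_app (Suc n) (ah p) ?zT))\<^sup>2 \<le> ln ((16 * ?N)\<^sup>2 / (1 / (2 * ?N))\<^sup>2) / real ?T * y\<^sup>2"
    unfolding y_def by (rule R(2)) simp_all
  also have "\<dots> \<le> 14 * real n / real ?T * y\<^sup>2"
    using lnb by (intro mult_right_mono divide_right_mono) auto
  also have "14 * real n / real ?T \<le> 14 * real n / (2 ^ 21 * real n / \<epsilon>\<^sup>2)"
    using iters_bounds(1)[OF m] T n_pos eps by (intro divide_left_mono) auto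
  then have "14 * real n / real ?T * y\<^sup>2 \<le> 14 * real n / (2 ^ 21 * real n / \<epsilon>\<^sup>2) * y\<^sup>2" by (rule mult_right_mono) simp
  also have "\<dots> = 14 / 2 ^ 21 * (\<epsilon> * y)\<^sup>2" using n_pos eps by (simp add: field_simps power_mult_distrib)
  finally have "(nrm n (mat_app (Suc n) (ah p) ?zT))\<^sup>2 \<le> 4 * B\<^sup>2 * (14 / 2 ^ 21 * (\<epsilon> * y)\<^sup>2)"
    unfolding B_def[symmetric] using B by (simp add: field_simps)
  \<comment> \<open>4 * 14 / 2^21 is below 1/2^14 = (1/128)^2. The 2^23 in \<open>iters\<close> is
    chosen for this; two of its bits are lost to m \<ge> 1 / (2 \<epsilon>).\<close>
  also have "\<dots> \<le> (\<epsilon> / 128 * B * y)\<^sup>2" by (simp add: power_mult_distrib power_divide)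
  finally have w: "nrm n (mat_app (Suc n) (ah p) ?zT) \<le> \<epsilon> / 128 * B * y"
    by (rule power2_le_imp_le) (use eps B y0 in simp)
  \<comment> \<open>The drift is proportional to the bound 16 (n + 1) for g, while y is only known
    to be at least 1 / (2 (n + 1)). Hence the n^2 in the denominator of
    \<open>drift_bound\<close>.\<close>
  have err: "nrm (Suc n) (\<lambda>j. z j - ?zT j) \<le> \<epsilon> / 2 ^ 10 * y"
  proof -
    have "(14 + 2000 * real ?T) * \<nu> * (16 * ?N) \<le> \<epsilon> / (2 ^ 20 * (real n)\<^sup>2) * (16 * ?N)"
      by (rule mult_right_mono[OF drift_bound[OF m]]) simp
    also have "\<dots> \<le> \<epsilon> / 2 ^ 10 * (1 / (2 * ?N))"
    proof -
      have gen: "\<epsilon> / (2 ^ 20 * v) * (16 * x) \<le> \<epsilon> / 2 ^ 10 * (1 / (2 * x))" if "x * x \<le> 4 * v" "0 < x" "0 < v" for x v :: real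
      proof -
        have "\<epsilon> * (x * x) \<le> \<epsilon> * (4 * v)" using that eps by (intro mult_left_mono) auto
        then have "\<epsilon> * (x * x) \<le> 32 * (\<epsilon> * v)" using eps that by simp
        then show ?thesis using that by (simp add: field_simps)
      qed
      have "?N * ?N \<le> (2 * real n) * (2 * real n)" using n_pos by (intro mult_mono) auto
      then show ?thesis using n_pos by (intro gen) (simp_all add: power2_eq_square)
    qed
    also have "\<dots> \<le> \<epsilon> / 2 ^ 10 * y" using eps by (intro mult_left_mono y) auto
    finally show ?thesis using z by linarith
  qed
  have "\<epsilon> / 2 ^ 10 * y \<le> 1 / 2 ^ 10 * y" using eps y0 by (intro mult_right_mono) auto
  then have err1: "nrm (Suc n) (\<lambda>j. z j - ?zT j) \<le> 1 / 2 ^ 10 * y" using err by linarith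
  then have err2: "nrm (Suc n) (\<lambda>j. z j - ?zT j) \<le> y / 2" using y0 by simp
  have zy: "y \<le> 2 * nrm (Suc n) z"
    using nrm_diff_triangle[of ?zT "Suc n" z] err2 unfolding y_def[symmetric]
    by (simp add: nrm_minus_commute[of ?zT z])
  then show z0: "0 < nrm (Suc n) z" using y0 by linarith
  have "nrm n (mat_app (Suc n) (ah p) (\<lambda>j. z j - ?zT j)) \<le> 2 * B * (\<epsilon> / 2 ^ 10 * y)"
  proof (rule order_trans[OF ah_bound[OF sb]])
    show "2 * \<beta> p * nrm (Suc n) (\<lambda>j. z j - ?zT j) \<le> 2 * B * (\<epsilon> / 2 ^ 10 * y)"
      using B err unfolding B_def by (intro mult_left_mono) auto
  qed
  then have "nrm n (\<lambda>i. mat_app (Suc n) (ah p) z i - mat_app (Suc n) (ah p) ?zT i) \<le> 2 * B * (\<epsilon> / 2 ^ 10 * y)"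
    by (simp add: mat_app_diff)
  then have "nrm n (mat_app (Suc n) (ah p) z) \<le> \<epsilon> / 128 * B * y + 2 * B * (\<epsilon> / 2 ^ 10 * y)"
    using nrm_diff_triangle[of "mat_app (Suc n) (ah p) z" n "mat_app (Suc n) (ah p) ?zT"] w by linarith
  \<comment> \<open>1/128 + 2/2^10 is below 1/100, and y will be at most 100/64 times the norm of
    z.\<close>
  also have "\<dots> \<le> \<epsilon> * B * y / 100" using eps B y0 by (simp add: field_simps)
  also have "\<dots> \<le> \<epsilon> * B * (nrm (Suc n) z) / 64"
  proof -
    have "nrm (Suc n) z \<ge> 64 / 100 * y"
    proof -
      have "nrm (Suc n) (\<lambda>j. z j - ?zT j) \<le> y / 100" using err1 y0 by simp
      then show ?thesis
        using nrm_diff_triangle[of ?zT "Suc n" z] y0 unfolding y_def[symmetric]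
        by (simp add: nrm_minus_commute[of ?zT z])
    qed
    then have "(\<epsilon> * B) * (64 / 100 * y) \<le> (\<epsilon> * B) * nrm (Suc n) z" using eps B by (intro mult_left_mono) auto
    then show ?thesis by (simp add: mult_ac)
  qed
  finally show fin: "nrm n (mat_app (Suc n) (ah p) z) \<le> \<epsilon> / 32 / 2 * \<beta> p * nrm (Suc n) z" by (simp add: B_def)
  \<comment> \<open>If x were 0, the bordered matrix would map z to a multiple of b/|b| of norm
    \<beta> |z|, far above the residual just obtained.\<close>
  show "0 < nrm n z"
  proof (rule ccontr)
    assume "\<not> 0 < nrm n z"
    then have n0: "nrm n z = 0" using L2_set_nonneg[of z "{..<n}"] by linarith
    then have zi: "z i = 0" if "i < n" for i using that by (simp add: L2_set_eq_0_iff)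
    have "(nrm (Suc n) z)\<^sup>2 = \<bar>z n\<bar>\<^sup>2" using nrm_Suc_sq[of z n] n0 by simp
    then have "nrm (Suc n) z = \<bar>z n\<bar>" by (rule power2_eq_imp_eq) auto
    moreover have "nrm n (mat_app (Suc n) (ah p) z) = nrm n (\<lambda>i. (\<beta> p * z n) * bh i)"
      by (rule nrm_cong) (simp only: mat_app_bordered, simp add: mat_app_def zi)
    moreover have "\<dots> = B * \<bar>z n\<bar>" using nrm_scale[of "\<beta> p * z n" bh n] nrm_bh B by (simp add: abs_mult B_def[symmetric])
    ultimately have "B * nrm (Suc n) z \<le> \<epsilon> / 64 * (B * nrm (Suc n) z)" using fin by (simp add: B_def[symmetric])
    moreover have "0 < B * nrm (Suc n) z" using B z0 by simp
    moreover have "\<epsilon> / 64 * (B * nrm (Suc n) z) < 1 * (B * nrm (Suc n) z)" using eps by (intro mult_strict_right_mono calculation) auto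
    ultimately show False by linarith
  qed
qed

end

section \<open>The search over the scales\<close>

definition Attempt :: "nat \<Rightarrow> com" where
  "Attempt C = Seq (Assign 3 (Add (V 3) (N 1))) (Seq (Scale C) (Seq StepSize (Seq Reset (Seq Iterate
     (Seq Product (Seq Measure (Cond (Conj (RLess (ad 1 13) (ad 1 14)) (RLess (ad 1 6) (ad 1 15)))
        (Seq (Assign 5 (N 1)) Output) Skip)))))))"

definition Scan :: "nat \<Rightarrow> com" where
  "Scan C = While (Conj (NLess (V 5) (N 1)) (NLess (V 3) (N (C\<^sup>2 + 1)))) (Attempt C)"

context solver
begin

text \<open>A rejection tells something only about a scale above the norm with a lucky tape, an
  acceptance only about a scale of at most twice the norm. These two one-sided statements suffice
  for the search.\<close>

lemma wp_Attempt:
  assumes s: "ready s" and p: "regs s 3 = p0" "p0 \<le> C\<^sup>2"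
    and m: "regs s 4 = m" "1 / (2 * \<epsilon>) \<le> real m" "real m \<le> 3 / \<epsilon>" and done0: "regs s 5 = 0"
    and Q: "\<And>t. regs t 3 = Suc p0 \<Longrightarrow> regs t 4 = m \<Longrightarrow> queries t = queries s + 2 * iters m + 1 \<Longrightarrow>
      regs t 5 = 0 \<and> ready t \<and> \<not> (sp \<le> \<beta> (Suc p0) \<and> kernel_overlap (Suc p0)) \<or>
      regs t 5 = 1 \<and> (\<beta> (Suc p0) \<le> 2 * sp \<longrightarrow> backward_solution n \<epsilon> A b (result n t)) \<Longrightarrow> Q t"
  shows "wp E (Attempt C) Q s"
  unfolding Attempt_def
proof (rule wp_Seq, rule wp_Assign)
  define p where "p = Suc p0"
  have p1: "1 \<le> p" "p \<le> C\<^sup>2 + 1" using p by (simp_all add: p_def)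
  define t0 where "t0 = set_reg 3 p s"
  have t0: "set_reg 3 (aval (Add (V 3) (N 1)) (regs s)) s = t0" using p by (simp add: t0_def p_def)
  have "real p \<le> real (C\<^sup>2 + 2)" using p1 by (simp del: of_nat_add of_nat_power)
  then show "real (aval (Add (V 3) (N 1)) (regs s)) \<le> wmax E" using wm(2) p by (simp add: p_def)
  have f0: "frame 0 touched {3} s t0" unfolding t0_def by (intro frame_set_reg frame_refl) simp
  have rd0: "ready t0" by (rule ready_frame[OF s f0]) simp
  have p0: "regs t0 3 = p" by (simp add: t0_def)
  let ?R = "{1, 2} :: nat set"
  show "wp E (Seq (Scale C) (Seq StepSize (Seq Reset (Seq Iterate
     (Seq Product (Seq Measure (Cond (Conj (RLess (ad 1 13) (ad 1 14)) (RLess (ad 1 6) (ad 1 15)))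
        (Seq (Assign 5 (N 1)) Output) Skip))))))) Q (set_reg 3 (aval (Add (V 3) (N 1)) (regs s)) s)"
    unfolding t0
  proof (rule wp_Seq, rule wp_Scale[OF rd0 p0 p1])
    fix t1 assume "frame 0 {n + 10, n + 16, n + 17} {} t0 t1" and b1: "ap (12 * \<nu>) (mem t1 ! (n + 10)) (\<beta> p)"
    then have f1: "frame 0 touched ?R t0 t1" by (elim frame_mono) auto
    have rd1: "ready t1" by (rule ready_frame[OF rd0 f1]) simp
    show "wp E (Seq StepSize (Seq Reset (Seq Iterate
     (Seq Product (Seq Measure (Cond (Conj (RLess (ad 1 13) (ad 1 14)) (RLess (ad 1 6) (ad 1 15)))
        (Seq (Assign 5 (N 1)) Output) Skip)))))) Q t1"
    proof (rule wp_Seq, rule wp_StepSize[OF rd1 p1(1) b1])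
      fix t2 assume "frame 0 {n + 11, n + 16, n + 17} {} t1 t2" and sc2: "scaled p t2"
      then have f2: "frame 0 touched ?R t1 t2" by (elim frame_mono) auto
      have rd2: "ready t2" by (rule ready_frame[OF rd1 f2]) simp
      show "wp E (Seq Reset (Seq Iterate
       (Seq Product (Seq Measure (Cond (Conj (RLess (ad 1 13) (ad 1 14)) (RLess (ad 1 6) (ad 1 15)))
          (Seq (Assign 5 (N 1)) Output) Skip))))) Q t2"
      proof (rule wp_Seq, rule wp_Reset[OF rd2])
        fix t3 assume f3: "frame 0 ({n + 2} \<union> {n + 18..<2 * n + 19}) {1} t2 t3"
          and z3: "nrm (Suc n) (\<lambda>j. seg (n + 18) t3 j - g j) \<le> 14 * \<nu> * nrm (Suc n) g"
        have "frame 0 xset {1} t2 t3" by (rule frame_mono[OF f3]) auto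
        then have sc3: "scaled p t3" by (rule scaled_frame[OF sc2])
        have f3': "frame 0 touched ?R t2 t3" by (rule frame_mono[OF f3]) auto
        have rd3: "ready t3" by (rule ready_frame[OF rd2 f3']) simp
        have f03: "frame 0 touched ?R t0 t3"
          using frame_trans[OF frame_trans[OF f1 f2] f3'] by simp
        have m3: "regs t3 4 = m" using frame_regD[OF f03, of 4] m by (simp add: t0_def)
        have "14 * \<nu> * nrm (Suc n) g \<le> 14 * \<nu> * (16 * real (Suc n))"
          using nu_nonneg by (intro mult_left_mono nrm_g) auto
        then have z3': "nrm (Suc n) (\<lambda>j. seg (n + 18) t3 j - g j) \<le> 14 * \<nu> * (16 * real (Suc n))"
          using z3 by linarith
        show "wp E (Seq Iterate
         (Seq Product (Seq Measure (Cond (Conj (RLess (ad 1 13) (ad 1 14)) (RLess (ad 1 6) (ad 1 15)))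
            (Seq (Assign 5 (N 1)) Output) Skip)))) Q t3"
        proof (rule wp_Seq, rule wp_Iterate[OF rd3 sc3 p1(1) m3 m(2,3) z3'])
          fix t4 assume f4: "frame (2 * iters m) xset {1, 2} t3 t4"
            and z4: "sp \<le> \<beta> p \<Longrightarrow> nrm (Suc n) (\<lambda>j. seg (n + 18) t4 j - gd_iter n (Suc n) (ah p) (1 / (4 * (\<beta> p)\<^sup>2)) g (iters m) j)
              \<le> (14 + 2000 * real (iters m)) * \<nu> * (16 * real (Suc n))"
          have sc4: "scaled p t4" by (rule scaled_frame[OF sc3 f4])
          have f4': "frame (2 * iters m) touched ?R t3 t4" by (rule frame_mono[OF f4]) auto
          have rd4: "ready t4" by (rule ready_frame[OF rd3 f4']) simp
          show "wp E (Seq Product (Seq Measure (Cond (Conj (RLess (ad 1 13) (ad 1 14)) (RLess (ad 1 6) (ad 1 15)))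
              (Seq (Assign 5 (N 1)) Output) Skip))) Q t4"
          proof (rule wp_Seq, rule wp_Product[OF rd4 sc4 p1(1)])
            fix t5 assume f5: "frame 1 wset {1} t4 t5"
              and w5: "nrm n (\<lambda>i. seg (4 * n + 21) t5 i - mat_app (Suc n) (ah p) (seg (n + 18) t4) i)
                \<le> 300 * \<nu> * (sp * nrm n (seg (n + 18) t4) + \<beta> p * \<bar>seg (n + 18) t4 n\<bar>)"
            have "frame 1 xset {1} t4 t5" by (rule frame_mono[OF f5]) auto
            then have sc5: "scaled p t5" by (rule scaled_frame[OF sc4])
            have f5': "frame 1 touched ?R t4 t5" by (rule frame_mono[OF f5]) auto
            have rd5: "ready t5" by (rule ready_frame[OF rd4 f5']) simp
            have b5: "ap (12 * \<nu>) (mem t5 ! (n + 10)) (\<beta> p)" using sc5 by (simp add: scaled_def)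
            have x5: "seg (n + 18) t5 i = seg (n + 18) t4 i" if "i < Suc n" for i
              by (rule frame_memD[OF f5]) (use that in auto)
            have nx5: "nrm n (seg (n + 18) t5) = nrm n (seg (n + 18) t4)"
              "nrm (Suc n) (seg (n + 18) t5) = nrm (Suc n) (seg (n + 18) t4)"
              by (rule nrm_cong; rule x5; simp)+
            show "wp E (Seq Measure (Cond (Conj (RLess (ad 1 13) (ad 1 14)) (RLess (ad 1 6) (ad 1 15)))
                (Seq (Assign 5 (N 1)) Output) Skip)) Q t5"
            proof (rule wp_Seq, rule wp_Measure[OF rd5 b5])
              let ?z = "seg (n + 18) t4" and ?w = "seg (4 * n + 21) t5"
              fix t6 assume f6: "frame 0 {n + 2, n + 13, n + 14, n + 15} {1} t5 t6"
                and R: "ap (4 * \<nu>) (mem t6 ! (n + 13)) ((nrm n ?w)\<^sup>2)"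
                and Q6: "ap (258 * \<nu>) (mem t6 ! (n + 14)) ((\<epsilon> / 32)\<^sup>2 * (\<beta> p)\<^sup>2 * (nrm (Suc n) (seg (n + 18) t5))\<^sup>2)"
                and X6: "ap (4 * \<nu>) (mem t6 ! (n + 15)) ((nrm n (seg (n + 18) t5))\<^sup>2)"
              have f6': "frame 0 touched ?R t5 t6" by (rule frame_mono[OF f6]) auto
              have rd6: "ready t6" by (rule ready_frame[OF rd5 f6']) simp
              have sc6: "scaled p t6" using sc5 unfolding scaled_def by (auto simp: frame_memD[OF f6])
              have F06: "frame (2 * iters m + 1) touched ?R t0 t6"
                using frame_trans[OF frame_trans[OF frame_trans[OF f03 f4'] f5'] f6'] by simp
              have r6: "regs t6 3 = p" "regs t6 4 = m" "regs t6 5 = 0" "queries t6 = queries s + 2 * iters m + 1"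
                using F06 m done0 by (simp_all add: frame_def t0_def)
              have l6: "7 * n + 24 \<le> length (mem t6)" "regs t6 0 = n" "mem t6 ! (n + 6) = 0"
                using rd6 by (auto simp: ready_def)
              have x6: "seg (n + 18) t6 i = ?z i" if "i < Suc n" for i
                using frame_memD[OF f6, of "n + 18 + i"] x5[OF that] by simp
              have nx6: "nrm n (seg (n + 18) t6) = nrm n ?z" by (rule nrm_cong) (simp add: x6)
              have nut: "\<nu> \<le> 1 / 2 ^ 20" using nu_tiny by simp
              show "wp E (Cond (Conj (RLess (ad 1 13) (ad 1 14)) (RLess (ad 1 6) (ad 1 15)))
                (Seq (Assign 5 (N 1)) Output) Skip) Q t6"
              proof (rule wp_Cond)
                show "bsafe (Conj (RLess (ad 1 13) (ad 1 14)) (RLess (ad 1 6) (ad 1 15))) t6" using l6 by simp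
              next
                assume rej: "\<not> bval (Conj (RLess (ad 1 13) (ad 1 14)) (RLess (ad 1 6) (ad 1 15))) t6"
                have "\<not> (sp \<le> \<beta> p \<and> kernel_overlap p)"
                proof
                  assume gp: "sp \<le> \<beta> p \<and> kernel_overlap p"
                  note cv = converged[OF m(2,3) conjunct1[OF gp] conjunct2[OF gp] z4[OF conjunct1[OF gp]]]
                  have bp: "0 < \<beta> p" by (rule beta_pos[OF p1(1)])
                  have "mem t6 ! (n + 13) < mem t6 ! (n + 14)"
                  proof (rule test_succeeds[OF _ cv(3) R Q6[unfolded nx5] nu_nonneg nut _ bp cv(1)])
                    have "sp * nrm n ?z + \<beta> p * \<bar>?z n\<bar> \<le> \<beta> p * nrm (Suc n) ?z + \<beta> p * nrm (Suc n) ?z"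
                      using gp bp by (intro add_mono mult_mono nrm_le_Suc abs_le_nrm_Suc) auto
                    then have le: "sp * nrm n ?z + \<beta> p * \<bar>?z n\<bar> \<le> 2 * (\<beta> p * nrm (Suc n) ?z)"
                      by (simp only: mult_2)
                    have "300 * \<nu> * (sp * nrm n ?z + \<beta> p * \<bar>?z n\<bar>) \<le> 300 * \<nu> * (2 * (\<beta> p * nrm (Suc n) ?z))"
                      by (rule mult_left_mono[OF le]) (use nu_nonneg in simp)
                    also have "\<dots> = (600 * \<nu>) * (\<beta> p * nrm (Suc n) ?z)" by simp
                    also have "\<dots> \<le> (\<epsilon> / 32 / 8) * (\<beta> p * nrm (Suc n) ?z)"
                      by (rule mult_right_mono) (use nu_le eps in simp, rule mult_nonneg_nonneg[OF less_imp_le[OF bp]], simp)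
                    finally show "nrm n (\<lambda>i. ?w i - mat_app (Suc n) (ah p) ?z i) \<le> \<epsilon> / 32 / 8 * \<beta> p * nrm (Suc n) ?z"
                      using w5 by (simp only: mult.assoc)
                    show "0 < \<epsilon> / 32" using eps by simp
                  qed
                  moreover have "0 < mem t6 ! (n + 15)"
                    by (rule ap_pos[OF X6[unfolded nx5]]) (use nu_tiny cv(2) in auto)
                  ultimately show False using rej l6 by simp
                qed
                then show "wp E Skip Q t6" using r6 rd6 by (intro wp_Skip Q) (auto simp: p_def)
              next
                assume acc: "bval (Conj (RLess (ad 1 13) (ad 1 14)) (RLess (ad 1 6) (ad 1 15))) t6"
                then have RQ: "mem t6 ! (n + 13) < mem t6 ! (n + 14)" and X0: "0 < mem t6 ! (n + 15)" using l6 by auto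
                define t7 where "t7 = set_reg 5 1 t6"
                have f7: "frame 0 touched {5} t6 t7" unfolding t7_def by (intro frame_set_reg frame_refl) simp
                have rd7: "ready t7" by (rule ready_frame[OF rd6 f7]) simp
                have sc7: "scaled p t7" using sc6 by (simp add: scaled_def t7_def)
                have X7: "ap (4 * \<nu>) (mem t7 ! (n + 15)) ((nrm n (seg (n + 18) t7))\<^sup>2)"
                  using X6 by (simp add: t7_def nx6 nx5)
                have X70: "0 < mem t7 ! (n + 15)" using X0 by (simp add: t7_def)
                show "wp E (Seq (Assign 5 (N 1)) Output) Q t6"
                proof (rule wp_Seq, rule wp_Assign)
                  show "real (aval (N 1) (regs t6)) \<le> wmax E" using wm_small[of 1] n_pos by simp
                  have "wp E Output Q t7"
                  proof (rule wp_Output[OF rd7 sc7 p1(1) X7 X70])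
                    fix t \<tau>
                    assume ft: "frame 0 (touched \<union> {..<n}) {1} t7 t"
                      and \<tau>: "\<bar>\<tau> - seg (n + 18) t7 n\<bar> \<le> 2 * (\<epsilon> / 32) * nrm n (seg (n + 18) t7)" "\<tau> \<noteq> 0"
                      and z0: "0 < nrm n (seg (n + 18) t7)"
                      and y: "\<And>i. i < n \<Longrightarrow> ap (700 * \<nu>) (mem t ! i) (- bn / (\<beta> p * \<tau>) * seg (n + 18) t7 i)"
                    have x7: "seg (n + 18) t7 i = ?z i" if "i < Suc n" for i using x6[OF that] by (simp add: t7_def)
                    have nx7: "nrm n (seg (n + 18) t7) = nrm n ?z" by (rule nrm_cong) (simp only: x7)
                    have rt: "regs t 3 = p" "regs t 4 = m" "regs t 5 = 1" "queries t = queries s + 2 * iters m + 1"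
                      using ft r6 by (simp_all add: frame_def t7_def)
                    have lt: "n \<le> length (mem t)" using frame_lenD[OF ft] l6 by (simp add: t7_def)
                    have "backward_solution n \<epsilon> A b (result n t)" if b2: "\<beta> p \<le> 2 * sp"
                    proof -
                      let ?y = "\<lambda>i. mem t ! i"
                      have nw: "nrm n ?w \<le> 2 * (\<epsilon> / 32) * \<beta> p * nrm (Suc n) ?z"
                        by (rule test_sound[OF RQ R Q6[unfolded nx5] nu_nonneg nut])
                          (use eps less_imp_le[OF beta_pos[OF p1(1)]] in auto)
                      have \<nu>e: "700 * \<nu> \<le> \<epsilon> / 32" using nu_le eps by simp
                      have y': "ap (700 * \<nu>) (mem t ! i) (- bn / (\<beta> p * \<tau>) * ?z i)" if "i < n" for i
                        using y[OF that] x7[of i] that by simp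
                      have e': "0 < \<epsilon> / 32" "\<epsilon> / 32 \<le> 1 / 32" using eps by auto
                      have \<tau>': "\<bar>\<tau> - ?z n\<bar> \<le> 2 * (\<epsilon> / 32) * nrm n ?z" using \<tau>(1) unfolding nx7 x7[OF lessI] .
                      have z0': "0 < nrm n ?z" using z0 unfolding nx7 .
                      note AR = accepted_residual[where y = ?y, OF sp_bound less_imp_le[OF sp_pos] nrm_bh beta_pos[OF p1(1)] b2
                        nu_nonneg \<nu>e e' w5 nw \<tau>' \<tau>(2) b_pos z0' y']
                      have res: "result n t \<in> carrier_vec n" "\<And>i. i < n \<Longrightarrow> result n t $ i = ?y i"
                        unfolding result_def using block_index[of 0 t] lt by auto
                      have ny: "nrm n (vec_index (result n t)) = nrm n ?y" by (rule nrm_cong) (rule res(2))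
                      show ?thesis
                      proof (rule backward_solution_of_residual[OF A b res(1)])
                        show "0 < nrm n (vec_index (result n t))" unfolding ny by (rule AR(1))
                        show "0 \<le> \<epsilon>" using eps by simp
                        have "nrm n (\<lambda>i. mat_app n a (vec_index (result n t)) i - b $ i)
                          = nrm n (\<lambda>i. mat_app n a ?y i - bn * bh i)"
                        proof (rule nrm_cong)
                          fix i
                          have "mat_app n a (vec_index (result n t)) i = mat_app n a ?y i"
                            by (rule mat_app_cong) (simp_all add: res)
                          then show "mat_app n a (vec_index (result n t)) i - b $ i = mat_app n a ?y i - bn * bh i"
                            using b_pos by simp
                        qed
                        then show "nrm n (\<lambda>i. mat_app n a (vec_index (result n t)) i - b $ i)
                          \<le> \<epsilon> * sp * nrm n (vec_index (result n t))"
                          unfolding ny using AR(2) by simp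
                      qed
                    qed
                    then show "Q t" using rt by (intro Q) (auto simp: p_def)
                  qed
                  then show "wp E Output Q (set_reg 5 (aval (N 1) (regs t6)) t6)" by (simp add: t7_def)
                qed
              qed
            qed
          qed
        qed
      qed
    qed
  qed
qed

text \<open>Rejected scales are not good ones, so the search stops no later than at a good p. The
  accepted scale is at most p, hence at most twice the norm, and the acceptance is sound even if
  that scale lies below the norm.\<close>

lemma wp_Scan:
  assumes s: "ready s" and r: "regs s 3 = 0" "regs s 5 = 0"
    and m: "regs s 4 = m" "1 / (2 * \<epsilon>) \<le> real m" "real m \<le> 3 / \<epsilon>"
    and Q: "\<And>t. queries t \<le> queries s + (C\<^sup>2 + 1) * (2 * iters m + 1) \<Longrightarrow>
      ((\<exists>p. 1 \<le> p \<and> p \<le> C\<^sup>2 + 1 \<and> sp \<le> \<beta> p \<and> \<beta> p \<le> 2 * sp \<and> kernel_overlap p) \<Longrightarrow>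
        backward_solution n \<epsilon> A b (result n t)) \<Longrightarrow> Q t"
  shows "wp E (Scan C) Q s"
  unfolding Scan_def
\<comment> \<open>While register 5 is 0, the scale in register 3 has itself been rejected. Once
  register 5 is 1, that scale is the accepted one, and only the strictly smaller ones were
  rejected.\<close>
proof (rule wp_While[where f = "\<lambda>t. C\<^sup>2 + 1 - regs t 3" and I = "\<lambda>t. regs t 3 \<le> C\<^sup>2 + 1 \<and> regs t 4 = m \<and>
    queries t \<le> queries s + regs t 3 * (2 * iters m + 1) \<and>
    (regs t 5 = 0 \<and> ready t \<and> (\<forall>p. 1 \<le> p \<and> p \<le> regs t 3 \<longrightarrow> \<not> (sp \<le> \<beta> p \<and> kernel_overlap p)) \<or>
     regs t 5 = 1 \<and> (\<forall>p. 1 \<le> p \<and> p < regs t 3 \<longrightarrow> \<not> (sp \<le> \<beta> p \<and> kernel_overlap p)) \<and>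
       (\<beta> (regs t 3) \<le> 2 * sp \<longrightarrow> backward_solution n \<epsilon> A b (result n t)))"], goal_cases)
  case 1
  then show ?case using s r m by auto
next
  case (2 t)
  then show ?case by simp
next
  case (3 t)
  show ?case
  proof (rule Q)
    have "regs t 3 * (2 * iters m + 1) \<le> (C\<^sup>2 + 1) * (2 * iters m + 1)" using 3 by (intro mult_right_mono) auto
    then show "queries t \<le> queries s + (C\<^sup>2 + 1) * (2 * iters m + 1)" using 3 by linarith
    assume "\<exists>p. 1 \<le> p \<and> p \<le> C\<^sup>2 + 1 \<and> sp \<le> \<beta> p \<and> \<beta> p \<le> 2 * sp \<and> kernel_overlap p"
    then obtain p where p: "1 \<le> p" "p \<le> C\<^sup>2 + 1" "sp \<le> \<beta> p" "\<beta> p \<le> 2 * sp" "kernel_overlap p" by blast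
    show "backward_solution n \<epsilon> A b (result n t)"
    proof (cases "regs t 5 = 0")
      case True
      then have "regs t 3 = C\<^sup>2 + 1" using 3 by auto
      then show ?thesis using 3 True p by auto
    next
      case False
      then have *: "\<And>p. 1 \<le> p \<Longrightarrow> p < regs t 3 \<Longrightarrow> \<not> (sp \<le> \<beta> p \<and> kernel_overlap p)"
        "\<beta> (regs t 3) \<le> 2 * sp \<longrightarrow> backward_solution n \<epsilon> A b (result n t)" using 3 by auto
      \<comment> \<open>Otherwise p would be among the rejected scales.\<close>
      then have "regs t 3 \<le> p" using p by (meson not_le)
      then have "\<beta> (regs t 3) \<le> \<beta> p" using Z_pos by (intro divide_right_mono mult_right_mono) auto
      then show ?thesis using * p by linarith
    qed
  qed
next
  case (4 t)
  then have t: "ready t" "regs t 5 = 0" "regs t 4 = m" "regs t 3 \<le> C\<^sup>2"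
    "\<And>p. 1 \<le> p \<Longrightarrow> p \<le> regs t 3 \<Longrightarrow> \<not> (sp \<le> \<beta> p \<and> kernel_overlap p)"
    "queries t \<le> queries s + regs t 3 * (2 * iters m + 1)" by auto
  show ?case
  proof (rule wp_Attempt[OF t(1) refl t(4) t(3) m(2,3) t(2)], goal_cases)
    case (1 t')
    have "queries t' \<le> queries s + regs t' 3 * (2 * iters m + 1)" using 1(1,3) t(6) by simp
    moreover have lt: "\<not> (sp \<le> \<beta> p \<and> kernel_overlap p)" if "1 \<le> p" "p < regs t' 3" for p
    proof -
      have "p \<le> regs t 3" using that 1(1) by simp
      then show ?thesis by (rule t(5)[OF that(1)])
    qed
    moreover have "\<not> (sp \<le> \<beta> p \<and> kernel_overlap p)"
      if "1 \<le> p" "p \<le> regs t' 3" "\<not> (sp \<le> \<beta> (Suc (regs t 3)) \<and> kernel_overlap (Suc (regs t 3)))" for p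
    proof (cases "p = Suc (regs t 3)")
      case True
      then show ?thesis using that(3) by blast
    next
      case False
      then have "p < regs t' 3" using that(2) unfolding 1(1) by linarith
      then show ?thesis by (rule lt[OF that(1)])
    qed
    moreover have "regs t' 3 \<le> C\<^sup>2 + 1" "C\<^sup>2 + 1 - regs t' 3 < C\<^sup>2 + 1 - regs t 3" using 1(1) t(4) by auto
    ultimately show ?case using 1(1,2,4) by metis
  qed
qed

end

section \<open>Start vector, constants and an integer of order 1/\<epsilon>\<close>

definition Sample :: com where
  "Sample = For 1 (ad 1 1) (Seq (Flip 6) (Seq (Flip 7) (Seq (Flip 8) (Seq (Flip 9) (Load (Add (ad 2 19) (V 1))
     (Add (V 6) (Add (Mul (N 2) (V 7)) (Add (Mul (N 4) (V 8)) (Mul (N 8) (V 9))))))))))"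

text \<open>\<open>Load\<close> produces natural numbers only, so -1 is computed as 0 - 1 and
  \<epsilon>/32 as a quotient.\<close>

definition Constants :: com where
  "Constants = Seq (Load (ad 1 5) (N 1)) (Seq (Sqrt (ad 1 4) (ad 1 3)) (Seq (Arith FSub (ad 1 7) (ad 1 6) (ad 1 5))
     (Seq (Load (ad 1 16) (N 32)) (Seq (Arith FDiv (ad 1 8) (ad 1 0) (ad 1 16)) (Seq (Arith FMul (ad 1 9) (ad 1 8) (ad 1 8))
     (Seq (Arith FDiv (ad 1 16) (ad 1 5) (ad 1 4)) (Axpy (ad 3 20) (ad 6 23) (ad 1 16) (ad 0 0) (ad 1 0))))))))"

text \<open>No instruction moves a real number into a register; only comparisons carry information
  that way. So 1/\<epsilon> is approximated by counting up until the rounded m \<epsilon> reaches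
  the stored one.\<close>

definition Grid :: com where
  "Grid = Seq (Assign 4 (N 1)) (Seq (Load (ad 1 16) (V 4)) (Seq (Arith FMul (ad 1 16) (ad 1 16) (ad 1 0))
     (While (RLess (ad 1 16) (ad 1 5)) (Seq (Assign 4 (Add (V 4) (N 1))) (Seq (Load (ad 1 16) (V 4))
       (Arith FMul (ad 1 16) (ad 1 16) (ad 1 0)))))))"

definition Small :: com where
  "Small = Seq (Load (ad 1 16) (N 1)) (Seq (MatVec (ad 1 17) (ad 1 16)) (Arith FDiv (ad 0 0) (ad 0 0) (ad 1 17)))"

text \<open>If b = 0, the cells of the result already hold the solution 0, and the program stops at
  once.\<close>

definition Solve :: "nat \<Rightarrow> com" where
  "Solve C = Seq (Dot (ad 1 3) (ad 0 0) (ad 0 0) (ad 1 0)) (Cond (RLess (ad 1 6) (ad 1 3))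
     (Cond (NLess (N 1) (V 0)) (Seq Sample (Seq Constants (Seq Grid (Scan C)))) Small) Skip)"

lemma wp_Flip4:
  assumes "tape s = x1 # x2 # x3 # x4 # w"
    and "wp E c Q (s\<lparr>regs := (regs s)(6 := of_bool x1, 7 := of_bool x2, 8 := of_bool x3, 9 := of_bool x4), tape := w\<rparr>)"
  shows "wp E (Seq (Flip 6) (Seq (Flip 7) (Seq (Flip 8) (Seq (Flip 9) c)))) Q s"
proof -
  let ?s1 = "set_reg 6 (of_bool x1) (s\<lparr>tape := x2 # x3 # x4 # w\<rparr>)"
  let ?s2 = "set_reg 7 (of_bool x2) (?s1\<lparr>tape := x3 # x4 # w\<rparr>)"
  let ?s3 = "set_reg 8 (of_bool x3) (?s2\<lparr>tape := x4 # w\<rparr>)"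
  let ?s4 = "set_reg 9 (of_bool x4) (?s3\<lparr>tape := w\<rparr>)"
  have "?s4 = s\<lparr>regs := (regs s)(6 := of_bool x1, 7 := of_bool x2, 8 := of_bool x3, 9 := of_bool x4), tape := w\<rparr>"
    by (rule state.equality) (simp_all add: set_reg_def)
  then have s4: "wp E c Q ?s4" using assms(2) by (simp only:)
  have s3: "wp E (Seq (Flip 9) c) Q ?s3" by (rule wp_Seq, rule wp_Flip[of ?s3 x4 w], simp, rule s4)
  have s2: "wp E (Seq (Flip 8) (Seq (Flip 9) c)) Q ?s2" by (rule wp_Seq, rule wp_Flip[of ?s2 x3 "x4 # w"], simp, rule s3)
  have s1: "wp E (Seq (Flip 7) (Seq (Flip 8) (Seq (Flip 9) c))) Q ?s1"
    by (rule wp_Seq, rule wp_Flip[of ?s1 x2 "x3 # x4 # w"], simp, rule s2)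
  show ?thesis by (rule wp_Seq, rule wp_Flip[OF assms(1)], rule s1)
qed

lemma drop_four:
  assumes "4 * Suc k \<le> length w"
  shows "drop (4 * k) w = w ! (4 * k) # w ! (4 * k + 1) # w ! (4 * k + 2) # w ! (4 * k + 3) # drop (4 * Suc k) w"
proof -
  have "drop i w = w ! i # drop (Suc i) w" if "i < length w" for i
    using that by (rule Cons_nth_drop_Suc[symmetric])
  from this[of "4 * k"] this[of "4 * k + 1"] this[of "4 * k + 2"] this[of "4 * k + 3"] show ?thesis
    using assms by (simp add: numeral_eq_Suc)
qed

context solver
begin

text \<open>The state before \<open>Constants\<close>: in contrast to \<open>ready\<close>, b is
  still in front and only its squared norm has been computed.\<close>

definition fresh :: "state \<Rightarrow> bool" where
  "fresh t \<longleftrightarrow> 7 * n + 24 \<le> length (mem t) \<and> regs t 0 = n \<and> mem t ! n = \<epsilon> \<and> mem t ! (n + 1) = Z \<and>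
     ap (4 * \<nu>) (mem t ! (n + 3)) (bn\<^sup>2) \<and> mem t ! (n + 6) = 0 \<and> (\<forall>i<n. mem t ! i = b $ i) \<and>
     (\<forall>i<Suc n. seg (6 * n + 23) t i = 0)"

lemma wp_Sample:
  assumes s: "fresh s" and w: "tape s = w" "4 * Suc n \<le> length w" and gw: "\<And>i. g i = real (nibble w i)"
    and Q: "\<And>t. fresh t \<Longrightarrow> (\<And>i. i < Suc n \<Longrightarrow> ap \<nu> (seg (2 * n + 19) t i) (g i)) \<Longrightarrow> queries t = queries s \<Longrightarrow>
      (\<And>r. r \<notin> {1, 6, 7, 8, 9} \<Longrightarrow> regs t r = regs s r) \<Longrightarrow> Q t"
  shows "wp E Sample Q s"
  unfolding Sample_def
proof -
  let ?R = "{1, 6, 7, 8, 9} :: nat set"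
  have r0: "regs s 0 = n" and len: "7 * n + 24 \<le> length (mem s)" using s by (auto simp: fresh_def)
  have w15: "real k \<le> wmax E" if "k \<le> 15" for k :: nat by (rule wm_small) (use that n_pos in simp)
  \<comment> \<open>\<open>frame\<close> insists on equal tapes, so the consumed tape is put into
    the reference state and described separately.\<close>
  let ?I = "\<lambda>k t. frame 0 {2 * n + 19..<2 * n + 19 + k} ?R (s\<lparr>tape := tape t\<rparr>) t \<and> tape t = drop (4 * k) w \<and>
    (\<forall>i<k. ap \<nu> (seg (2 * n + 19) t i) (g i))"
  show "wp E (For 1 (ad 1 1) (Seq (Flip 6) (Seq (Flip 7) (Seq (Flip 8) (Seq (Flip 9) (Load (Add (ad 2 19) (V 1))
     (Add (V 6) (Add (Mul (N 2) (V 7)) (Add (Mul (N 4) (V 8)) (Mul (N 8) (V 9))))))))))) Q s"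
  proof (rule wp_For[where I = ?I and m = "Suc n"])
    show "?I 0 (set_reg 1 0 s)" using w by (auto simp: frame_def)
    show "real (Suc n) \<le> wmax E" by (rule wm_small) (use n_pos in simp)
    show "aval (ad 1 1) (regs t) = Suc n" if "?I k t" for k t using that r0 by (auto simp: frame_def)
    show "Q t" if t: "?I (Suc n) t" for t
    proof (rule Q)
      have m: "mem t ! j = mem s ! j" if "j < 2 * n + 19 \<or> 3 * n + 20 \<le> j" for j
        using t that by (auto simp: frame_def)
      have l: "length (mem t) = length (mem s)" "regs t 0 = n" using t r0 by (auto simp: frame_def)
      have "seg (6 * n + 23) t i = seg (6 * n + 23) s i" for i by (rule m) simp
      moreover have "mem t ! i = mem s ! i" if "i < n" for i by (rule m) (use that in simp)
      moreover have "mem t ! n = mem s ! n" "mem t ! (n + 1) = mem s ! (n + 1)" "mem t ! (n + 3) = mem s ! (n + 3)"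
        "mem t ! (n + 6) = mem s ! (n + 6)" by (rule m; simp)+
      ultimately show "fresh t" using s l by (simp add: fresh_def)
    qed (use t in \<open>auto simp: frame_def\<close>)
    fix k t assume k: "k < Suc n" and t: "?I k t" and rt: "regs t 1 = k"
    have fr: "frame 0 {2 * n + 19..<2 * n + 19 + k} ?R (s\<lparr>tape := tape t\<rparr>) t" using t by blast
    have t0: "regs t 0 = n" "length (mem t) = length (mem s)" "queries t = queries s" using fr r0 by (auto simp: frame_def)
    have tp: "tape t = w ! (4 * k) # w ! (4 * k + 1) # w ! (4 * k + 2) # w ! (4 * k + 3) # drop (4 * Suc k) w"
      using t drop_four[of k w] w(2) k by simp
    have nb: "nibble w k \<le> 15" by (rule nibble_le)
    show "wp E (Seq (Flip 6) (Seq (Flip 7) (Seq (Flip 8) (Seq (Flip 9) (Load (Add (ad 2 19) (V 1))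
     (Add (V 6) (Add (Mul (N 2) (V 7)) (Add (Mul (N 4) (V 8)) (Mul (N 8) (V 9))))))))))
       (\<lambda>t'. regs t' 1 = k \<and> ?I (Suc k) (set_reg 1 (Suc k) t')) t"
    proof (rule wp_Flip4[OF tp], rule wp_Load, goal_cases)
      case 1
      then show ?case using t0 rt len k by simp
    next
      case 2
      then show ?case using w15[OF nb] by (simp add: nibble_def add_ac)
    next
      case (3 \<theta>)
      have ap: "ap \<nu> ((1 + \<theta>) * real (nibble w k)) (g k)" unfolding gw
        by (rule apI[OF refl]) (use 3 u_le_nu in linarith)
      show ?case
      proof (intro conjI allI impI, goal_cases)
        case 1 show ?case using rt by simp
      next
        case 2
        show ?case using fr rt t0 unfolding frame_def by (auto simp: nth_list_update_neq)
      next
        case 3 show ?case by simp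
      next
        case (4 i)
        show ?case
        proof (cases "i = k")
          case True
          then show ?thesis using ap rt t0 len k by (simp add: nibble_def add_ac)
        next
          case False
          then have "i < k" using 4 by simp
          then show ?thesis using t rt t0 by simp
        qed
      qed
    qed
  qed
qed

lemma wp_Constants:
  assumes s: "fresh s" and gs: "\<And>i. i < Suc n \<Longrightarrow> ap \<nu> (seg (2 * n + 19) s i) (g i)"
    and Q: "\<And>t. ready t \<Longrightarrow> queries t = queries s \<Longrightarrow> (\<And>r. r \<noteq> 1 \<Longrightarrow> regs t r = regs s r) \<Longrightarrow> Q t"
  shows "wp E Constants Q s"
  unfolding Constants_def
proof -
  have r0: "regs s 0 = n" and len: "7 * n + 24 \<le> length (mem s)" and me: "mem s ! n = \<epsilon>" and mZ: "mem s ! (n + 1) = Z"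
    and nb: "ap (4 * \<nu>) (mem s ! (n + 3)) (bn\<^sup>2)" and m6: "mem s ! (n + 6) = 0" and mb: "\<And>i. i < n \<Longrightarrow> mem s ! i = b $ i"
    and mO: "\<And>i. i < Suc n \<Longrightarrow> seg (6 * n + 23) s i = 0"
    using s by (auto simp: fresh_def)
  have nbpos: "0 < mem s ! (n + 3)" by (rule ap_pos[OF nb]) (use nu_tiny b_pos in auto)
  have w32: "1 \<le> wmax E" "32 \<le> wmax E" using wm_small[of 1] wm_small[of 32] n_pos by simp_all
  have th: "1 + \<theta> \<noteq> 0" if "\<bar>\<theta>\<bar> \<le> u" for \<theta> using that u_tiny by auto
  have th32: "32 + \<theta> * 32 \<noteq> 0" if "\<bar>\<theta>\<bar> \<le> u" for \<theta>
    using th[OF that] by (simp add: add_eq_0_iff)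
  have B: "0 < bn" by (rule b_pos)
  show "wp E (Seq (Load (ad 1 5) (N 1)) (Seq (Sqrt (ad 1 4) (ad 1 3)) (Seq (Arith FSub (ad 1 7) (ad 1 6) (ad 1 5))
     (Seq (Load (ad 1 16) (N 32)) (Seq (Arith FDiv (ad 1 8) (ad 1 0) (ad 1 16)) (Seq (Arith FMul (ad 1 9) (ad 1 8) (ad 1 8))
     (Seq (Arith FDiv (ad 1 16) (ad 1 5) (ad 1 4)) (Axpy (ad 3 20) (ad 6 23) (ad 1 16) (ad 0 0) (ad 1 0)))))))) ) Q s"
  proof (intro wp_Seq wp_Load wp_Sqrt wp_Arith, goal_cases)
    case (24 \<theta>1 \<theta>2 \<theta>3 \<theta>4 \<theta>5 \<theta>6 \<theta>7)
    define v1 where "v1 = 1 + \<theta>1"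
    define v2 where "v2 = (1 + \<theta>2) * sqrt (mem s ! (n + 3))"
    define v3 where "v3 = (1 + \<theta>3) * (0 - v1)"
    define v4 where "v4 = (1 + \<theta>4) * 32"
    define v5 where "v5 = (1 + \<theta>5) * (\<epsilon> / v4)"
    define v6 where "v6 = (1 + \<theta>6) * (v5 * v5)"
    define v7 where "v7 = (1 + \<theta>7) * (v1 / v2)"
    define t where "t = put (n + 16) v7 (put (n + 9) v6 (put (n + 8) v5 (put (n + 16) v4 (put (n + 7) v3
      (put (n + 4) v2 (put (n + 5) v1 s))))))"
    have a1: "ap \<nu> v1 1" by (rule apI[of _ \<theta>1]) (use 24 u_le_nu in \<open>simp_all add: v1_def\<close>)
    have "ap (4 * \<nu>) (sqrt (mem s ! (n + 3))) (sqrt (bn\<^sup>2))" by (rule ap_sqrt[OF nb]) (use nbpos in auto)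
    then have "ap (4 * \<nu>) (sqrt (mem s ! (n + 3))) bn" using B by simp
    then have "ap (2 * (4 * \<nu> + u)) v2 bn" unfolding v2_def
      by (rule ap_round[OF _ 24(2)]) (use nu_nonneg nu_tiny u_tiny in auto)
    then have a2: "ap (10 * \<nu>) v2 bn" by (rule ap_mono) (use u_le_nu in simp)
    have "ap \<nu> (0 - v1) (- 1)" using a1 by (simp add: ap_def)
    then have "ap (2 * (\<nu> + u)) v3 (- 1)" unfolding v3_def
      by (rule ap_round[OF _ 24(3)]) (use nu_nonneg nu_tiny u_tiny in auto)
    then have a3: "ap (4 * \<nu>) v3 (- 1)" by (rule ap_mono) (use u_le_nu in simp)
    have a4: "ap \<nu> v4 32" unfolding v4_def by (rule apI[OF refl]) (use 24 u_le_nu in linarith)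
    have "ap (2 * (0 + \<nu> + u)) v5 (\<epsilon> / 32)" unfolding v5_def
      by (rule ap_round_div[OF ap_refl a4 24(5)]) (use nu_nonneg nu_tiny u_tiny in auto)
    then have a5: "ap (4 * \<nu>) v5 (\<epsilon> / 32)" by (rule ap_mono) (use u_le_nu in simp)
    have "ap (2 * (4 * \<nu> + 4 * \<nu> + u)) v6 (\<epsilon> / 32 * (\<epsilon> / 32))" unfolding v6_def
      by (rule ap_round_mult[OF a5 a5 24(6)]) (use nu_nonneg nu_tiny u_tiny in auto)
    then have "ap (18 * \<nu>) v6 (\<epsilon> / 32 * (\<epsilon> / 32))" by (rule ap_mono) (use u_le_nu in simp)
    then have a6: "ap (18 * \<nu>) v6 ((\<epsilon> / 32)\<^sup>2)" by (simp only: power2_eq_square)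
    have "ap (2 * (\<nu> + 10 * \<nu> + u)) v7 (1 / bn)" unfolding v7_def
      by (rule ap_round_div[OF a1 a2 24(7)]) (use nu_nonneg nu_tiny u_tiny B in auto)
    then have a7: "ap (24 * \<nu>) v7 (1 / bn)" by (rule ap_mono) (use u_le_nu in simp)
    have rt: "regs t 0 = n" "length (mem t) = length (mem s)" using r0 by (simp_all add: t_def)
    have tm: "mem t ! (n + 16) = v7" using len by (simp add: t_def)
    have tb: "seg 0 t i = b $ i" if "i < n" for i using that mb by (simp add: t_def)
    have tO: "seg (6 * n + 23) t i = 0" if "i < Suc n" for i using that mO by (simp add: t_def)
    have tG: "seg (2 * n + 19) t i = seg (2 * n + 19) s i" for i by (simp add: t_def)
    have "wp E (Axpy (ad 3 20) (ad 6 23) (ad 1 16) (ad 0 0) (ad 1 0)) Q t"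
    proof (rule wp_Axpy[where D = "3 * n + 20" and P = "6 * n + 23" and ?a0.0 = "n + 16" and Q' = 0 and m = n])
      show "addr (ad 3 20) (3 * n + 20)" "addr (ad 6 23) (6 * n + 23)" "addr (ad 1 16) (n + 16)"
        "addr (ad 0 0) 0" "addr (ad 1 0) n" by (auto intro!: addr_ad)
      show "real n \<le> wmax E" by (rule wm_small) simp
      show "u \<le> 1" using u_tiny by simp
      fix t' assume f: "frame 0 ({n + 2} \<union> {3 * n + 20..<3 * n + 20 + n}) {1} t t'"
        and y: "\<And>i. i < n \<Longrightarrow> \<bar>seg (3 * n + 20) t' i - (seg (6 * n + 23) t i + mem t ! (n + 16) * seg 0 t i)\<bar>
          \<le> 3 * u * (\<bar>seg (6 * n + 23) t i\<bar> + \<bar>mem t ! (n + 16) * seg 0 t i\<bar>)"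
      have bh: "ap (110 * \<nu>) (seg (3 * n + 20) t' i) (bh i)" if i: "i < n" for i
      proof -
        let ?y = "v7 * b $ i"
        have "ap (3 * u) (seg (3 * n + 20) t' i) ?y" using y[OF i] tO[of i] tb[OF i] i by (simp add: ap_def tm)
        then obtain \<theta> where \<theta>: "seg (3 * n + 20) t' i = (1 + \<theta>) * ?y" "\<bar>\<theta>\<bar> \<le> 3 * u" using u_nonneg by (elim apE) auto
        have "ap (2 * (24 * \<nu> + 0 + 3 * u)) ((1 + \<theta>) * ?y) (1 / bn * b $ i)"
          by (rule ap_round_mult[OF a7 ap_refl \<theta>(2)]) (use nu_nonneg nu_tiny u_tiny in auto)
        then have "ap (110 * \<nu>) ((1 + \<theta>) * ?y) (1 / bn * b $ i)" by (rule ap_mono) (use u_le_nu nu_nonneg in simp)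
        then show ?thesis unfolding \<theta>(1) by simp
      qed
      have m: "mem t' ! j = mem t ! j" if "j \<noteq> n + 2" "j < 3 * n + 20 \<or> 4 * n + 20 \<le> j" for j
        by (rule frame_memD[OF f]) (use that in auto)
      have mc: "mem t' ! n = \<epsilon>" "mem t' ! (n + 1) = Z" "mem t' ! (n + 4) = v2" "mem t' ! (n + 5) = v1" "mem t' ! (n + 6) = 0"
        "mem t' ! (n + 7) = v3" "mem t' ! (n + 8) = v5" "mem t' ! (n + 9) = v6"
        using len me mZ m6 by (simp_all add: m) (simp_all add: t_def)
      have g': "ap \<nu> (seg (2 * n + 19) t' i) (g i)" if "i < Suc n" for i
        using gs[OF that] that m[of "2 * n + 19 + i"] tG[of i] by simp
      have O': "seg (6 * n + 23) t' i = 0" if "i < Suc n" for i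
        using tO[OF that] m[of "6 * n + 23 + i"] by simp
      have lr: "length (mem t') = length (mem s)" "regs t' 0 = n" using f rt by (auto simp: frame_def)
      show "Q t'"
      proof (rule Q)
        show "ready t'" unfolding ready_def mc using lr len a1 a2 a3 a5 a6 bh g' O' by auto
        show "queries t' = queries s" using f by (simp add: frame_def t_def)
        show "regs t' r = regs s r" if "r \<noteq> 1" for r using f that by (simp add: frame_def t_def)
      qed
    qed (use rt len in auto)
    then show ?case using r0 len me m6
      by (simp add: t_def v1_def v2_def v3_def v4_def v5_def v6_def v7_def)
  qed (use r0 len w32 nbpos th th32 u_tiny in \<open>auto simp: less_imp_le\<close>)
qed

text \<open>Leaving the loop means that m \<epsilon> is at least about 1, entering it that m
  \<epsilon> \<le> 2, so m + 1 \<le> 3/\<epsilon>. The constants 1/2 and 3 absorb the rounding of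
  the comparison.\<close>

lemma wp_Grid:
  assumes s: "ready s"
    and Q: "\<And>t. ready t \<Longrightarrow> queries t = queries s \<Longrightarrow> (\<And>r. r \<noteq> 4 \<Longrightarrow> regs t r = regs s r) \<Longrightarrow>
      1 / (2 * \<epsilon>) \<le> real (regs t 4) \<Longrightarrow> real (regs t 4) \<le> 3 / \<epsilon> \<Longrightarrow> Q t"
  shows "wp E Grid Q s"
proof -
  let ?I = "\<lambda>t. frame 0 {n + 16} {4} s t \<and> ap (4 * \<nu>) (mem t ! (n + 16)) (real (regs t 4) * \<epsilon>) \<and> real (regs t 4) \<le> 3 / \<epsilon>"
  have three: "1 \<le> 1 / \<epsilon>" using eps by simp
  have body: "wp E (Seq (Load (ad 1 16) (V 4)) (Arith FMul (ad 1 16) (ad 1 16) (ad 1 0))) (\<lambda>t'. ?I t' \<and> regs t' 4 = regs t 4) t"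
    if t: "frame 0 {n + 16} {4} s t" "real (regs t 4) \<le> 3 / \<epsilon>" for t
  proof -
    have f: "7 * n + 24 \<le> length (mem t)" "regs t 0 = n" using t s by (auto simp: frame_def ready_def)
    have me: "mem t ! n = \<epsilon>" using frame_memD[OF t(1), of n] s by (simp add: ready_def)
    have "(real n / \<epsilon>) ^ 1 \<le> (real n / \<epsilon>) ^ 3" using n_eps by (intro power_increasing) auto
    then have "3 / \<epsilon> \<le> 3 * (real n / \<epsilon>) ^ 3" using n_eps by simp
    also have "\<dots> \<le> 2 ^ 40 * (real n / \<epsilon>) ^ 3" using eps by (intro mult_right_mono) auto
    finally have wmt: "real (regs t 4) \<le> wmax E" using t(2) wm(1) by linarith
    show ?thesis
    proof (intro wp_Seq wp_Load wp_Arith, goal_cases)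
      case (7 \<theta>1 \<theta>2)
      define v where "v = (1 + \<theta>1) * real (regs t 4)"
      have a1: "ap \<nu> v (real (regs t 4))" unfolding v_def by (rule apI[OF refl]) (use 7 u_le_nu in linarith)
      have "ap (2 * (\<nu> + 0 + u)) ((1 + \<theta>2) * (v * \<epsilon>)) (real (regs t 4) * \<epsilon>)"
        by (rule ap_round_mult[OF a1 ap_refl 7(2)]) (use nu_nonneg nu_tiny u_tiny in auto)
      then have "ap (4 * \<nu>) ((1 + \<theta>2) * (v * \<epsilon>)) (real (regs t 4) * \<epsilon>)" by (rule ap_mono) (use u_le_nu in simp)
      then show ?case using f me t by (auto simp: v_def intro!: frame_put)
    qed (use f wmt in auto)
  qed
  show ?thesis
    unfolding Grid_def
  proof (rule wp_Seq, rule wp_Assign)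
    show "real (aval (N 1) (regs s)) \<le> wmax E" using wm_small[of 1] n_pos by simp
    define t0 where "t0 = set_reg 4 1 s"
    have t0: "frame 0 {n + 16} {4} s t0" "real (regs t0 4) \<le> 3 / \<epsilon>"
      using three by (auto simp: t0_def intro!: frame_set_reg frame_refl)
    \<comment> \<open>The evaluation of m \<epsilon> before the loop is the same code as inside it.
      Regrouping the sequence lets \<open>body\<close> serve both places.\<close>
    have "wp E (Seq (Seq (Load (ad 1 16) (V 4)) (Arith FMul (ad 1 16) (ad 1 16) (ad 1 0)))
      (While (RLess (ad 1 16) (ad 1 5)) (Seq (Assign 4 (Add (V 4) (N 1))) (Seq (Load (ad 1 16) (V 4))
       (Arith FMul (ad 1 16) (ad 1 16) (ad 1 0)))))) Q t0"
    proof (rule wp_Seq, rule wp_mono[OF body[OF t0]])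
      fix t1 assume "?I t1 \<and> regs t1 4 = regs t0 4"
      then have I1: "?I t1" by blast
      show "wp E (While (RLess (ad 1 16) (ad 1 5)) (Seq (Assign 4 (Add (V 4) (N 1))) (Seq (Load (ad 1 16) (V 4))
         (Arith FMul (ad 1 16) (ad 1 16) (ad 1 0))))) Q t1"
      proof (rule wp_While[where I = ?I and f = "\<lambda>t. nat \<lceil>3 / \<epsilon>\<rceil> - regs t 4"])
        show "?I t1" by (rule I1)
      next
        fix t assume "?I t"
        then show "bsafe (RLess (ad 1 16) (ad 1 5)) t" using s by (auto simp: frame_def ready_def)
      next
        fix t assume I: "?I t" and g: "\<not> bval (RLess (ad 1 16) (ad 1 5)) t"
        have fr: "frame 0 {n + 16} {4} s t" using I by blast
        have r: "regs t 0 = n" "mem t ! (n + 5) = mem s ! (n + 5)" using fr s by (auto simp: frame_def ready_def)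
        have "frame 0 touched {4} s t" by (rule frame_mono[OF fr]) auto
        then have rd: "ready t" by (rule ready_frame[OF s]) simp
        have one: "ap \<nu> (mem t ! (n + 5)) 1" using rd by (simp add: ready_def)
        have le: "mem t ! (n + 5) \<le> mem t ! (n + 16)" using g r by simp
        define x where "x = real (regs t 4) * \<epsilon>"
        have x0: "0 \<le> x" using eps by (simp add: x_def)
        have "mem t ! (n + 16) \<le> (1 + 4 * \<nu>) * x" using ap_abs_le[of "4 * \<nu>" "mem t ! (n + 16)" x] I x0 by (simp add: x_def)
        also have "\<dots> \<le> 3/2 * x" using nu_tiny x0 by (intro mult_right_mono) auto
        finally have "1 - \<nu> \<le> 3/2 * x" using one le by (simp add: ap_def)
        then have "1 / 2 \<le> x" using nu_tiny by simp
        then have "1 / (2 * \<epsilon>) \<le> real (regs t 4)" using eps by (simp add: x_def field_simps)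
        then show "Q t" using I rd by (intro Q) (auto simp: frame_def)
      next
        fix t assume I: "?I t" and g: "bval (RLess (ad 1 16) (ad 1 5)) t"
        have fr: "frame 0 {n + 16} {4} s t" using I by blast
        have r: "regs t 0 = n" "mem t ! (n + 5) = mem s ! (n + 5)" using fr s by (auto simp: frame_def ready_def)
        have one: "ap \<nu> (mem t ! (n + 5)) 1" using s r by (simp add: ready_def)
        have lt: "mem t ! (n + 16) < mem t ! (n + 5)" using g r by simp
        define x where "x = real (regs t 4) * \<epsilon>"
        have x0: "0 \<le> x" using eps by (simp add: x_def)
        have "\<bar>mem t ! (n + 16) - x\<bar> \<le> 4 * \<nu> * x" using I x0 by (simp add: ap_def x_def)
        moreover have "4 * \<nu> * x \<le> 1/4 * x" using nu_tiny x0 by (intro mult_right_mono) auto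
        moreover have "mem t ! (n + 5) \<le> 1 + \<nu>" using one by (simp add: ap_def)
        ultimately have "x \<le> 2" using lt nu_tiny by simp
        then have "real (regs t 4) \<le> 2 / \<epsilon>" using eps by (simp add: x_def field_simps)
        then have m3: "real (Suc (regs t 4)) \<le> 3 / \<epsilon>" using three by (simp add: field_simps)
        then have "Suc (regs t 4) \<le> nat \<lceil>3 / \<epsilon>\<rceil>" by linarith
        then have dec: "nat \<lceil>3 / \<epsilon>\<rceil> - Suc (regs t 4) < nat \<lceil>3 / \<epsilon>\<rceil> - regs t 4" by linarith
        have "(real n / \<epsilon>) ^ 1 \<le> (real n / \<epsilon>) ^ 3" using n_eps by (intro power_increasing) auto
        then have "3 / \<epsilon> \<le> 3 * (real n / \<epsilon>) ^ 3" using n_eps by simp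
        also have "\<dots> \<le> 2 ^ 40 * (real n / \<epsilon>) ^ 3" using eps by (intro mult_right_mono) auto
        finally have wmt: "real (Suc (regs t 4)) \<le> wmax E" using m3 wm(1) by linarith
        let ?t' = "set_reg 4 (Suc (regs t 4)) t"
        have f': "frame 0 {n + 16} {4} s ?t'" using fr by (intro frame_set_reg) auto
        show "wp E (Seq (Assign 4 (Add (V 4) (N 1))) (Seq (Load (ad 1 16) (V 4)) (Arith FMul (ad 1 16) (ad 1 16) (ad 1 0))))
          (\<lambda>t'. ?I t' \<and> nat \<lceil>3 / \<epsilon>\<rceil> - regs t' 4 < nat \<lceil>3 / \<epsilon>\<rceil> - regs t 4) t"
        proof (rule wp_Seq, rule wp_Assign)
          show "real (aval (Add (V 4) (N 1)) (regs t)) \<le> wmax E" using wmt by simp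
          have "wp E (Seq (Load (ad 1 16) (V 4)) (Arith FMul (ad 1 16) (ad 1 16) (ad 1 0)))
            (\<lambda>t'. ?I t' \<and> nat \<lceil>3 / \<epsilon>\<rceil> - regs t' 4 < nat \<lceil>3 / \<epsilon>\<rceil> - regs t 4) ?t'"
            by (rule wp_mono[OF body[OF f']]) (use m3 dec in auto)
          then show "wp E (Seq (Load (ad 1 16) (V 4)) (Arith FMul (ad 1 16) (ad 1 16) (ad 1 0)))
            (\<lambda>t'. ?I t' \<and> nat \<lceil>3 / \<epsilon>\<rceil> - regs t' 4 < nat \<lceil>3 / \<epsilon>\<rceil> - regs t 4)
            (set_reg 4 (aval (Add (V 4) (N 1)) (regs t)) t)" by simp
        qed
      qed
    qed
    then have "wp E (Seq (Load (ad 1 16) (V 4)) (Seq (Arith FMul (ad 1 16) (ad 1 16) (ad 1 0))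
      (While (RLess (ad 1 16) (ad 1 5)) (Seq (Assign 4 (Add (V 4) (N 1))) (Seq (Load (ad 1 16) (V 4))
       (Arith FMul (ad 1 16) (ad 1 16) (ad 1 0))))))) Q t0"
      unfolding wp_def by (blast elim: exec.cases intro: exec.Seq)
    then show "wp E (Seq (Load (ad 1 16) (V 4)) (Seq (Arith FMul (ad 1 16) (ad 1 16) (ad 1 0))
      (While (RLess (ad 1 16) (ad 1 5)) (Seq (Assign 4 (Add (V 4) (N 1))) (Seq (Load (ad 1 16) (V 4))
       (Arith FMul (ad 1 16) (ad 1 16) (ad 1 0))))))) Q (set_reg 4 (aval (N 1) (regs s)) s)" by (simp add: t0_def)
  qed
qed

text \<open>In dimension one the norm is the modulus of the single entry, so the error of a query is
  a relative error of that entry and the quotient is accurate up to 10 \<nu>, far below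
  \<epsilon>.\<close>

lemma wp_Small:
  assumes s: "fresh s" and n1: "n = 1"
    and Q: "\<And>t. queries t = queries s + 1 \<Longrightarrow> backward_solution n \<epsilon> A b (result n t) \<Longrightarrow> Q t"
  shows "wp E Small Q s"
  unfolding Small_def
proof (rule wp_Seq, rule wp_Load, goal_cases)
  case 1 then show ?case using s by (auto simp: fresh_def)
next
  case 2 then show ?case using wm_small[of 1] n_pos by simp
next
  case (3 \<theta>1)
  have r0: "regs s 0 = 1" and len: "31 \<le> length (mem s)" and m0: "mem s ! 0 = b $ 0"
    using s[unfolded fresh_def] n1 by auto
  define t1 where "t1 = put 17 (1 + \<theta>1) s"
  have c1: "put (aval (ad 1 16) (regs s)) ((1 + \<theta>1) * real (aval (N 1) (regs s))) s = t1" using r0 by (simp add: t1_def)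
  have nrm1: "nrm n f = \<bar>f 0\<bar>" for f using n1 by (simp add: L2_set_def)
  have ma: "mat_app n a z 0 = a 0 0 * z 0" for z using n1 by (simp add: mat_app_def)
  have spa: "sp \<le> \<bar>a 0 0\<bar>"
    by (rule spectral_norm_le[OF A]) (simp_all add: nrm1 ma abs_mult)
  then have a0: "a 0 0 \<noteq> 0" using sp_pos by auto
  have spa': "\<bar>a 0 0\<bar> \<le> sp" using sp_bound[of "\<lambda>_. 1"] by (simp add: nrm1 ma)
  have v: "ap \<nu> (1 + \<theta>1) 1" by (rule apI[of _ \<theta>1]) (use 3 u_le_nu in auto)
  show ?case
    unfolding c1
  proof (rule wp_Seq, rule wp_MatVec[of _ _ 18 _ 17])
    show "aval (ad 1 17) (regs t1) = 18" "aval (ad 1 16) (regs t1) = 17" using r0 by (simp_all add: t1_def)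
    show "18 + n \<le> length (mem t1)" "17 + n \<le> length (mem t1)" using len n1 by (simp_all add: t1_def)
    fix t2 assume f2: "frame 1 {18..<18 + n} {} t1 t2"
      and F2: "nrm n (\<lambda>i. seg 18 t2 i - mat_app n a (seg 17 t1) i) \<le> u * sp * nrm n (seg 17 t1)"
    have m17: "mem t1 ! 17 = 1 + \<theta>1" using len by (simp add: t1_def)
    have sa: "sp = \<bar>a 0 0\<bar>" using spa spa' by simp
    have "ap u (mem t2 ! 18) ((1 + \<theta>1) * a 0 0)"
      using F2 unfolding nrm1 ma by (simp add: m17 ap_def sa abs_mult mult_ac)
    then obtain \<theta> where \<theta>: "mem t2 ! 18 = (1 + \<theta>) * ((1 + \<theta>1) * a 0 0)" "\<bar>\<theta>\<bar> \<le> u" using u_nonneg by (elim apE) auto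
    have "ap (2 * (\<nu> + 0 + u)) (mem t2 ! 18) (1 * a 0 0)" unfolding \<theta>(1)
      by (rule ap_round_mult[OF v ap_refl \<theta>(2)]) (use nu_nonneg nu_tiny u_tiny in auto)
    then have a2: "ap (4 * \<nu>) (mem t2 ! 18) (a 0 0)" by (simp, elim ap_mono) (use u_le_nu in simp)
    have nz: "mem t2 ! 18 \<noteq> 0" by (rule ap_nonzero[OF a2 _ a0]) (use nu_tiny in simp)
    have r2: "regs t2 0 = 1" "length (mem t2) = length (mem s)" "mem t2 ! 0 = b $ 0" "queries t2 = queries s + 1"
      using f2 r0 m0 by (auto simp: frame_def t1_def)
    show "wp E (Arith FDiv (ad 0 0) (ad 0 0) (ad 1 17)) Q t2"
    proof (rule wp_Arith, goal_cases)
      case (5 \<theta>2)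
      define y where "y = (1 + \<theta>2) * (b $ 0 / mem t2 ! 18)"
      have "ap (2 * (0 + 4 * \<nu> + u)) y (b $ 0 / a 0 0)" unfolding y_def
        by (rule ap_round_div[OF ap_refl a2 5]) (use nu_nonneg nu_tiny u_tiny a0 in auto)
      then have ya: "ap (10 * \<nu>) y (b $ 0 / a 0 0)" by (rule ap_mono) (use u_le_nu in simp)
      have b0: "0 < \<bar>b $ 0\<bar>" using b_pos unfolding nrm1 .
      define t where "t = put 0 y t2"
      have lt: "n \<le> length (mem t)" using r2 len n1 by (simp add: t_def)
      have "0 < length (mem t2)" using r2 len by linarith
      then have y0: "mem t ! 0 = y" by (simp add: t_def)
      have res: "result n t \<in> carrier_vec n" "result n t $ 0 = y"
        unfolding result_def using block_index[of 0 t] lt n1 y0 by auto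
      have e1: "\<bar>a 0 0 * y - b $ 0\<bar> \<le> 10 * \<nu> * \<bar>b $ 0\<bar>"
      proof -
        have "\<bar>a 0 0 * y - b $ 0\<bar> = \<bar>a 0 0\<bar> * \<bar>y - b $ 0 / a 0 0\<bar>"
          unfolding abs_mult[symmetric] using a0 by (simp add: right_diff_distrib)
        also have "\<dots> \<le> \<bar>a 0 0\<bar> * (10 * \<nu> * \<bar>b $ 0 / a 0 0\<bar>)" using ya unfolding ap_def by (intro mult_left_mono) auto
        also have "\<dots> = 10 * \<nu> * \<bar>b $ 0\<bar>" using a0 by (simp add: abs_divide)
        finally show ?thesis .
      qed
      have "10 * \<nu> * \<bar>b $ 0\<bar> \<le> \<epsilon> / 4 * \<bar>b $ 0\<bar>" using nu_le eps by (intro mult_right_mono) auto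
      then have e2: "\<bar>a 0 0 * y - b $ 0\<bar> \<le> \<epsilon> / 4 * \<bar>b $ 0\<bar>" using e1 by linarith
      have "\<epsilon> / 4 * \<bar>b $ 0\<bar> \<le> 1 / 4 * \<bar>b $ 0\<bar>" using eps by (intro mult_right_mono) auto
      then have e3: "\<bar>b $ 0\<bar> \<le> 2 * (sp * \<bar>y\<bar>)" using e2 b0 unfolding sa abs_mult[symmetric] by linarith
      have "backward_solution n \<epsilon> A b (result n t)"
      proof (rule backward_solution_of_residual[OF A b res(1)])
        show "0 < nrm n (vec_index (result n t))" unfolding nrm1 res using e3 b0 sp_pos by (cases "y = 0") auto
        show "0 \<le> \<epsilon>" using eps by simp
        have "\<epsilon> / 4 * \<bar>b $ 0\<bar> \<le> \<epsilon> / 4 * (2 * (sp * \<bar>y\<bar>))" using e3 eps by (intro mult_left_mono) auto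
        also have "\<dots> \<le> \<epsilon> * sp * \<bar>y\<bar>" using eps sp_pos by simp
        finally show "nrm n (\<lambda>i. mat_app n a (vec_index (result n t)) i - b $ i) \<le> \<epsilon> * sp * nrm n (vec_index (result n t))"
          using e2 unfolding nrm1 ma res by linarith
      qed
      then have "Q t" using r2 by (intro Q) (auto simp: t_def)
      then show ?case using r2 by (simp add: t_def y_def)
    qed (use r2 len nz in auto)
  qed
qed

end

section \<open>The complete program\<close>

lemma init_state_mem:
  assumes "b \<in> carrier_vec n" "28 \<le> K" "1 \<le> n"
  shows "7 * n + 24 \<le> length (mem (init_state K n \<epsilon> b Z w))"
    and "i < n \<Longrightarrow> mem (init_state K n \<epsilon> b Z w) ! i = b $ i"
    and "mem (init_state K n \<epsilon> b Z w) ! n = \<epsilon>" "mem (init_state K n \<epsilon> b Z w) ! (n + 1) = Z"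
    and "n + 2 \<le> i \<Longrightarrow> i < 7 * n + 24 \<Longrightarrow> mem (init_state K n \<epsilon> b Z w) ! i = 0"
proof -
  have l: "length (list_of_vec b) = n" using assms by simp
  \<comment> \<open>As n \<ge> 1, 28 n \<ge> 6 n + 22, and together with the n + 2 input cells this
    makes the 7 n + 24 cells in use.\<close>
  have "28 * n \<le> K * n" using assms by (intro mult_right_mono) auto
  then have Kn: "6 * n + 22 \<le> K * n" using assms by linarith
  show "7 * n + 24 \<le> length (mem (init_state K n \<epsilon> b Z w))" using Kn l by (simp add: init_state_def)
  show "i < n \<Longrightarrow> mem (init_state K n \<epsilon> b Z w) ! i = b $ i"
    using l by (simp add: init_state_def nth_append list_of_vec_index)
  show "mem (init_state K n \<epsilon> b Z w) ! n = \<epsilon>" "mem (init_state K n \<epsilon> b Z w) ! (n + 1) = Z"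
    using l by (simp_all add: init_state_def nth_append)
  assume i: "n + 2 \<le> i" "i < 7 * n + 24"
  then obtain j where j: "i = n + (2 + j)" by (metis add.assoc le_Suc_ex)
  then have "j < K * n" using i Kn by linarith
  then show "mem (init_state K n \<epsilon> b Z w) ! i = 0"
    unfolding j using l by (simp add: init_state_def nth_append)
qed

lemma init_state_simps:
  "regs (init_state K n \<epsilon> b Z w) 0 = n" "r \<noteq> 0 \<Longrightarrow> regs (init_state K n \<epsilon> b Z w) r = 0"
  "tape (init_state K n \<epsilon> b Z w) = w" "queries (init_state K n \<epsilon> b Z w) = 0"
  by (simp_all add: init_state_def)

context machine
begin

lemma backward_solution_zero:
  assumes "0 \<le> \<epsilon>"
  shows "backward_solution n \<epsilon> A (0\<^sub>v n) (0\<^sub>v n)"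
  unfolding backward_solution_def
proof (intro bexI[of _ A] conjI)
  show "A *\<^sub>v 0\<^sub>v n = 0\<^sub>v n" using A by auto
  have AA: "A - A = 0\<^sub>m n n" using A by (intro eq_matI) auto
  show "spectral_norm (A - A) \<le> \<epsilon> * sp"
  proof (rule spectral_norm_le)
    show "A - A \<in> carrier_mat n n" using A by (rule minus_carrier_mat)
    show L: "0 \<le> \<epsilon> * sp" using assms spectral_norm_nonneg[OF A] by simp
    fix z
    have "nrm n (mat_app n (mfun (A - A)) z) = nrm n (\<lambda>_. 0)"
      unfolding AA by (rule nrm_cong) (simp add: mat_app_def)
    also have "\<dots> = 0" by (simp add: L2_set_def)
    also have "0 \<le> \<epsilon> * sp * nrm n z" by (rule mult_nonneg_nonneg[OF L L2_set_nonneg])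
    finally show "nrm n (mat_app n (mfun (A - A)) z) \<le> \<epsilon> * sp * nrm n z" .
  qed
qed (rule A)

lemma wp_Solve_zero:
  assumes K: "28 \<le> K" and \<epsilon>: "0 \<le> \<epsilon>" and w: "real n \<le> wmax E" "4 * real n * u \<le> 1"
  shows "wp E (Solve C) (\<lambda>t. queries t = 0 \<and> backward_solution n \<epsilon> A (0\<^sub>v n) (result n t)) (init_state K n \<epsilon> (0\<^sub>v n) Z w')"
  unfolding Solve_def
proof (rule wp_Seq, rule wp_Dot[where D = "n + 3" and P = 0 and Q' = 0 and m = n])
  let ?s = "init_state K n \<epsilon> (0\<^sub>v n) Z w'"
  have b: "0\<^sub>v n \<in> carrier_vec n" by simp
  note i = init_state_mem[OF b K n_pos, where \<epsilon> = \<epsilon> and Z = Z and w = w']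
  show "regs ?s 0 = n" by (rule init_state_simps)
  show "addr (ad 1 3) (n + 3)" "addr (ad 0 0) 0" "addr (ad 0 0) 0" "addr (ad 1 0) n" by (auto intro!: addr_ad)
  show "n + 3 < length (mem ?s)" "n + 2 < length (mem ?s)" "0 + n \<le> length (mem ?s)" "0 + n \<le> length (mem ?s)"
    using i(1) by auto
  fix t assume f: "frame 0 {n + 3, n + 2} {1} ?s t"
    and d: "\<bar>mem t ! (n + 3) - ip n (seg 0 ?s) (seg 0 ?s)\<bar>
      \<le> 4 * real n * u * (\<Sum>i<n. \<bar>seg 0 ?s i\<bar> * \<bar>seg 0 ?s i\<bar>)"
  have z: "seg 0 ?s j = 0" if "j < n" for j using i(2)[OF that] that by simp
  \<comment> \<open>For b = 0 the error bound of the dot product is itself 0, so the test for b = 0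
    is exact.\<close>
  have m3: "mem t ! (n + 3) = 0" using d z by (simp add: ip_def)
  have m6: "mem t ! (n + 6) = 0" using frame_memD[OF f, of "n + 6"] i(5)[of "n + 6"] by simp
  have l: "7 * n + 24 \<le> length (mem t)" "regs t 0 = n" "queries t = 0"
    using f i(1) by (auto simp: frame_def init_state_simps)
  have mz: "mem t ! j = 0" if "j < n" for j
    using frame_memD[OF f, of j] z[OF that] that by simp
  have "result n t = 0\<^sub>v n"
  proof (rule eq_vecI)
    fix j assume "j < dim_vec (0\<^sub>v n :: real Matrix.vec)"
    then show "result n t $ j = 0\<^sub>v n $ j" using block_index(2)[of 0 t j] l mz[of j] by (simp add: result_def)
  qed (use block_index(1)[of 0 t] l in \<open>simp add: result_def\<close>)
  then have sol: "backward_solution n \<epsilon> A (0\<^sub>v n) (result n t)" using backward_solution_zero[OF \<epsilon>] by simp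
  show "wp E (Cond (RLess (ad 1 6) (ad 1 3))
     (Cond (NLess (N 1) (V 0)) (Seq Sample (Seq Constants (Seq Grid (Scan C)))) Small) Skip)
     (\<lambda>t. queries t = 0 \<and> backward_solution n \<epsilon> A (0\<^sub>v n) (result n t)) t"
  proof (rule wp_Cond)
    assume "bval (RLess (ad 1 6) (ad 1 3)) t"
    then show "wp E (Cond (NLess (N 1) (V 0)) (Seq Sample (Seq Constants (Seq Grid (Scan C)))) Small)
       (\<lambda>t. queries t = 0 \<and> backward_solution n \<epsilon> A (0\<^sub>v n) (result n t)) t" using m3 m6 l by simp
  qed (use l sol in \<open>auto intro: wp_Skip\<close>)
qed (use w in auto)

end

context solver
begin

text \<open>Termination and the number of queries do not depend on luck; the tape enters only
  through \<open>kernel_overlap\<close>.\<close>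

lemma wp_Solve:
  assumes K: "28 \<le> K" and w: "n = 1 \<or> 4 * Suc n \<le> length w" and gw: "\<And>i. g i = real (nibble w i)"
  shows "wp E (Solve C) (\<lambda>t. real (queries t) \<le> real (C\<^sup>2 + 1) * 2 ^ 29 * (real n / \<epsilon>\<^sup>2) \<and>
    (n = 1 \<or> (\<exists>p. 1 \<le> p \<and> p \<le> C\<^sup>2 + 1 \<and> sp \<le> \<beta> p \<and> \<beta> p \<le> 2 * sp \<and> kernel_overlap p) \<longrightarrow>
      backward_solution n \<epsilon> A b (result n t))) (init_state K n \<epsilon> b Z w)"
    (is "wp E _ ?Q _")
  unfolding Solve_def
proof (rule wp_Seq, rule wp_Dot[where D = "n + 3" and P = 0 and Q' = 0 and m = n])
  let ?s = "init_state K n \<epsilon> b Z w"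
  note i = init_state_mem[OF b K n_pos, where \<epsilon> = \<epsilon> and Z = Z and w = w]
  have ne: "1 \<le> real n / \<epsilon>\<^sup>2"
  proof -
    have "\<epsilon>\<^sup>2 \<le> 1" using eps by (simp add: power_le_one)
    then show ?thesis using n_pos eps by (simp add: le_divide_eq)
  qed
  show "regs ?s 0 = n" by (rule init_state_simps)
  show "addr (ad 1 3) (n + 3)" "addr (ad 0 0) 0" "addr (ad 0 0) 0" "addr (ad 1 0) n" by (auto intro!: addr_ad)
  show "n + 3 < length (mem ?s)" "n + 2 < length (mem ?s)" "0 + n \<le> length (mem ?s)" "0 + n \<le> length (mem ?s)"
    using i(1) by auto
  show "real n \<le> wmax E" by (rule wm_small) simp
  fix t assume f: "frame 0 {n + 3, n + 2} {1} ?s t"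
    and d: "\<bar>mem t ! (n + 3) - ip n (seg 0 ?s) (seg 0 ?s)\<bar>
      \<le> 4 * real n * u * (\<Sum>i<n. \<bar>seg 0 ?s i\<bar> * \<bar>seg 0 ?s i\<bar>)"
  have z: "seg 0 ?s j = b $ j" if "j < n" for j using i(2)[OF that] by simp
  have "nrm n (seg 0 ?s) = bn" by (rule nrm_cong) (rule z)
  then have nb: "ap (4 * \<nu>) (mem t ! (n + 3)) (bn\<^sup>2)" using ap_of_dot[OF d] by (simp only: dot_small)
  have m: "mem t ! j = mem ?s ! j" if "j \<noteq> n + 3" "j \<noteq> n + 2" for j
    by (rule frame_memD[OF f]) (use that in auto)
  have l: "7 * n + 24 \<le> length (mem t)" "regs t 0 = n" "queries t = 0" "tape t = w"
    "\<And>r. r \<noteq> 0 \<Longrightarrow> r \<noteq> 1 \<Longrightarrow> regs t r = 0"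
    using f i(1) by (auto simp: frame_def init_state_simps)
  have fr: "fresh t"
    unfolding fresh_def
  proof (intro conjI allI impI)
    show "mem t ! n = \<epsilon>" "mem t ! (n + 1) = Z" "mem t ! (n + 6) = 0" using i(3,4) i(5)[of "n + 6"] by (simp_all add: m)
    show "mem t ! j = b $ j" if "j < n" for j using i(2)[OF that] that by (simp add: m)
    show "seg (6 * n + 23) t j = 0" if "j < Suc n" for j using i(5)[of "6 * n + 23 + j"] that by (simp add: m)
  qed (use l nb in auto)
  have nbpos: "0 < mem t ! (n + 3)" by (rule ap_pos[OF nb]) (use nu_tiny b_pos in auto)
  show "wp E (Cond (RLess (ad 1 6) (ad 1 3))
     (Cond (NLess (N 1) (V 0)) (Seq Sample (Seq Constants (Seq Grid (Scan C)))) Small) Skip) ?Q t"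
  proof (rule wp_Cond)
    show "bsafe (RLess (ad 1 6) (ad 1 3)) t" using l by simp
    assume "\<not> bval (RLess (ad 1 6) (ad 1 3)) t"
    then show "wp E Skip ?Q t" using nbpos fr l by (simp add: fresh_def)
  next
    show "wp E (Cond (NLess (N 1) (V 0)) (Seq Sample (Seq Constants (Seq Grid (Scan C)))) Small) ?Q t"
    proof (rule wp_Cond)
      assume "\<not> bval (NLess (N 1) (V 0)) t"
      then have n1: "n = 1" using l n_pos by simp
      show "wp E Small ?Q t"
      proof (rule wp_Small[OF fr n1])
        fix t' assume q: "queries t' = queries t + 1" and sol: "backward_solution n \<epsilon> A b (result n t')"
        have "1 * 1 * 1 \<le> real (C\<^sup>2 + 1) * 2 ^ 29 * (real n / \<epsilon>\<^sup>2)" using ne by (intro mult_mono) auto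
        then show "?Q t'" using q sol l by simp
      qed
    next
      assume "bval (NLess (N 1) (V 0)) t"
      then have n1: "n \<noteq> 1" using l by simp
      then have w': "4 * Suc n \<le> length w" using w by blast
      show "wp E (Seq Sample (Seq Constants (Seq Grid (Scan C)))) ?Q t"
      proof (rule wp_Seq, rule wp_Sample[OF fr l(4) w' gw])
        fix t1 assume fr1: "fresh t1" and g1: "\<And>i. i < Suc n \<Longrightarrow> ap \<nu> (seg (2 * n + 19) t1 i) (g i)"
          and q1: "queries t1 = queries t" and r1: "\<And>r. r \<notin> {1, 6, 7, 8, 9} \<Longrightarrow> regs t1 r = regs t r"
        show "wp E (Seq Constants (Seq Grid (Scan C))) ?Q t1"
        proof (rule wp_Seq, rule wp_Constants[OF fr1 g1])
          fix t2 assume rd2: "ready t2" and q2: "queries t2 = queries t1" and r2: "\<And>r. r \<noteq> 1 \<Longrightarrow> regs t2 r = regs t1 r"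
          show "wp E (Seq Grid (Scan C)) ?Q t2"
          proof (rule wp_Seq, rule wp_Grid[OF rd2])
            fix t3 assume rd3: "ready t3" and q3: "queries t3 = queries t2" and r3: "\<And>r. r \<noteq> 4 \<Longrightarrow> regs t3 r = regs t2 r"
              and m3: "1 / (2 * \<epsilon>) \<le> real (regs t3 4)" "real (regs t3 4) \<le> 3 / \<epsilon>"
            have z3: "regs t3 3 = 0" "regs t3 5 = 0" using r1 r2 r3 l(5) by auto
            have q0: "queries t3 = 0" using q1 q2 q3 l(3) by simp
            show "wp E (Scan C) ?Q t3"
            proof (rule wp_Scan[OF rd3 z3 refl m3])
              fix t4 assume q4: "queries t4 \<le> queries t3 + (C\<^sup>2 + 1) * (2 * iters (regs t3 4) + 1)"
                and sol: "\<exists>p. 1 \<le> p \<and> p \<le> C\<^sup>2 + 1 \<and> sp \<le> \<beta> p \<and> \<beta> p \<le> 2 * sp \<and> kernel_overlap p \<Longrightarrow>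
                  backward_solution n \<epsilon> A b (result n t4)"
              have "real (queries t4) \<le> real ((C\<^sup>2 + 1) * (2 * iters (regs t3 4) + 1))"
                using q4 q0 by (simp del: of_nat_add of_nat_mult of_nat_power)
              also have "\<dots> = real (C\<^sup>2 + 1) * (2 * real (iters (regs t3 4)) + 1)" by (simp only: of_nat_mult) simp
              also have "\<dots> \<le> real (C\<^sup>2 + 1) * (2 ^ 29 * (real n / \<epsilon>\<^sup>2))"
              proof (rule mult_left_mono)
                have "real (iters (regs t3 4)) \<le> 2 ^ 27 * (real n / \<epsilon>\<^sup>2)" using iters_bounds(2)[OF m3] by simp
                then show "2 * real (iters (regs t3 4)) + 1 \<le> 2 ^ 29 * (real n / \<epsilon>\<^sup>2)" using ne by simp
              qed simp
              finally show "?Q t4" using sol n1 by (simp only: mult.assoc simp_thms) blast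
            qed
          qed
        qed
      qed
    qed simp
  qed
qed (use dot_small in auto)

text \<open>Rounding x = C ||A|| / Z up gives the first scale not below the norm. As Z is within a
  factor C of the norm, 1 \<le> x \<le> C^2, and rounding up adds at most 1, which at most doubles
  x.\<close>

lemma good_scale: "\<exists>p. 1 \<le> p \<and> p \<le> C\<^sup>2 + 1 \<and> sp \<le> \<beta> p \<and> \<beta> p \<le> 2 * sp"
proof -
  define x where "x = sp * real C / Z"
  define p where "p = nat \<lceil>x\<rceil>"
  have C0: "0 < real C" using C by simp
  have x1: "1 \<le> x" using Z(2) Z_pos by (simp add: x_def mult_ac)
  have x2: "x \<le> (real C)\<^sup>2"
  proof -
    have "sp * real C \<le> (real C * Z) * real C" using Z(1) by (intro mult_right_mono) auto
    then show ?thesis using Z_pos by (simp add: x_def power2_eq_square field_simps)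
  qed
  have p: "x \<le> real p" "real p \<le> x + 1" using x1 unfolding p_def by linarith+
  have "real p \<le> real (C\<^sup>2 + 1)" using p(2) x2 by simp
  then have "p \<le> C\<^sup>2 + 1" by (simp only: of_nat_le_iff)
  moreover have "1 \<le> p" using p(1) x1 by linarith
  moreover have "sp = x * Z / real C" using Z_pos C0 by (simp add: x_def)
  moreover have "x * Z / real C \<le> \<beta> p" using p(1) Z_pos C0 by (intro divide_right_mono mult_right_mono) auto
  moreover have "\<beta> p \<le> 2 * x * Z / real C" using p(2) x1 Z_pos C0 by (intro divide_right_mono mult_right_mono) auto
  ultimately show ?thesis by (intro exI[of _ p]) (simp add: mult_ac)
qed

end

section \<open>From the precision to numerical bounds\<close>

lemma machine_of_admissible:
  assumes "1 \<le> n" "A \<in> carrier_mat n n" "0 \<le> u" "admissible_env K n \<epsilon> u A E"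
  shows "machine E n u A"
  using assms by (simp add: machine_def admissible_env_def)

text \<open>The lower bound 1 in \<open>lg\<close> gives L \<ge> 2, so numerical constants can be
  absorbed into powers of L.\<close>

lemma precision_bounds:
  assumes n: "1 \<le> n" and \<epsilon>: "0 < \<epsilon>" "\<epsilon> < 1"
  defines "L \<equiv> 2 powr precision n \<epsilon>"
  shows "2 \<le> L" "real n / \<epsilon> \<le> L" "2 powr (real k * precision n \<epsilon>) = L ^ k"
    "2 powr (- 100 * precision n \<epsilon>) = 1 / L ^ 100"
proof -
  have p: "1 \<le> precision n \<epsilon>" "log 2 (real n / \<epsilon>) \<le> precision n \<epsilon>" by (simp_all add: precision_def lg_def)
  have "2 powr 1 \<le> L" unfolding L_def using p(1) by (intro powr_mono) auto
  then show "2 \<le> L" by simp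
  have "2 powr log 2 (real n / \<epsilon>) \<le> L" unfolding L_def using p(2) by (intro powr_mono) auto
  then show "real n / \<epsilon> \<le> L" using n \<epsilon> by simp
  have pw: "L ^ j = 2 powr (real j * precision n \<epsilon>)" for j
    unfolding L_def by (simp add: powr_powr powr_realpow[symmetric] mult.commute)
  then show "2 powr (real k * precision n \<epsilon>) = L ^ k" by simp
  show "2 powr (- 100 * precision n \<epsilon>) = 1 / L ^ 100"
    unfolding pw by (simp add: powr_minus divide_inverse)
qed

text \<open>One number for all roles of K: memory, tape length, word size and query factor. 2^29
  n/\<epsilon>^2 bounds the queries of one scale, and at most C^2 + 1 scales are tried.\<close>

definition work :: "nat \<Rightarrow> nat" where
  "work C = 2 ^ 29 * (C\<^sup>2 + 2)"

lemma work_ge: "2 ^ 29 \<le> work C" "C\<^sup>2 + 2 \<le> work C"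
  by (simp_all add: work_def)

text \<open>The literals of the program grow with C, so the word size must do so too; it does
  through K. The 2^40 is absorbed as L^40.\<close>

lemma word_size:
  assumes "1 \<le> n" "0 < \<epsilon>" "\<epsilon> < 1" "admissible_env (work C) n \<epsilon> u A E"
  shows "2 ^ 40 * (real n / \<epsilon>) ^ 3 \<le> wmax E" "real (C\<^sup>2 + 2) \<le> wmax E"
proof -
  define L where "L = 2 powr precision n \<epsilon>"
  note pb = precision_bounds[OF assms(1-3), folded L_def]
  have wE: "wmax E = L ^ work C" using assms(4) pb(3)[of "work C"] by (simp add: admissible_env_def)
  have "2 ^ 40 * (real n / \<epsilon>) ^ 3 \<le> L ^ 40 * L ^ 3" using pb assms(2) by (intro mult_mono power_mono) auto
  also have "\<dots> = L ^ 43" by (simp add: power_add[symmetric])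
  also have "\<dots> \<le> L ^ work C" using pb work_ge(1)[of C] by (intro power_increasing) auto
  finally show "2 ^ 40 * (real n / \<epsilon>) ^ 3 \<le> wmax E" by (simp add: wE)
  have "C\<^sup>2 + 2 < 2 ^ work C" using work_ge(2)[of C] less_exp[of "work C"] by linarith
  then have "real (C\<^sup>2 + 2) \<le> real (2 ^ work C)" by (simp only: of_nat_le_iff less_imp_le)
  also have "\<dots> \<le> L ^ work C" using pb(1) by (simp add: power_mono)
  finally show "real (C\<^sup>2 + 2) \<le> wmax E" by (simp add: wE)
qed

text \<open>2^60 consumes 60 factors L and the powers of n/\<epsilon> five more. The exponent 100 is
  a rounder choice, independent of C.\<close>

lemma precision_small:
  assumes "1 \<le> n" "0 < \<epsilon>" "\<epsilon> < 1" "0 \<le> u" "u \<le> 2 powr (- 100 * precision n \<epsilon>)"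
  shows "u * 2 ^ 60 * (real n / \<epsilon>) ^ 5 \<le> 1"
proof -
  define L where "L = 2 powr precision n \<epsilon>"
  note pb = precision_bounds[OF assms(1-3), folded L_def]
  have u: "u \<le> 1 / L ^ 100" using assms(5) by (simp only: pb(4))
  have L0: "0 < L ^ k" for k using pb(1) by simp
  have "u * 2 ^ 60 * (real n / \<epsilon>) ^ 5 \<le> (1 / L ^ 100) * L ^ 60 * L ^ 5"
    using u pb assms(2,4) L0 by (intro mult_mono power_mono) (auto simp: less_imp_le)
  also have "\<dots> = L ^ 65 / L ^ 100" by (simp add: power_add[symmetric])
  also have "\<dots> \<le> 1" using pb(1) L0[of 100] power_increasing[of 65 100 L] by (simp add: divide_le_eq)
  finally show ?thesis .
qed

text \<open>The program makes only order n/\<epsilon>^2 queries; a further factor 1/\<epsilon> and a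
  logarithm of at least 1 are given away.\<close>

lemma query_bound_ge:
  assumes "1 \<le> n" "0 < \<epsilon>" "\<epsilon> < 1"
  shows "real (C\<^sup>2 + 1) * 2 ^ 29 * (real n / \<epsilon>\<^sup>2) \<le> query_bound (work C) n \<epsilon>"
proof -
  have lg: "1 \<le> lg (1 / \<epsilon>)" by (simp add: lg_def)
  have "real n / \<epsilon>\<^sup>2 \<le> real n / \<epsilon> ^ 3"
    using assms by (intro divide_left_mono) (auto simp: power_decreasing)
  also have "\<dots> = real n * 1 / \<epsilon> ^ 3" by simp
  also have "\<dots> \<le> real n * lg (1 / \<epsilon>) / \<epsilon> ^ 3"
    using lg assms by (intro divide_right_mono mult_left_mono) auto
  finally have a: "real n / \<epsilon>\<^sup>2 \<le> real n * lg (1 / \<epsilon>) / \<epsilon> ^ 3" .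
  have "real ((C\<^sup>2 + 1) * 2 ^ 29) \<le> real (work C)" by (simp only: of_nat_le_iff work_def) simp
  then have b: "real (C\<^sup>2 + 1) * 2 ^ 29 \<le> real (work C)" by simp
  show ?thesis unfolding query_bound_def using a b assms by (intro mult_mono) auto
qed

text \<open>For n \<ge> 2 the logarithm is at least 1 and 4 (n + 1) \<le> 8 n. For n = 1 the
  logarithm is 0 and the tape is empty.\<close>

lemma tape_length:
  assumes "2 \<le> n" "w \<in> random_tapes (work C) n"
  shows "4 * Suc n \<le> length w"
proof -
  have "1 \<le> log 2 (real n)" using assms(1) by (simp add: le_log_iff)
  then have "real n * 1 \<le> real n * log 2 (real n)" by (intro mult_left_mono) auto
  moreover have K: "8 \<le> real (work C)" using work_ge(1)[of C] by simp
  ultimately have "8 * real n \<le> real (work C) * (real n * log 2 (real n))" by (intro mult_mono) auto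
  then have "8 * real n \<le> real (work C) * real n * log 2 (real n)" by (simp add: mult.assoc)
  then have "int (8 * n) \<le> \<lfloor>real (work C) * real n * log 2 (real n)\<rfloor>" by (simp add: le_floor_iff)
  then have "8 * n \<le> length w" using assms(2) by (simp add: random_tapes_def)
  then show ?thesis using assms(1) by simp
qed

lemma prob_all_tapes:
  assumes "\<And>w. w \<in> random_tapes K n \<Longrightarrow> w \<in> S"
  shows "measure_pmf.prob (pmf_of_set (random_tapes K n)) S \<ge> 0.9"
proof -
  let ?L = "nat \<lfloor>real K * real n * log 2 (real n)\<rfloor>"
  have fin: "finite (random_tapes K n)"
    unfolding random_tapes_def using finite_lists_length_eq[of "UNIV :: bool set" ?L] by simp
  have ne: "random_tapes K n \<noteq> {}" unfolding random_tapes_def using Ex_list_of_length[of ?L] by blast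
  have "random_tapes K n \<inter> S = random_tapes K n" using assms by blast
  then show ?thesis using measure_pmf_of_set[OF ne fin, of S] fin ne by simp
qed

theorem theorem9p11:
  shows "\<exists>c>0. \<forall>C\<ge>1. \<exists>(P :: com) (K :: nat).
    \<forall>(n :: nat) (\<epsilon> :: real) (A :: real mat) (b :: real Matrix.vec) (Z :: real) (u :: real).
      n \<ge> 1 \<longrightarrow> 0 < \<epsilon> \<longrightarrow> \<epsilon> < 1 \<longrightarrow>
      A \<in> carrier_mat n n \<longrightarrow> b \<in> carrier_vec n \<longrightarrow> (A = 0\<^sub>m n n \<longrightarrow> b = 0\<^sub>v n) \<longrightarrow>
      spectral_norm A / C \<le> Z \<longrightarrow> Z \<le> C * spectral_norm A \<longrightarrow>
      0 \<le> u \<longrightarrow> u \<le> 2 powr (- c * precision n \<epsilon>) \<longrightarrow>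
      (\<forall>w \<in> random_tapes K n. \<forall>E. admissible_env K n \<epsilon> u A E \<longrightarrow>
         (\<exists>t. exec E P (init_state K n \<epsilon> b Z w) t \<and> real (queries t) \<le> query_bound K n \<epsilon>)) \<and>
      measure_pmf.prob (pmf_of_set (random_tapes K n))
        {w. \<forall>E. admissible_env K n \<epsilon> u A E \<longrightarrow>
           (\<exists>t. exec E P (init_state K n \<epsilon> b Z w) t \<and>
                backward_solution n \<epsilon> A b (result n t))} \<ge> 0.9"
proof (intro exI[of _ "100::real"] conjI allI impI, simp)
  fix C :: real assume C: "C \<ge> 1"
  \<comment> \<open>The program contains its approximation factor as a natural number literal;
    rounding C up only weakens the condition on Z.\<close>
  define D where "D = nat \<lceil>C\<rceil>"
  have D: "C \<le> real D" "1 \<le> D" using C unfolding D_def by linarith+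
  show "\<exists>(P :: com) (K :: nat).
    \<forall>(n :: nat) (\<epsilon> :: real) (A :: real mat) (b :: real Matrix.vec) (Z :: real) (u :: real).
      n \<ge> 1 \<longrightarrow> 0 < \<epsilon> \<longrightarrow> \<epsilon> < 1 \<longrightarrow>
      A \<in> carrier_mat n n \<longrightarrow> b \<in> carrier_vec n \<longrightarrow> (A = 0\<^sub>m n n \<longrightarrow> b = 0\<^sub>v n) \<longrightarrow>
      spectral_norm A / C \<le> Z \<longrightarrow> Z \<le> C * spectral_norm A \<longrightarrow>
      0 \<le> u \<longrightarrow> u \<le> 2 powr (- 100 * precision n \<epsilon>) \<longrightarrow>
      (\<forall>w \<in> random_tapes K n. \<forall>E. admissible_env K n \<epsilon> u A E \<longrightarrow>
         (\<exists>t. exec E P (init_state K n \<epsilon> b Z w) t \<and> real (queries t) \<le> query_bound K n \<epsilon>)) \<and>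
      measure_pmf.prob (pmf_of_set (random_tapes K n))
        {w. \<forall>E. admissible_env K n \<epsilon> u A E \<longrightarrow>
           (\<exists>t. exec E P (init_state K n \<epsilon> b Z w) t \<and>
                backward_solution n \<epsilon> A b (result n t))} \<ge> 0.9"
  proof (rule exI[of _ "Solve D"], rule exI[of _ "work D"], intro allI impI)
    fix n :: nat and \<epsilon> :: real and A :: "real mat" and b :: "real Matrix.vec" and Z u :: real
    let ?K = "work D" and ?P = "Solve D" and ?s = "spectral_norm A"
    assume n: "1 \<le> n" and \<epsilon>: "0 < \<epsilon>" "\<epsilon> < 1" and A: "A \<in> carrier_mat n n" and b: "b \<in> carrier_vec n"
      and Ab: "A = 0\<^sub>m n n \<longrightarrow> b = 0\<^sub>v n" and Z: "?s / C \<le> Z" "Z \<le> C * ?s"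
      and u: "0 \<le> u" "u \<le> 2 powr (- 100 * precision n \<epsilon>)"
    have K28: "28 \<le> ?K" using work_ge(1)[of D] by simp
    note small = precision_small[OF n \<epsilon> u]
    note ws = word_size[OF n \<epsilon>]
    have ne: "1 \<le> real n / \<epsilon>" "real n \<le> real n / \<epsilon>" using n \<epsilon> by (simp_all add: field_simps)
    show "(\<forall>w \<in> random_tapes ?K n. \<forall>E. admissible_env ?K n \<epsilon> u A E \<longrightarrow>
         (\<exists>t. exec E ?P (init_state ?K n \<epsilon> b Z w) t \<and> real (queries t) \<le> query_bound ?K n \<epsilon>)) \<and>
      measure_pmf.prob (pmf_of_set (random_tapes ?K n))
        {w. \<forall>E. admissible_env ?K n \<epsilon> u A E \<longrightarrow>
           (\<exists>t. exec E ?P (init_state ?K n \<epsilon> b Z w) t \<and>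
                backward_solution n \<epsilon> A b (result n t))} \<ge> 0.9"
    \<comment> \<open>This case includes A = 0, so in the other one the norm is positive.\<close>
    proof (cases "b = 0\<^sub>v n")
      case True
      have qb: "0 \<le> query_bound ?K n \<epsilon>" using \<epsilon> by (simp add: query_bound_def lg_def)
      have run: "\<exists>t. exec E ?P (init_state ?K n \<epsilon> b Z w) t \<and> queries t = 0 \<and> backward_solution n \<epsilon> A b (result n t)"
        if E: "admissible_env ?K n \<epsilon> u A E" for w E
      proof -
        interpret machine E n u A by (rule machine_of_admissible[OF n A u(1) E])
        have "(real n / \<epsilon>) ^ 1 \<le> (real n / \<epsilon>) ^ 3" "(real n / \<epsilon>) ^ 1 \<le> (real n / \<epsilon>) ^ 5"
          using ne by (intro power_increasing; simp)+
        then have n3: "real n \<le> (real n / \<epsilon>) ^ 3" "real n \<le> (real n / \<epsilon>) ^ 5" using ne by simp_all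
        have "real n \<le> wmax E" using ws(1)[OF E] n3(1) by simp
        moreover have "4 * real n * u \<le> 1"
        proof -
          have "u * 2 ^ 60 * real n \<le> u * 2 ^ 60 * (real n / \<epsilon>) ^ 5" using n3(2) u(1) by (intro mult_left_mono) auto
          then have "u * 2 ^ 60 * real n \<le> 1" using small by linarith
          moreover have "0 \<le> u * real n" using u(1) by simp
          ultimately show ?thesis by (simp add: mult_ac)
        qed
        ultimately show ?thesis using wp_Solve_zero[OF K28, of \<epsilon> D Z w] \<epsilon> unfolding wp_def True by auto
      qed
      show ?thesis
      proof (intro conjI ballI allI impI prob_all_tapes CollectI)
        fix w E assume E: "admissible_env ?K n \<epsilon> u A E"
        show "\<exists>t. exec E ?P (init_state ?K n \<epsilon> b Z w) t \<and> real (queries t) \<le> query_bound ?K n \<epsilon>"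
          using run[OF E, of w] qb by force
        show "\<exists>t. exec E ?P (init_state ?K n \<epsilon> b Z w) t \<and> backward_solution n \<epsilon> A b (result n t)"
          using run[OF E, of w] by blast
      qed
    next
      case False
      have s: "0 < ?s" using spectral_norm_pos[OF A] Ab False by blast
      have bpos: "0 < nrm n (vec_index b)"
      proof -
        have "nrm n (vec_index b) \<noteq> 0" using False b by (auto simp: L2_set_eq_0_iff vec_eq_iff)
        then show ?thesis using L2_set_nonneg[of "vec_index b" "{..<n}"] by linarith
      qed
      have "0 < ?s / C" using s C by simp
      then have Z0: "0 < Z" using Z(1) by linarith
      have ZD: "?s \<le> real D * Z" "Z \<le> real D * ?s"
      proof -
        have "?s \<le> C * Z" using Z(1) C by (simp add: field_simps)
        also have "\<dots> \<le> real D * Z" using D Z0 by (intro mult_right_mono) auto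
        finally show "?s \<le> real D * Z" .
        have "C * ?s \<le> real D * ?s" using D s by (intro mult_right_mono) auto
        then show "Z \<le> real D * ?s" using Z(2) by linarith
      qed
      have sol: "solver E n u A b \<epsilon> Z D (\<lambda>i. real (nibble w i))" if E: "admissible_env ?K n \<epsilon> u A E" for E w
      proof -
        have "real (nibble w i) \<le> 15" for i using nibble_le[of w i] by simp
        then show ?thesis
          using b bpos s \<epsilon> small D(2) ZD ws[OF E]
          by (intro solver.intro machine_of_admissible[OF n A u(1) E] solver_axioms.intro) auto
      qed
      have w4: "n = 1 \<or> 4 * Suc n \<le> length w" if "w \<in> random_tapes ?K n" for w
        using tape_length[OF _ that] n by (cases "n = 1") auto
      \<comment> \<open>\<open>kernel_overlap\<close> is written out so that the condition on the
        tape visibly does not mention \<open>E\<close>.\<close>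
      have run: "\<exists>t. exec E ?P (init_state ?K n \<epsilon> b Z w) t \<and> real (queries t) \<le> query_bound ?K n \<epsilon> \<and>
          (n = 1 \<or> (\<exists>p. 1 \<le> p \<and> p \<le> D\<^sup>2 + 1 \<and> ?s \<le> real p * Z / real D \<and> real p * Z / real D \<le> 2 * ?s \<and>
            (\<exists>e. nrm (Suc n) e = 1 \<and> (\<forall>i<n. mat_app (Suc n) (bordered n (mfun A) (real p * Z / real D) (\<lambda>i. b $ i / nrm n (vec_index b))) e i = 0) \<and>
              1 / (2 * real (Suc n)) \<le> \<bar>ip (Suc n) (\<lambda>i. real (nibble w i)) e\<bar>)) \<longrightarrow>
           backward_solution n \<epsilon> A b (result n t))"
        if w: "w \<in> random_tapes ?K n" and E: "admissible_env ?K n \<epsilon> u A E" for w E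
      proof -
        interpret solver E n u A b \<epsilon> Z D "\<lambda>i. real (nibble w i)" by (rule sol[OF E])
        from wp_Solve[OF K28 w4[OF w] refl] obtain t where t: "exec E ?P (init_state ?K n \<epsilon> b Z w) t"
            "real (queries t) \<le> real (D\<^sup>2 + 1) * 2 ^ 29 * (real n / \<epsilon>\<^sup>2)"
            "n = 1 \<or> (\<exists>p. 1 \<le> p \<and> p \<le> D\<^sup>2 + 1 \<and> ?s \<le> real p * Z / real D \<and> real p * Z / real D \<le> 2 * ?s \<and> kernel_overlap p) \<longrightarrow>
              backward_solution n \<epsilon> A b (result n t)"
          unfolding wp_def by (elim exE conjE)
        show ?thesis
        proof (rule exI[of _ t], intro conjI)
          show "exec E ?P (init_state ?K n \<epsilon> b Z w) t" by (rule t(1))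
          show "real (queries t) \<le> query_bound ?K n \<epsilon>" by (rule order_trans[OF t(2) query_bound_ge[OF n \<epsilon>]])
        qed (rule t(3)[unfolded kernel_overlap_def])
      qed
      show ?thesis
      proof (intro conjI ballI allI impI)
        fix w E assume "w \<in> random_tapes ?K n" "admissible_env ?K n \<epsilon> u A E"
        from run[OF this] show "\<exists>t. exec E ?P (init_state ?K n \<epsilon> b Z w) t \<and> real (queries t) \<le> query_bound ?K n \<epsilon>"
          by blast
      next
        show "measure_pmf.prob (pmf_of_set (random_tapes ?K n))
          {w. \<forall>E. admissible_env ?K n \<epsilon> u A E \<longrightarrow>
             (\<exists>t. exec E ?P (init_state ?K n \<epsilon> b Z w) t \<and> backward_solution n \<epsilon> A b (result n t))} \<ge> 0.9"
        \<comment> \<open>An admissible environment is needed to enter \<open>solver\<close> and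
          obtain the scale p. Neither p nor the null vector e depends on it, so a single event for
          the tape covers all environments at once.\<close>
        proof (cases "n = 1 \<or> (\<forall>E. \<not> admissible_env ?K n \<epsilon> u A E)")
          case True
          show ?thesis
          proof (rule prob_all_tapes, rule CollectI, intro allI impI)
            fix w E assume w: "w \<in> random_tapes ?K n" and E: "admissible_env ?K n \<epsilon> u A E"
            show "\<exists>t. exec E ?P (init_state ?K n \<epsilon> b Z w) t \<and> backward_solution n \<epsilon> A b (result n t)"
              using run[OF w E] True E by blast
          qed
        next
          case False
          then obtain E0 where E0: "admissible_env ?K n \<epsilon> u A E0" and n2: "2 \<le> n" using n by force
          have "\<exists>p. 1 \<le> p \<and> p \<le> D\<^sup>2 + 1 \<and> ?s \<le> real p * Z / real D \<and> real p * Z / real D \<le> 2 * ?s"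
            by (rule solver.good_scale[OF sol[OF E0, of "[]"]])
          then obtain p where p: "1 \<le> p" "p \<le> D\<^sup>2 + 1" "?s \<le> real p * Z / real D" "real p * Z / real D \<le> 2 * ?s" by blast
          obtain e where e: "nrm (Suc n) e = 1"
            "\<And>i. i < n \<Longrightarrow> mat_app (Suc n) (bordered n (mfun A) (real p * Z / real D) (\<lambda>i. b $ i / nrm n (vec_index b))) e i = 0"
            using wide_matrix_kernel[of n "bordered n (mfun A) (real p * Z / real D) (\<lambda>i. b $ i / nrm n (vec_index b))"] by blast
          obtain k where k: "k < Suc n" "1 / sqrt (real (Suc n)) \<le> \<bar>e k\<bar>" by (rule unit_vector_large_entry[OF e(1)])
          have ek: "1 / real (Suc n) \<le> \<bar>e k\<bar>"
          proof -
            have "sqrt (real (Suc n)) \<le> real (Suc n)" by (rule real_le_lsqrt) (simp_all add: power2_eq_square algebra_simps)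
            then have "1 / real (Suc n) \<le> 1 / sqrt (real (Suc n))" by (intro divide_left_mono) auto
            then show ?thesis using k(2) by linarith
          qed
          have "0 < 1 / real (Suc n)" by simp
          then have ek0: "e k \<noteq> 0" using ek by linarith
          let ?L = "nat \<lfloor>real ?K * real n * log 2 (real n)\<rfloor>"
          \<comment> \<open>Any tape will do here: it only serves to read off the lower bound for
            the common length of all tapes.\<close>
          have "replicate ?L True \<in> random_tapes ?K n" by (simp add: random_tapes_def)
          from tape_length[OF n2 this] have L: "4 * Suc n \<le> ?L" by simp
          show ?thesis
            unfolding random_tapes_def
          proof (rule prob_large_inner_product[OF k(1) L, of e], rule ek0, rule CollectI, intro allI impI)
            fix w :: "bool list" and E
            assume lw: "length w = ?L" and ip: "\<bar>e k\<bar> / 2 \<le> \<bar>ip (Suc n) (\<lambda>j. real (nibble w j)) e\<bar>"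
              and E: "admissible_env ?K n \<epsilon> u A E"
            have w: "w \<in> random_tapes ?K n" using lw by (simp add: random_tapes_def)
            have "1 / (2 * real (Suc n)) = 1 / real (Suc n) / 2" by simp
            also have "\<dots> \<le> \<bar>e k\<bar> / 2" using ek by (rule divide_right_mono) simp
            finally have "1 / (2 * real (Suc n)) \<le> \<bar>ip (Suc n) (\<lambda>i. real (nibble w i)) e\<bar>" using ip by linarith
            then show "\<exists>t. exec E ?P (init_state ?K n \<epsilon> b Z w) t \<and> backward_solution n \<epsilon> A b (result n t)"
              using run[OF w E] p e by blast
          qed
        qed
      qed
    qed
  qed
qed

end
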